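(* Let $\zeta(\theta)=-4\cos(2\theta)+\cos(4\theta)$ and let $\Omega_t=\{x\in\mathbb{R}^2: r<1+t\zeta(\theta)\}$, a smooth domain symmetric about both coordinate axes, where $(r,\theta)$ are polar coordinates of $x$. Let $u(\cdot,t)$ be the torsion function of $\Omega_t$ and set $\Gamma^{++}=\partial\Omega_t\cap\{x_1\ge 0,\ x_2\ge 0\}$. Then for all sufficiently small $t>0$: (1) the maximum of $|\nabla u(\cdot,t)|$ on $\Gamma^{++}$ is achieved at exactly one point $\bar P_t$, with corresponding polar angle $\theta=\bar\vartheta(t)=\bar\theta+O(t)$, where $\bar\theta=\arccos(\sqrt{2/3})$; (2) the minimum of the curvature $\kappa(\cdot,t)$ of $\Gamma^{++}$ is achieved at exactly one point $\hat P_t$, with corresponding polar angle $\theta=\hat\vartheta(t)=\hat\theta+O(t)$, where $\hat\theta=\arccos(\sqrt{3/5})$; (3) the minimum of the distance function $x\in\Gamma^{++}\mapsto|x|$ is achieved at exactly one point $\tilde P_t$, with corresponding polar angle $\theta=0$, which corresponds to an end of the shorter axis.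
   Context: The torsion function of a bounded domain $\Omega$ is the solution $u$ of $-\Delta u=1$ in $\Omega$, $u=0$ on $\partial\Omega$. The curvature of $\partial\Omega_t$ is taken with the sign convention that the unit circle has curvature $+1$, i.e. $\kappa(\theta,t)=\dfrac{(1+t\zeta)^2+2(t\zeta')^2-(1+t\zeta)(t\zeta'')}{[(1+t\zeta)^2+(t\zeta')^2]^{3/2}}$ at the boundary point with polar angle $\theta$. *)

theory Defs
  imports "HOL-Analysis.Analysis" "HOL-Library.Landau_Symbols"
begin

text \<open>
  The plane is identified with the type \<^typ>\<open>complex\<close>, with \<open>x\<^sub>1 = Re x\<close>, \<open>x\<^sub>2 = Im x\<close> and polar
  coordinates \<open>r = norm x\<close>, \<open>\<theta> = Arg x\<close>.  The inner product, norm and basis of \<^typ>\<open>complex\<close> as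
  a Euclidean space are those of the real plane.
\<close>

definition partial_deriv :: "'a::euclidean_space \<Rightarrow> ('a \<Rightarrow> real) \<Rightarrow> 'a \<Rightarrow> real" where
  "partial_deriv b f x = frechet_derivative f (at x) b"

text \<open>Twice continuously differentiable; only meant for open \<open>S\<close>.\<close>

definition C2_on :: "'a::euclidean_space set \<Rightarrow> ('a \<Rightarrow> real) \<Rightarrow> bool" where
  "C2_on S f \<longleftrightarrow>
     (\<forall>x\<in>S. f differentiable (at x)) \<and>
     (\<forall>b\<in>Basis. \<forall>x\<in>S. partial_deriv b f differentiable (at x)) \<and>
     (\<forall>b\<in>Basis. \<forall>c\<in>Basis. continuous_on S (partial_deriv c (partial_deriv b f)))"

definition laplacian :: "('a::euclidean_space \<Rightarrow> real) \<Rightarrow> 'a \<Rightarrow> real" where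
  "laplacian f x = (\<Sum>b\<in>Basis. partial_deriv b (partial_deriv b f) x)"

text \<open>
  The torsion function is understood as the classical solution of the Dirichlet problem.  No
  regularity at the boundary beyond continuity is built in, and the values of \<open>u\<close> outside
  \<open>closure \<Omega>\<close> are irrelevant.
\<close>

definition torsion_function :: "'a::euclidean_space set \<Rightarrow> ('a \<Rightarrow> real) \<Rightarrow> bool" where
  "torsion_function \<Omega> u \<longleftrightarrow>
     C2_on \<Omega> u \<and> continuous_on (closure \<Omega>) u \<and>
     (\<forall>x\<in>\<Omega>. - laplacian u x = 1) \<and>
     (\<forall>x\<in>frontier \<Omega>. u x = 0)"

text \<open>
  At a boundary point of a domain \<open>\<Omega>\<close> the gradient is the one-sided one, obtained with the
  filter \<open>at x within closure \<Omega>\<close>.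
\<close>

definition gradient :: "('a::euclidean_space \<Rightarrow> real) \<Rightarrow> 'a filter \<Rightarrow> 'a" where
  "gradient f F = (\<Sum>b\<in>Basis. frechet_derivative f F b *\<^sub>R b)"

definition zeta :: "real \<Rightarrow> real" where
  "zeta \<theta> = - 4 * cos (2 * \<theta>) + cos (4 * \<theta>)"

definition Omega :: "real \<Rightarrow> complex set" where
  "Omega t = {x. norm x < 1 + t * zeta (Arg x)}"

definition Gamma_pp :: "real \<Rightarrow> complex set" where
  "Gamma_pp t = frontier (Omega t) \<inter> {x. Re x \<ge> 0 \<and> Im x \<ge> 0}"

text \<open>
  Curvature of the polar curve \<open>r = 1 + t \<zeta>(\<theta>)\<close> at the point with polar angle \<open>\<theta>\<close>, with the sign
  for which the unit circle has curvature \<open>1\<close>.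
\<close>

definition kappa :: "real \<Rightarrow> real \<Rightarrow> real" where
  "kappa \<theta> t =
     ((1 + t * zeta \<theta>)\<^sup>2 + 2 * (t * deriv zeta \<theta>)\<^sup>2
        - (1 + t * zeta \<theta>) * (t * deriv (deriv zeta) \<theta>))
     / ((1 + t * zeta \<theta>)\<^sup>2 + (t * deriv zeta \<theta>)\<^sup>2) powr (3 / 2)"

end

theory Submission
  imports Defs "HOL-Complex_Analysis.Complex_Analysis"
begin

text \<open>
  Write \<open>v = u + |x|\<^sup>2 / 4\<close>, which is harmonic with boundary values \<open>|x|\<^sup>2 / 4\<close>, and let
  \<open>\<gamma>(w) = (1 + t \<zeta>(w)) e\<^sup>i\<^sup>w\<close> be the boundary curve with complexified angle \<open>w\<close>.  The harmonic polynomial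
  \<open>1/4 + t Re (- 2 z\<^sup>2 + z\<^sup>4 / 2)\<close> agrees with \<open>v\<close> on the boundary up to \<open>t\<^sup>2\<close> times the real part of an entire
  function of \<open>w\<close>; by the maximum principle the two differ by \<open>O(t\<^sup>2)\<close> in the whole domain.  Pulled back by
  \<open>\<gamma>\<close> to half discs \<open>Im w > 0\<close> and freed from its explicit boundary values, the difference vanishes on the real axis,
  so Schwarz reflection extends it to full discs of fixed radius with the same bound.  Hence \<open>u\<close> is smooth up
  to the boundary, and at \<open>\<gamma>(s)\<close> one has \<open>|\<nabla>u|\<^sup>2 = 1/4 + t (2 cos 2s - 3/2 cos 4s) + t\<^sup>2 Re R(s)\<close> with \<open>R\<close>
  holomorphic and uniformly bounded near the real axis; by Cauchy's estimates the error is \<open>O(t\<^sup>2)\<close> together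
  with its derivatives.  Likewise \<open>\<kappa> = 1 - t (12 cos 2s - 15 cos 4s) + O(t\<^sup>2)\<close>.  In \<open>c = cos 2s\<close> the
  first-order terms are parabolas with vertices at \<open>c = 1/3\<close> and \<open>c = 1/5\<close>, so the extrema are nondegenerate and
  persist.
\<close>

section \<open>Harmonic functions and reflection\<close>

text \<open>The hypothesis on \<open>u\<close> gives no derivative at the boundary, so even the
  existence of the one-sided gradient has to be produced. Smoothness for each fixed \<open>t\<close>
  would not be enough: uniqueness of the maximum point needs two derivatives of the error bounded
  uniformly in \<open>t\<close>. Complexifying the boundary angle serves both ends. It straightens
  the boundary into the real axis for every small \<open>t\<close>, makes discs of one radius
  available, and lets a sup bound on a holomorphic function control all its derivatives. The price
  is geometric: \<open>bcurve\<close> must carry the upper half of a strip of fixed width into the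
  domain and the lower half out of its closure. The gradient is built from a chosen Frechet
  derivative relative to the closure, so it has a value only once that derivative is known to be
  unique. Its squared norm is expanded rather than its norm, because the square continues
  holomorphically in the angle as a product of a holomorphic function and its reflected conjugate.
  The distance to the origin needs no expansion at all, since \<zeta> itself is a parabola in cos
  2s.\<close>

lemma linear_complex_decomp:
  fixes L :: "complex \<Rightarrow> 'a::real_vector"
  assumes "linear L"
  shows "L \<eta> = Re \<eta> *\<^sub>R L 1 + Im \<eta> *\<^sub>R L \<i>"
proof -
  have "\<eta> = Re \<eta> *\<^sub>R 1 + Im \<eta> *\<^sub>R \<i>"
    by (simp add: complex_eq_iff)
  then show ?thesis
    by (metis assms linear_add linear_scale)
qed

text \<open>At an interior maximum of \<open>h\<close> the modulus of \<open>exp f\<close>, which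
  equals \<open>exp h\<close>, is maximal as well; hence \<open>exp f\<close> is constant, and
  \<open>h\<close> is constant up to the closure. Boundedness of \<open>S\<close> supplies a
  frontier point at which the constant can be compared with \<open>B\<close>. Keeping
  \<open>h\<close> apart from \<open>f\<close> gives \<open>h\<close> boundary values where
  \<open>f\<close> has none.\<close>

lemma harmonic_le_frontier:
  fixes h :: "complex \<Rightarrow> real"
  assumes "open S" "connected S" "bounded S" "f holomorphic_on S"
    and cont: "continuous_on (closure S) h"
    and eq: "\<And>z. z \<in> S \<Longrightarrow> h z = Re (f z)"
    and le: "\<And>z. z \<in> frontier S \<Longrightarrow> h z \<le> B"
    and z: "z \<in> closure S"
  shows "h z \<le> B"
proof -
  have "compact (closure S)"
    using assms(3) by simp
  moreover have "closure S \<noteq> {}"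
    using z by auto
  ultimately have "\<exists>p\<in>closure S. \<forall>y\<in>closure S. h y \<le> h p"
    by (rule continuous_attains_sup[OF _ _ cont])
  then obtain p where p: "p \<in> closure S" "\<And>y. y \<in> closure S \<Longrightarrow> h y \<le> h p"
    by blast
  show ?thesis
  proof (cases "p \<in> S")
    case False
    then have "p \<in> frontier S"
      using p(1) assms(1) by (simp add: frontier_def interior_open)
    then show ?thesis
      using le p(2)[OF z] by force
  next
    case True
    have "(\<lambda>z. exp (f z)) constant_on S"
    proof (rule maximum_modulus_principle[OF _ assms(1,2,1) subset_refl True])
      show "(\<lambda>z. exp (f z)) holomorphic_on S"
        using assms by (intro holomorphic_intros)
      show "norm (exp (f y)) \<le> norm (exp (f p))" if "y \<in> S" for y
        using p(2)[of y] that closure_subset[of S] eq[OF that] eq[OF True] by auto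
    qed
    then obtain c where c: "\<And>y. y \<in> S \<Longrightarrow> exp (f y) = c"
      by (auto simp: constant_on_def)
    have "h y = h p" if "y \<in> S" for y
    proof -
      have "norm (exp (f y)) = norm (exp (f p))"
        using c[OF that] c[OF True] by simp
      then show ?thesis
        using eq[OF that] eq[OF True] by simp
    qed
    then have const: "h y = h p" if "y \<in> closure S" for y
      using continuous_constant_on_closure[OF cont] that by blast
    have "S \<noteq> {}" "S \<noteq> UNIV"
      using True assms(3) by auto
    then obtain q where "q \<in> frontier S"
      using frontier_eq_empty by blast
    then show ?thesis
      using const[of q] const[OF z] le[of q] by (simp add: frontier_def)
  qed
qed

text \<open>The Moebius map x / (2M - x) sends the half-plane Re x < M into the unit disc and fixes
  0, so the Schwarz lemma applies to its composite with \<open>f\<close>. This turns control of real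
  parts, which is all that the maximum principle provides, into control of holomorphic
  functions.\<close>

lemma Borel_Caratheodory_unit:
  assumes hol: "f holomorphic_on ball 0 1" and f0: "f 0 = 0"
    and Re: "\<And>z. norm z < 1 \<Longrightarrow> Re (f z) < M" and z: "norm z < 1"
  shows "norm (f z) \<le> 2 * M * norm z / (1 - norm z)"
proof -
  have M: "M > 0"
    using Re[of 0] f0 by simp
  have ne: "2 * M - f w \<noteq> 0" if "norm w < 1" for w
    using Re[OF that] M by (auto simp: complex_eq_iff)
  have "norm (f w) < norm (2 * M - f w)" if "norm w < 1" for w
  proof -
    \<comment> \<open>The right square exceeds the left one by 4M (M - Re (f w)).\<close>
    have "(norm (f w))\<^sup>2 < (norm (2 * M - f w))\<^sup>2"
      using mult_strict_left_mono[OF Re[OF that] M]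
      unfolding cmod_power2 by (simp add: power2_eq_square algebra_simps)
    then show ?thesis
      by (meson norm_ge_zero power_less_imp_less_base)
  qed
  then have lt: "norm (f w / (2 * M - f w)) < 1" if "norm w < 1" for w
    using that ne[OF that] by (simp add: norm_divide divide_less_eq)
  have "norm (f z / (2 * M - f z)) \<le> norm z"
  proof (rule Schwarz_Lemma(1)[where f="\<lambda>z. f z / (2 * M - f z)"])
    show "(\<lambda>z. f z / (2 * M - f z)) holomorphic_on ball 0 1"
      using ne by (intro holomorphic_intros hol) auto
  qed (use lt f0 z in auto)
  then have "norm (f z) \<le> norm z * norm (2 * M - f z)"
    using ne[OF z] by (simp add: norm_divide divide_le_eq)
  also have "\<dots> \<le> norm z * (2 * M + norm (f z))"
    using norm_triangle_ineq4[of "of_real (2 * M)" "f z"] M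
    by (intro mult_left_mono) (auto simp: norm_mult)
  finally have "norm (f z) * (1 - norm z) \<le> 2 * M * norm z"
    by (simp add: algebra_simps)
  then show ?thesis
    using z by (simp add: pos_le_divide_eq)
qed

section \<open>Real polynomials on the unit circle as real parts of complex polynomials\<close>

definition circle_harmonic :: "(complex \<Rightarrow> real) \<Rightarrow> bool" where
  "circle_harmonic g \<longleftrightarrow> (\<exists>p. \<forall>z. norm z = 1 \<longrightarrow> g z = Re (poly p z))"

lemma circle_harmonic_add:
  assumes "circle_harmonic f" "circle_harmonic g"
  shows "circle_harmonic (\<lambda>z. f z + g z)"
proof -
  obtain p q where "\<forall>z. norm z = 1 \<longrightarrow> f z = Re (poly p z)" "\<forall>z. norm z = 1 \<longrightarrow> g z = Re (poly q z)"
    using assms by (auto simp: circle_harmonic_def)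
  then show ?thesis
    unfolding circle_harmonic_def by (intro exI[of _ "p + q"]) simp
qed

lemma circle_harmonic_sum:
  assumes "\<And>i. i \<in> I \<Longrightarrow> circle_harmonic (f i)"
  shows "circle_harmonic (\<lambda>z. \<Sum>i\<in>I. f i z)"
proof -
  have 0: "circle_harmonic (\<lambda>z. 0)"
    unfolding circle_harmonic_def by (intro exI[of _ 0]) simp
  show ?thesis
  proof (cases "finite I")
    case True
    then show ?thesis
      using assms by (induction I) (auto intro: 0 circle_harmonic_add)
  qed (use 0 in simp)
qed

text \<open>By Re x * Re y = Re (y x + cnj y x) / 2 the product splits in two. On the unit circle
  \<open>cnj z ^ n\<close> cancels \<open>n\<close> factors of \<open>z ^ m\<close>, and ordering
  the exponents so that \<open>n \<le> m\<close> avoids negative powers.\<close>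

lemma circle_harmonic_mult_monom:
  "circle_harmonic (\<lambda>z. Re (a * z ^ m) * Re (b * z ^ n))"
proof -
  have *: "circle_harmonic (\<lambda>z. Re (a * z ^ m) * Re (b * z ^ n))" if "n \<le> m" for a b m n
    unfolding circle_harmonic_def
  proof (intro exI allI impI)
    fix z :: complex
    assume z: "norm z = 1"
    have "z * cnj z = 1"
      using z by (simp add: complex_norm_square[symmetric])
    then have "cnj z ^ n * z ^ n = 1"
      by (metis mult.commute power_mult_distrib power_one)
    moreover have "z ^ m = z ^ n * z ^ (m - n)"
      using that by (simp flip: power_add)
    ultimately have 1: "a * cnj b * z ^ (m - n) = cnj (b * z ^ n) * (a * z ^ m)"
      by simp
    have 2: "a * b * z ^ (m + n) = (b * z ^ n) * (a * z ^ m)"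
      by (simp add: power_add)
    have 3: "Re x * Re y = Re (y * x / 2 + cnj y * x / 2)" for x y :: complex
      by (simp add: field_simps)
    have "poly (monom (a * b / 2) (m + n) + monom (a * cnj b / 2) (m - n)) z
        = a * b * z ^ (m + n) / 2 + a * cnj b * z ^ (m - n) / 2"
      by (simp add: poly_monom)
    then show "Re (a * z ^ m) * Re (b * z ^ n)
        = Re (poly (monom (a * b / 2) (m + n) + monom (a * cnj b / 2) (m - n)) z)"
      unfolding 1 2 3 by (rule arg_cong[OF sym])
  qed
  show ?thesis
  proof (cases "n \<le> m")
    case False
    then show ?thesis
      using *[of m n b a] by (simp add: mult.commute)
  qed (rule *)
qed

lemma circle_harmonic_mult:
  assumes "circle_harmonic f" "circle_harmonic g"
  shows "circle_harmonic (\<lambda>z. f z * g z)"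
proof -
  obtain p q where pq: "\<forall>z. norm z = 1 \<longrightarrow> f z = Re (poly p z)" "\<forall>z. norm z = 1 \<longrightarrow> g z = Re (poly q z)"
    using assms by (auto simp: circle_harmonic_def)
  have "circle_harmonic (\<lambda>z. \<Sum>i\<le>degree p. \<Sum>j\<le>degree q. Re (coeff p i * z ^ i) * Re (coeff q j * z ^ j))"
    by (intro circle_harmonic_sum circle_harmonic_mult_monom)
  moreover have "f z * g z = (\<Sum>i\<le>degree p. \<Sum>j\<le>degree q. Re (coeff p i * z ^ i) * Re (coeff q j * z ^ j))"
    if "norm z = 1" for z
    using pq that by (simp add: poly_altdef sum_product)
  ultimately show ?thesis
    by (simp add: circle_harmonic_def)
qed

lemma circle_harmonic_polynomial:
  assumes "real_polynomial_function g"
  shows "circle_harmonic g"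
  using assms
proof (induction rule: real_polynomial_function.induct)
  case (linear f)
  \<comment> \<open>The coefficient comes from Re ((a - ib) z) = a Re z + b Im z.\<close>
  have "f z = Re (poly [:0, f 1 - \<i> * f \<i>:] z)" for z
  proof -
    have "f z = Re z * f 1 + Im z * f \<i>"
      using linear_complex_decomp[OF bounded_linear.linear[OF linear], of z] by (simp only: real_scaleR_def)
    then show ?thesis
      by simp
  qed
  then show ?case
    unfolding circle_harmonic_def by blast
next
  case (const c)
  then show ?case
    unfolding circle_harmonic_def by (intro exI[of _ "[:of_real c:]"]) simp
next
  case (add f g)
  then show ?case
    by (intro circle_harmonic_add)
next
  case (mult f g)
  then show ?case
    by (intro circle_harmonic_mult)
qed

text \<open>A convex set with nonempty interior has the same closure as its interior. This places
  the frontier of the half disc on the upper semicircle and the real diameter.\<close>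

lemma closure_half_disc:
  "closure (ball 0 1 \<inter> {z. 0 < Im z}) = cball 0 1 \<inter> {z. 0 \<le> Im z}"
proof -
  have 1: "interior (cball 0 1 \<inter> {z. 0 \<le> Im z}) = ball 0 1 \<inter> {z. 0 < Im z}"
    using interior_halfspace_ge[of "\<i>" 0] by (simp add: inner_complex_def)
  have "convex (cball 0 1 \<inter> {z. 0 \<le> Im z})"
    by (intro convex_Int convex_cball convex_halfspace_Im_ge)
  moreover have "interior (cball 0 1 \<inter> {z. 0 \<le> Im z}) \<noteq> {}"
  proof -
    have "\<i> / 2 \<in> ball 0 1 \<inter> {z. 0 < Im z}"
      by (simp add: norm_divide)
    then show ?thesis
      unfolding 1 by blast
  qed
  ultimately have "closure (interior (cball 0 1 \<inter> {z. 0 \<le> Im z})) = closure (cball 0 1 \<inter> {z. 0 \<le> Im z})"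
    by (rule convex_closure_interior)
  moreover have "closed (cball 0 1 \<inter> {z. 0 \<le> Im z})"
    by (intro closed_Int closed_cball closed_halfspace_Im_ge)
  ultimately show ?thesis
    unfolding 1 by simp
qed

text \<open>On the unit circle a real polynomial is the real part of a complex one, so Stone--Weierstrass approximates
  the odd extension of \<open>h\<close> there; the maximum principle on the half disc carries the estimate inside.\<close>

lemma odd_polynomial_approx:
  fixes h :: "complex \<Rightarrow> real"
  assumes cont: "continuous_on (cball 0 1 \<inter> {z. 0 \<le> Im z}) h"
    and hol: "f holomorphic_on ball 0 1 \<inter> {z. 0 < Im z}"
    and eq: "\<And>z. norm z < 1 \<Longrightarrow> 0 < Im z \<Longrightarrow> h z = Re (f z)"
    and zero: "\<And>z. norm z \<le> 1 \<Longrightarrow> Im z = 0 \<Longrightarrow> h z = 0"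
    and e: "e > 0"
  obtains q where "q holomorphic_on UNIV" "q 0 = 0" "\<And>z. Re (q (cnj z)) = - Re (q z)"
    "\<And>z. norm z \<le> 1 \<Longrightarrow> 0 \<le> Im z \<Longrightarrow> \<bar>Re (q z) - h z\<bar> \<le> e"
proof -
  \<comment> \<open>On the circle the two branches meet only at -1 and 1, where \<open>h\<close>
    vanishes, so the odd extension is continuous.\<close>
  define \<phi> where "\<phi> z = (if Im z \<ge> 0 then h z else - h (cnj z))" for z
  have "continuous_on (sphere 0 1) \<phi>"
  proof -
    have "continuous_on ((sphere 0 1 \<inter> {z. Im z \<ge> 0}) \<union> (sphere 0 1 \<inter> {z. Im z \<le> 0}))
       (\<lambda>z. if Im z \<ge> 0 then h z else - h (cnj z))"
    proof (rule continuous_on_If)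
      show "continuous_on (sphere 0 1 \<inter> {z. Im z \<ge> 0}) h"
        by (rule continuous_on_subset[OF cont]) auto
      show "continuous_on (sphere 0 1 \<inter> {z. Im z \<le> 0}) (\<lambda>z. - h (cnj z))"
        by (intro continuous_on_minus continuous_on_compose2[OF cont] continuous_intros) auto
    qed (auto intro!: closed_Int closed_halfspace_Im_ge closed_halfspace_Im_le simp: zero)
    moreover have "(sphere 0 1 \<inter> {z. Im z \<ge> 0}) \<union> (sphere 0 1 \<inter> {z. Im z \<le> 0}) = sphere (0::complex) 1"
      by auto
    ultimately show ?thesis
      by (simp add: \<phi>_def[abs_def])
  qed
  then obtain g where g: "real_polynomial_function g" "\<And>z. z \<in> sphere 0 1 \<Longrightarrow> \<bar>\<phi> z - g z\<bar> < e"
    using Stone_Weierstrass_real_polynomial_function[of "sphere 0 1" \<phi> e] e by auto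
  obtain p where p: "\<And>z. norm z = 1 \<Longrightarrow> g z = Re (poly p z)"
    using circle_harmonic_polynomial[OF g(1)] by (auto simp: circle_harmonic_def)
  \<comment> \<open>Antisymmetrising under conjugation makes the real part odd, hence zero on the
    real axis. The value \<open>q0 0\<close> is purely imaginary, so subtracting it normalises
    \<open>q\<close> at 0 without touching real parts.\<close>
  define q0 where "q0 z = (poly p z - cnj (poly p (cnj z))) / 2" for z
  define q where "q z = q0 z - q0 0" for z
  have Req: "Re (q z) = (Re (poly p z) - Re (poly p (cnj z))) / 2" for z
    by (simp add: q_def q0_def)
  have holq: "q holomorphic_on UNIV"
  proof -
    have "(\<lambda>z. cnj (poly p (cnj z))) holomorphic_on UNIV"
      using holomorphic_on_compose_cnj_cnj[of "poly p" UNIV] by (simp add: o_def surj_def holomorphic_intros bij_is_surj)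
    then show ?thesis
      unfolding q_def q0_def by (intro holomorphic_intros) auto
  qed
  \<comment> \<open>The error here is half the difference of the approximation errors at
    \<open>z\<close> and at \<open>cnj z\<close>, because \<phi> is odd.\<close>
  have circ: "\<bar>Re (q z) - h z\<bar> \<le> e" if "norm z = 1" "0 \<le> Im z" for z
  proof -
    have "h z = \<phi> z" "h z = - \<phi> (cnj z)"
      using that zero[of z] zero[of "cnj z"] by (auto simp: \<phi>_def)
    moreover have "\<bar>\<phi> z - Re (poly p z)\<bar> < e" "\<bar>\<phi> (cnj z) - Re (poly p (cnj z))\<bar> < e"
      using g(2)[of z] g(2)[of "cnj z"] p[of z] p[of "cnj z"] that by auto
    ultimately show ?thesis
      unfolding Req abs_le_iff abs_less_iff by (simp add: field_simps)
  qed
  have fr: "\<bar>Re (q z) - h z\<bar> \<le> e" if "z \<in> frontier (ball 0 1 \<inter> {z. 0 < Im z})" for z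
  proof -
    have "open (ball 0 1 \<inter> {z. 0 < Im z})"
      by (intro open_Int open_ball open_halfspace_Im_gt)
    then have z: "norm z \<le> 1" "0 \<le> Im z" "norm z = 1 \<or> Im z = 0"
      using that by (auto simp: frontier_def closure_half_disc interior_open simp del: interior_Int)
    show ?thesis
    proof (cases "Im z = 0")
      case True
      then have "cnj z = z"
        by (simp add: complex_eq_iff)
      then show ?thesis
        using True zero z e by (simp add: Req)
    qed (use z circ in auto)
  qed
  have conv: "connected (ball 0 1 \<inter> {z. 0 < Im z})"
    by (intro convex_connected convex_Int convex_ball convex_halfspace_Im_gt)
  have op: "open (ball 0 1 \<inter> {z. 0 < Im z})"
    by (intro open_Int open_ball open_halfspace_Im_gt)
  have bd: "bounded (ball 0 1 \<inter> {z. 0 < Im z})"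
    by (simp add: bounded_Int)
  have contq: "continuous_on (cball 0 1 \<inter> {z. 0 \<le> Im z}) (\<lambda>z. Re (q z))"
    using holomorphic_on_imp_continuous_on[OF holq]
    by (intro continuous_intros) (auto intro: continuous_on_subset)
  have all: "\<bar>Re (q z) - h z\<bar> \<le> e" if z: "norm z \<le> 1" "0 \<le> Im z" for z
  proof -
    have z': "z \<in> closure (ball 0 1 \<inter> {z. 0 < Im z})"
      using z by (auto simp: closure_half_disc)
    have "Re (q z) - h z \<le> e"
      by (rule harmonic_le_frontier[OF op conv bd, where f="\<lambda>z. q z - f z"])
        (use z' eq fr in \<open>auto intro!: holomorphic_intros hol holomorphic_on_subset[OF holq] continuous_intros contq cont
         simp: closure_half_disc abs_le_iff\<close>)
    moreover have "h z - Re (q z) \<le> e"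
      by (rule harmonic_le_frontier[OF op conv bd, where f="\<lambda>z. f z - q z"])
        (use z' eq fr in \<open>auto intro!: holomorphic_intros hol holomorphic_on_subset[OF holq] continuous_intros contq cont
         simp: closure_half_disc abs_le_iff\<close>)
    ultimately show ?thesis
      by linarith
  qed
  show ?thesis
    by (rule that[OF holq _ _ all]) (auto simp: q_def[of 0] Req field_simps)
qed

text \<open>No gluing across the axis is needed. The approximants are entire with odd real parts, so
  estimates on the upper half disc hold on the full disc, and the Borel-Caratheodory bound makes the
  sequence uniformly Cauchy on smaller discs. Their vanishing at 0 fixes the free imaginary
  constant. The factor 6 is 2r / (1 - r) at r = 3/4.\<close>

lemma harmonic_reflection:
  fixes h :: "complex \<Rightarrow> real"
  assumes cont: "continuous_on (cball 0 1 \<inter> {z. 0 \<le> Im z}) h"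
    and hol: "f holomorphic_on ball 0 1 \<inter> {z. 0 < Im z}"
    and eq: "\<And>z. norm z < 1 \<Longrightarrow> 0 < Im z \<Longrightarrow> h z = Re (f z)"
    and zero: "\<And>z. norm z \<le> 1 \<Longrightarrow> Im z = 0 \<Longrightarrow> h z = 0"
    and bd: "\<And>z. norm z \<le> 1 \<Longrightarrow> 0 \<le> Im z \<Longrightarrow> \<bar>h z\<bar> \<le> M"
  obtains H where "H holomorphic_on ball 0 1"
    "\<And>z. norm z < 1 \<Longrightarrow> 0 \<le> Im z \<Longrightarrow> Re (H z) = h z"
    "\<And>z. norm z < 3/4 \<Longrightarrow> norm (H z) \<le> 6 * M"
proof -
  define e :: "nat \<Rightarrow> real" where "e n = 1 / Suc n" for n
  have e: "e n > 0" for n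
    by (simp add: e_def)
  have e_lim: "e \<longlonglongrightarrow> 0"
    using LIMSEQ_inverse_real_of_nat by (simp add: e_def[abs_def] inverse_eq_divide)
  have "\<exists>q. q holomorphic_on UNIV \<and> q 0 = 0 \<and> (\<forall>z. Re (q (cnj z)) = - Re (q z)) \<and>
    (\<forall>z. norm z \<le> 1 \<longrightarrow> 0 \<le> Im z \<longrightarrow> \<bar>Re (q z) - h z\<bar> \<le> e n)" for n
    by (rule odd_polynomial_approx[OF cont hol eq zero e[of n]]) blast+
  then obtain q where q: "\<And>n. q n holomorphic_on UNIV" "\<And>n. q n 0 = 0"
    "\<And>n z. Re (q n (cnj z)) = - Re (q n z)"
    "\<And>n z. norm z \<le> 1 \<Longrightarrow> 0 \<le> Im z \<Longrightarrow> \<bar>Re (q n z) - h z\<bar> \<le> e n"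
    by metis
  have hq: "q n holomorphic_on A" for n A
    using q(1) holomorphic_on_subset by blast
  have odd_ext: "\<bar>Re (F z)\<bar> \<le> B" if "\<And>z. Re (F (cnj z)) = - Re (F z)"
    "\<And>z. norm z \<le> 1 \<Longrightarrow> 0 \<le> Im z \<Longrightarrow> \<bar>Re (F z)\<bar> \<le> B" "norm z \<le> 1" for F B z
    using that(2)[of z] that(2)[of "cnj z"] that(1)[of z] that(3) by (cases "0 \<le> Im z") auto
  have Reb: "\<bar>Re (q n z)\<bar> \<le> M + e n" if "norm z \<le> 1" for n z
  proof (rule odd_ext[where F="q n", OF q(3) _ that])
    show "\<bar>Re (q n z)\<bar> \<le> M + e n" if "norm z \<le> 1" "0 \<le> Im z" for z
      using q(4)[OF that, of n] bd[OF that] by linarith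
  qed
  have Red: "\<bar>Re (q n z - q m z)\<bar> \<le> e n + e m" if "norm z \<le> 1" for n m z
  proof (rule odd_ext[OF _ _ that, where F="\<lambda>z. q n z - q m z"])
    show "\<bar>Re (q n z - q m z)\<bar> \<le> e n + e m" if "norm z \<le> 1" "0 \<le> Im z" for z
      using q(4)[OF that, of n] q(4)[OF that, of m] by simp
  qed (simp add: q(3))
  have mono: "2 * B * norm z / (1 - norm z) \<le> 2 * B * r / (1 - r)"
    if "norm z \<le> r" "r < 1" "B \<ge> 0" for B r :: real and z :: complex
  proof (rule frac_le)
    show "2 * B * norm z \<le> 2 * B * r"
      using that by (intro mult_left_mono) auto
    show "0 \<le> 2 * B * r"
      using that norm_ge_zero[of z] by (intro mult_nonneg_nonneg; linarith)
  qed (use that in auto)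
  have nb: "norm (q n z) \<le> 6 * (M + 2 * e n)" if "norm z \<le> 3/4" for n z
  proof -
    \<comment> \<open>The extra \<open>e n\<close> yields the strict inequality that
      \<open>Borel_Caratheodory_unit\<close> asks for; it disappears in the limit.\<close>
    have "Re (q n w) < M + 2 * e n" if "norm w < 1" for w
      using Reb[of w n] that e[of n] by auto
    then have "norm (q n z) \<le> 2 * (M + 2 * e n) * norm z / (1 - norm z)"
      using that by (intro Borel_Caratheodory_unit hq q(2)) auto
    also have "\<dots> \<le> 2 * (M + 2 * e n) * (3/4) / (1 - 3/4)"
      using that Reb[of 0 n] e[of n] by (intro mono) auto
    finally show ?thesis
      by simp
  qed
  have nd: "norm (q n z - q m z) \<le> 2 * (e n + e m + (e n + e m)) * r / (1 - r)"
    if "norm z \<le> r" "r < 1" for n m z r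
  proof -
    have "Re (q n w - q m w) < e n + e m + (e n + e m)" if "norm w < 1" for w
      using Red[of w n m] that e[of n] e[of m] by linarith
    then have "norm (q n z - q m z) \<le> 2 * (e n + e m + (e n + e m)) * norm z / (1 - norm z)"
      using that q(2)
      by (intro Borel_Caratheodory_unit[where f="\<lambda>z. q n z - q m z"] holomorphic_intros hq) auto
    also have "\<dots> \<le> 2 * (e n + e m + (e n + e m)) * r / (1 - r)"
      using that e[of n] e[of m] by (intro mono) auto
    finally show ?thesis .
  qed
  have uc: "uniformly_Cauchy_on (cball 0 r) q" if r: "0 \<le> r" "r < 1" for r
    unfolding uniformly_Cauchy_on_def dist_norm
  proof (intro allI impI)
    fix \<epsilon> :: real
    assume \<epsilon>: "\<epsilon> > 0"
    have "(\<lambda>n. 8 * e n * r / (1 - r)) \<longlonglongrightarrow> 8 * 0 * r / (1 - r)"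
      using r by (intro tendsto_intros e_lim) auto
    then have "eventually (\<lambda>n. 8 * e n * r / (1 - r) < \<epsilon>) sequentially"
      using \<epsilon> by (auto dest: order_tendstoD)
    then obtain N where N: "8 * e N * r / (1 - r) < \<epsilon>"
      using eventually_happens by force
    have le: "e n \<le> e N" if "n \<ge> N" for n
      using that by (simp add: e_def frac_le)
    show "\<exists>N. \<forall>z::complex\<in>cball 0 r. \<forall>m\<ge>N. \<forall>n\<ge>N. norm (q m z - q n z) < \<epsilon>"
    proof (intro exI ballI allI impI)
      fix z :: complex and m n
      assume z: "z \<in> cball 0 r" and mn: "N \<le> m" "N \<le> n"
      have "norm (q m z - q n z) \<le> 2 * (e m + e n + (e m + e n)) * r / (1 - r)"
        using z r by (intro nd) auto
      also have "\<dots> \<le> 8 * e N * r / (1 - r)"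
        using r le[OF mn(1)] le[OF mn(2)] by (intro divide_right_mono mult_right_mono) auto
      finally show "norm (q m z - q n z) < \<epsilon>"
        using N by simp
    qed
  qed
  have ex: "\<exists>l. uniform_limit (cball 0 r) q l sequentially" if "0 \<le> r" "r < 1" for r
    using uc[OF that] Cauchy_uniformly_convergent unfolding uniformly_convergent_on_def by blast
  \<comment> \<open>A pointwise limit, so that the uniform limits on the discs of all radii below 1
    are one and the same function.\<close>
  define H where "H z = lim (\<lambda>n. q n z)" for z
  have ul: "uniform_limit (cball 0 r) q H sequentially" if r: "0 \<le> r" "r < 1" for r
  proof -
    obtain l where l: "uniform_limit (cball 0 r) q l sequentially"
      using ex[OF r] by auto
    have "l z = H z" if "z \<in> cball 0 r" for z
      using tendsto_uniform_limitI[OF l that] by (simp add: H_def limI)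
    then show ?thesis
      using l uniform_limit_cong'[of "cball 0 r" q q l H] by auto
  qed
  have tend: "(\<lambda>n. q n z) \<longlonglongrightarrow> H z" if "norm z < 1" for z
    using tendsto_uniform_limitI[OF ul[of "norm z"]] that by auto
  have "H holomorphic_on ball 0 1"
  proof (rule holomorphic_uniform_sequence[OF open_ball hq])
    fix x :: complex
    assume x: "x \<in> ball 0 1"
    define d where "d = (1 - norm x) / 2"
    have sub: "cball x d \<subseteq> cball 0 (norm x + d)"
      by (auto simp: dist_norm) (smt (verit) norm_triangle_ineq2 norm_minus_commute)
    have d: "d > 0" "norm x + d < 1"
      using x by (auto simp: d_def field_simps)
    show "\<exists>d>0. cball x d \<subseteq> ball 0 1 \<and> uniform_limit (cball x d) q H sequentially"
      using d sub by (intro exI[of _ d] conjI uniform_limit_on_subset[OF ul sub]) auto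
  qed
  moreover have "Re (H z) = h z" if z: "norm z < 1" "0 \<le> Im z" for z
  proof -
    have "(\<lambda>n. Re (q n z)) \<longlonglongrightarrow> Re (H z)"
      using tend[OF z(1)] by (intro tendsto_intros)
    moreover have "(\<lambda>n. Re (q n z) - h z) \<longlonglongrightarrow> 0"
      by (rule tendsto_0_le[where K=1 and f=e])
        (use q(4)[of z] z e[THEN less_imp_le] e_lim in auto)
    then have "(\<lambda>n. Re (q n z)) \<longlonglongrightarrow> h z"
      by (simp add: LIM_zero_iff)
    ultimately show ?thesis
      using LIMSEQ_unique by blast
  qed
  moreover have "norm (H z) \<le> 6 * M" if z: "norm z < 3/4" for z
  proof (rule tendsto_le[OF sequentially_bot])
    show "(\<lambda>n. 6 * (M + 2 * e n)) \<longlonglongrightarrow> 6 * M"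
    proof -
      have "(\<lambda>n. 6 * (M + 2 * e n)) \<longlonglongrightarrow> 6 * (M + 2 * 0)"
        by (intro tendsto_intros e_lim)
      then show ?thesis by simp
    qed
    show "(\<lambda>n. norm (q n z)) \<longlonglongrightarrow> norm (H z)"
      using tend[of z] z by (intro tendsto_intros) auto
  qed (use nb[of z] z in auto)
  ultimately show ?thesis
    using that by blast
qed

text \<open>The mean value theorem along \<open>a\<close>, applied to the increment in direction
  \<open>b\<close>, reduces the second difference to an increment of the
  \<open>a\<close>-derivative; differentiability of that derivative at the single point
  \<open>x\<close> then gives the limit. The quotient is symmetric in \<open>a\<close> and
  \<open>b\<close>, which is its purpose.\<close>

lemma second_difference_tendsto:
  fixes f :: "'a::real_normed_vector \<Rightarrow> real"
  assumes S: "open S" "x \<in> S"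
    and f: "\<And>z. z \<in> S \<Longrightarrow> (f has_derivative f' z) (at z)"
    and P: "((\<lambda>z. f' z a) has_derivative P) (at x)"
  shows "((\<lambda>h. (f (x + h *\<^sub>R a + h *\<^sub>R b) - f (x + h *\<^sub>R a) - f (x + h *\<^sub>R b) + f x) / h\<^sup>2) \<longlongrightarrow> P b) (at_right 0)"
proof (rule tendstoI)
  fix e :: real
  assume e: "e > 0"
  \<comment> \<open>For \<open>0 \<le> s \<le> h\<close> all displacements
    \<open>s *\<^sub>R a + h *\<^sub>R b\<close> have norm at most h B. Two errors of size
    \<epsilon> h B, divided by h, add up to e/2.\<close>
  define B where "B = norm a + norm b + 1"
  define \<epsilon> where "\<epsilon> = e / (4 * B)"
  have B: "B > 0"
    unfolding B_def by (intro add_nonneg_pos) auto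
  then have \<epsilon>: "\<epsilon> > 0"
    using e by (simp add: \<epsilon>_def)
  define g where "g z = f' z a" for z
  interpret P: bounded_linear P
    using P by (rule has_derivative_bounded_linear)
  obtain d1 where d1: "d1 > 0" "\<And>y. norm (y - x) < d1 \<Longrightarrow> norm (g y - g x - P (y - x)) \<le> \<epsilon> * norm (y - x)"
    using P \<epsilon> unfolding has_derivative_at_alt g_def by metis
  obtain d2 where d2: "d2 > 0" "ball x d2 \<subseteq> S"
    using S open_contains_ball by blast
  define d where "d = min d1 d2 / B"
  have d: "d > 0"
    using d1 d2 B by (simp add: d_def)
  have "\<bar>(f (x + h *\<^sub>R a + h *\<^sub>R b) - f (x + h *\<^sub>R a) - f (x + h *\<^sub>R b) + f x) / h\<^sup>2 - P b\<bar> < e"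
    if h: "0 < h" "h < d" for h
  proof -
    have hB: "h * B < d1" "h * B < d2"
      using h B by (auto simp: d_def field_simps)
    have n1: "norm (s *\<^sub>R a + h *\<^sub>R b) \<le> h * B" and n2: "norm (s *\<^sub>R a) \<le> h * B" if "0 \<le> s" "s \<le> h" for s
    proof -
      have "s * norm a + h * norm b \<le> h * norm a + h * norm b"
        using that by (simp add: mult_right_mono)
      moreover have "norm (s *\<^sub>R a + h *\<^sub>R b) \<le> s * norm a + h * norm b"
        using norm_triangle_ineq[of "s *\<^sub>R a" "h *\<^sub>R b"] that h by simp
      ultimately show "norm (s *\<^sub>R a + h *\<^sub>R b) \<le> h * B"
        using h by (simp add: B_def algebra_simps)
      have "s * norm a \<le> h * B"
        using that h unfolding B_def by (intro mult_mono) auto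
      then show "norm (s *\<^sub>R a) \<le> h * B"
        using that by simp
    qed
    have inS: "x + s *\<^sub>R a + h *\<^sub>R b \<in> S" "x + s *\<^sub>R a \<in> S" if "0 \<le> s" "s \<le> h" for s
      using n1[OF that] n2[OF that] hB d2(2) by (auto simp: subset_iff dist_norm norm_minus_commute add.assoc)
    define \<phi> where "\<phi> s = f (x + s *\<^sub>R a + h *\<^sub>R b) - f (x + s *\<^sub>R a)" for s
    have "DERIV \<phi> s :> g (x + s *\<^sub>R a + h *\<^sub>R b) - g (x + s *\<^sub>R a)" if "0 \<le> s" "s \<le> h" for s
    proof -
      have "((\<lambda>s. f (x + s *\<^sub>R a + h *\<^sub>R b)) has_derivative (\<lambda>k. f' (x + s *\<^sub>R a + h *\<^sub>R b) (k *\<^sub>R a))) (at s)"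
        by (rule has_derivative_compose[where g=f and f="\<lambda>s. x + s *\<^sub>R a + h *\<^sub>R b", OF _ f[OF inS(1)[OF that]]]) (auto intro!: derivative_eq_intros)
      moreover have "((\<lambda>s. f (x + s *\<^sub>R a)) has_derivative (\<lambda>k. f' (x + s *\<^sub>R a) (k *\<^sub>R a))) (at s)"
        by (rule has_derivative_compose[where g=f and f="\<lambda>s. x + s *\<^sub>R a", OF _ f[OF inS(2)[OF that]]]) (auto intro!: derivative_eq_intros)
      ultimately have "(\<phi> has_derivative (\<lambda>k. f' (x + s *\<^sub>R a + h *\<^sub>R b) (k *\<^sub>R a) - f' (x + s *\<^sub>R a) (k *\<^sub>R a))) (at s)"
        unfolding \<phi>_def by (rule has_derivative_diff)
      moreover have "f' y (k *\<^sub>R a) = k * g y" if "y \<in> S" for y k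
        using linear_scale[OF has_derivative_linear[OF f[OF that]]] by (simp add: g_def)
      ultimately have "(\<phi> has_derivative (\<lambda>k. (g (x + s *\<^sub>R a + h *\<^sub>R b) - g (x + s *\<^sub>R a)) * k)) (at s)"
        using inS[OF that] by (simp add: algebra_simps)
      then show ?thesis
        unfolding has_field_derivative_def .
    qed
    from MVT2[OF h(1) this]
    obtain \<xi> where \<xi>: "0 < \<xi>" "\<xi> < h"
      "\<phi> h - \<phi> 0 = (h - 0) * (g (x + \<xi> *\<^sub>R a + h *\<^sub>R b) - g (x + \<xi> *\<^sub>R a))"
      by auto
    have "norm (g (x + \<xi> *\<^sub>R a + h *\<^sub>R b) - g x - P (\<xi> *\<^sub>R a + h *\<^sub>R b)) \<le> \<epsilon> * norm (\<xi> *\<^sub>R a + h *\<^sub>R b)"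
      using d1(2)[of "x + \<xi> *\<^sub>R a + h *\<^sub>R b"] n1[of \<xi>] \<xi> hB by (simp add: add.assoc)
    moreover have "norm (g (x + \<xi> *\<^sub>R a) - g x - P (\<xi> *\<^sub>R a)) \<le> \<epsilon> * norm (\<xi> *\<^sub>R a)"
      using d1(2)[of "x + \<xi> *\<^sub>R a"] n2[of \<xi>] \<xi> hB by simp
    moreover have "\<epsilon> * norm (\<xi> *\<^sub>R a + h *\<^sub>R b) \<le> \<epsilon> * (h * B)" "\<epsilon> * norm (\<xi> *\<^sub>R a) \<le> \<epsilon> * (h * B)"
      using n1[of \<xi>] n2[of \<xi>] \<xi> \<epsilon> by (auto intro!: mult_left_mono simp del: norm_scaleR)
    ultimately have *: "\<bar>(g (x + \<xi> *\<^sub>R a + h *\<^sub>R b) - g (x + \<xi> *\<^sub>R a)) - h * P b\<bar> \<le> 2 * \<epsilon> * (h * B)"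
      by (simp add: P.add P.scaleR abs_le_iff del: norm_scaleR)
    have "f (x + h *\<^sub>R a + h *\<^sub>R b) - f (x + h *\<^sub>R a) - f (x + h *\<^sub>R b) + f x
       = h * (g (x + \<xi> *\<^sub>R a + h *\<^sub>R b) - g (x + \<xi> *\<^sub>R a))"
      using \<xi>(3) by (simp add: \<phi>_def)
    then have "(f (x + h *\<^sub>R a + h *\<^sub>R b) - f (x + h *\<^sub>R a) - f (x + h *\<^sub>R b) + f x) / h\<^sup>2 - P b
       = ((g (x + \<xi> *\<^sub>R a + h *\<^sub>R b) - g (x + \<xi> *\<^sub>R a)) - h * P b) / h"
      using h by (simp add: diff_divide_distrib power2_eq_square)
    also have "\<bar>\<dots>\<bar> \<le> 2 * \<epsilon> * B"
      using * h by (simp add: field_simps)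
    also have "\<dots> < e"
      using B e by (simp add: \<epsilon>_def)
    finally show ?thesis .
  qed
  then show "\<forall>\<^sub>F h in at_right 0. dist ((f (x + h *\<^sub>R a + h *\<^sub>R b) - f (x + h *\<^sub>R a) - f (x + h *\<^sub>R b) + f x) / h\<^sup>2) (P b) < e"
    using d by (auto simp: eventually_at_right_field dist_real_def)
qed

text \<open>Both numbers are limits of the same second difference quotient, since exchanging
  \<open>a\<close> and \<open>b\<close> leaves it unchanged.\<close>

lemma mixed_partials_commute:
  fixes f :: "'a::real_normed_vector \<Rightarrow> real"
  assumes "open S" "x \<in> S" "\<And>z. z \<in> S \<Longrightarrow> (f has_derivative f' z) (at z)"
    and "((\<lambda>z. f' z a) has_derivative P) (at x)" "((\<lambda>z. f' z b) has_derivative Q) (at x)"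
  shows "P b = Q a"
proof (rule tendsto_unique[OF _ second_difference_tendsto[OF assms(1-3,4)]])
  show "((\<lambda>h. (f (x + h *\<^sub>R a + h *\<^sub>R b) - f (x + h *\<^sub>R a) - f (x + h *\<^sub>R b) + f x) / h\<^sup>2) \<longlongrightarrow> Q a) (at_right 0)"
    using second_difference_tendsto[OF assms(1-3,5), of a] by (simp add: algebra_simps)
qed auto

text \<open>For v = u + |z|^2 / 4 the function v_x - i v_y satisfies the Cauchy-Riemann equations:
  one is the vanishing Laplacian of v, the other the symmetry of mixed partials. A primitive exists
  on the starlike set, and its real part has the gradient of v.\<close>

lemma torsion_eq_Re_holomorphic:
  fixes u :: "complex \<Rightarrow> real"
  assumes S: "open S" "starlike S" and C2: "C2_on S u" and lap: "\<And>x. x \<in> S \<Longrightarrow> - laplacian u x = 1"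
  obtains F where "F holomorphic_on S" "\<And>z. z \<in> S \<Longrightarrow> u z + (norm z)\<^sup>2 / 4 = Re (F z)"
proof -
  define p where "p = partial_deriv 1 u"
  define q where "q = partial_deriv \<i> u"
  have u: "(u has_derivative frechet_derivative u (at z)) (at z)" if "z \<in> S" for z
    using C2 that by (simp add: C2_on_def frechet_derivative_works)
  have u_eq: "frechet_derivative u (at z) \<eta> = p z * Re \<eta> + q z * Im \<eta>" if "z \<in> S" for z \<eta>
    using linear_complex_decomp[OF has_derivative_linear[OF u[OF that]], of \<eta>]
    by (simp add: p_def q_def partial_deriv_def mult.commute)
  \<comment> \<open>This is v_x - i v_y; the terms \<open>Re z / 2\<close> and
    \<open>Im z / 2\<close> are the partial derivatives of |z|^2 / 4.\<close>
  define D where "D z = of_real (p z + Re z / 2) + \<i> * of_real (- q z - Im z / 2)" for z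
  have D: "\<exists>c. (D has_field_derivative c) (at z)" if z: "z \<in> S" for z
  proof -
    define P where "P = frechet_derivative p (at z)"
    define Q where "Q = frechet_derivative q (at z)"
    have P: "(p has_derivative P) (at z)" and Q: "(q has_derivative Q) (at z)"
      using C2 z by (auto simp: C2_on_def p_def q_def P_def Q_def Basis_complex_def simp flip: frechet_derivative_works)
    have PQ: "P \<i> = Q 1"
      by (rule mixed_partials_commute[OF S(1) z u])
        (use P Q in \<open>simp_all add: p_def q_def partial_deriv_def[abs_def]\<close>)
    have "P 1 + Q \<i> = -1"
      using lap[OF z] by (simp add: laplacian_def Basis_complex_def partial_deriv_def[of _ p] partial_deriv_def[of _ q] P_def Q_def flip: p_def q_def)
    then have Qi: "Q \<i> = - 1 - P 1"
      by simp
    have P': "P \<eta> = Re \<eta> * P 1 + Im \<eta> * P \<i>" and Q': "Q \<eta> = Re \<eta> * Q 1 + Im \<eta> * Q \<i>" for \<eta>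
      using linear_complex_decomp[OF has_derivative_linear[OF P], of \<eta>]
        linear_complex_decomp[OF has_derivative_linear[OF Q], of \<eta>] by auto
    have "(D has_derivative (\<lambda>\<eta>. of_real (P \<eta> + Re \<eta> / 2) + \<i> * of_real (- Q \<eta> - Im \<eta> / 2))) (at z)"
      unfolding D_def by (auto intro!: derivative_eq_intros P Q)
    moreover have "of_real (P \<eta> + Re \<eta> / 2) + \<i> * of_real (- Q \<eta> - Im \<eta> / 2) = Complex (P 1 + 1/2) (- P \<i>) * \<eta>" for \<eta>
      unfolding P'[of \<eta>] Q'[of \<eta>] Qi PQ by (simp add: complex_eq_iff algebra_simps)
    ultimately show ?thesis
      by (auto simp: has_field_derivative_def)
  qed
  have holD: "D holomorphic_on S"
    using D S(1) by (simp add: holomorphic_on_open)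
  obtain F where F: "\<And>z. z \<in> S \<Longrightarrow> (F has_field_derivative D z) (at z)"
    using holomorphic_starlike_primitive[OF holomorphic_on_imp_continuous_on[OF holD] S(2,1), of "{}"] holD S(1)
    by (auto simp: holomorphic_on_imp_differentiable_at)
  have der0: "((\<lambda>z. u z + (norm z)\<^sup>2 / 4 - Re (F z)) has_derivative (\<lambda>\<eta>. 0)) (at z)" if z: "z \<in> S" for z
  proof -
    have "((\<lambda>z. u z + (z \<bullet> z) / 4 - Re (F z)) has_derivative
       (\<lambda>\<eta>. frechet_derivative u (at z) \<eta> + (z \<bullet> \<eta> + \<eta> \<bullet> z) / 4 - Re (D z * \<eta>))) (at z)"
      using F[OF z] unfolding has_field_derivative_def
      by (auto intro!: derivative_eq_intros u z)
    moreover have "frechet_derivative u (at z) \<eta> + (z \<bullet> \<eta> + \<eta> \<bullet> z) / 4 - Re (D z * \<eta>) = 0" for \<eta>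
      by (simp add: u_eq[OF z] inner_complex_def D_def field_simps)
    ultimately show ?thesis
      by (simp add: dot_square_norm)
  qed
  obtain a where a: "a \<in> S"
    using S(2) by (auto simp: starlike_def)
  define c where "c = u a + (norm a)\<^sup>2 / 4 - Re (F a)"
  have c: "u z + (norm z)\<^sup>2 / 4 - Re (F z) = c" if "z \<in> S" for z
    unfolding c_def
    by (rule has_derivative_zero_unique_connected[OF S(1) starlike_imp_connected[OF S(2)] der0 that a])
  show ?thesis
  proof (rule that)
    show "(\<lambda>z. F z + of_real c) holomorphic_on S"
      using F S(1) by (intro holomorphic_intros) (auto simp: holomorphic_on_open)
    show "u z + (norm z)\<^sup>2 / 4 = Re (F z + of_real c)" if "z \<in> S" for z
      using c[OF that] by simp
  qed
qed

section \<open>Perturbation of nondegenerate maxima\<close>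

lemma has_real_derivative_Re_trace:
  fixes \<rho> :: "real \<Rightarrow> real"
  assumes R: "R holomorphic_on ball (of_real s\<^sub>0) \<delta>"
    and eq: "\<And>s. \<bar>s - s\<^sub>0\<bar> < \<delta> \<Longrightarrow> \<rho> s = Re (R (of_real s))"
    and s: "\<bar>s - s\<^sub>0\<bar> < \<delta>"
  shows "(\<rho> has_real_derivative Re (deriv R (of_real s))) (at s)"
proof -
  have "of_real s \<in> ball (of_real s\<^sub>0 :: complex) \<delta>"
    using s by (simp add: dist_real_def dist_of_real abs_minus_commute)
  then have "(R has_field_derivative deriv R (of_real s)) (at (of_real s))"
    using R by (simp add: holomorphic_derivI)
  then have "((\<lambda>s. R (of_real s)) has_vector_derivative deriv R (of_real s)) (at s)"
    by (rule has_vector_derivative_real_field)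
  then have "((\<lambda>s. Re (R (of_real s))) has_real_derivative Re (deriv R (of_real s))) (at s)"
    using bounded_linear.has_vector_derivative[OF bounded_linear_Re]
    by (simp add: has_real_derivative_iff_has_vector_derivative)
  then show ?thesis
  proof (rule has_field_derivative_transform_within_open)
    show "open {s\<^sub>0 - \<delta><..<s\<^sub>0 + \<delta>}" "s \<in> {s\<^sub>0 - \<delta><..<s\<^sub>0 + \<delta>}"
      using s by (auto simp: abs_less_iff)
  qed (auto simp: eq abs_less_iff)
qed

text \<open>Cauchy's estimate on the disc of radius \<delta>/2, whose closure lies where
  \<open>R\<close> is controlled. The constant is C + 1 because the values have to lie in an open
  ball; 2!/(\<delta>/2)^2 gives the 8.\<close>

lemma Re_trace_derivative_bounds:
  fixes \<rho> :: "real \<Rightarrow> real"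
  assumes R: "R holomorphic_on ball (of_real s\<^sub>0) \<delta>" and \<delta>: "\<delta> > 0"
    and bd: "\<And>w. w \<in> ball (of_real s\<^sub>0) \<delta> \<Longrightarrow> norm (R w) \<le> C"
    and eq: "\<And>s. \<bar>s - s\<^sub>0\<bar> < \<delta> \<Longrightarrow> \<rho> s = Re (R (of_real s))"
  shows "\<bar>\<rho> s\<^sub>0\<bar> \<le> C"
    and "(\<rho> has_real_derivative deriv \<rho> s\<^sub>0) (at s\<^sub>0)"
    and "(deriv \<rho> has_real_derivative deriv (deriv \<rho>) s\<^sub>0) (at s\<^sub>0)"
    and "\<bar>deriv \<rho> s\<^sub>0\<bar> \<le> 2 * (C + 1) / \<delta>"
    and "\<bar>deriv (deriv \<rho>) s\<^sub>0\<bar> \<le> 8 * (C + 1) / \<delta>\<^sup>2"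
proof -
  have "\<bar>Re (R (of_real s\<^sub>0))\<bar> \<le> norm (R (of_real s\<^sub>0))"
    by (rule abs_Re_le_cmod)
  then show "\<bar>\<rho> s\<^sub>0\<bar> \<le> C"
    using bd[of "of_real s\<^sub>0"] eq[of s\<^sub>0] \<delta> by simp
  have d1: "(\<rho> has_real_derivative Re (deriv R (of_real s))) (at s)" if "\<bar>s - s\<^sub>0\<bar> < \<delta>" for s
    using has_real_derivative_Re_trace[OF R eq that] .
  have eq': "deriv \<rho> s = Re (deriv R (of_real s))" if "\<bar>s - s\<^sub>0\<bar> < \<delta>" for s
    using DERIV_imp_deriv[OF d1[OF that]] .
  have R': "deriv R holomorphic_on ball (of_real s\<^sub>0) \<delta>"
    using R by (simp add: holomorphic_deriv)
  have d2: "(deriv \<rho> has_real_derivative Re (deriv (deriv R) (of_real s\<^sub>0))) (at s\<^sub>0)"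
    using has_real_derivative_Re_trace[OF R' eq', of s\<^sub>0] \<delta> by simp
  have eq'': "deriv (deriv \<rho>) s\<^sub>0 = Re (deriv (deriv R) (of_real s\<^sub>0))"
    using DERIV_imp_deriv[OF d2] .
  show "(\<rho> has_real_derivative deriv \<rho> s\<^sub>0) (at s\<^sub>0)"
    using d1[of s\<^sub>0] eq'[of s\<^sub>0] \<delta> by simp
  show "(deriv \<rho> has_real_derivative deriv (deriv \<rho>) s\<^sub>0) (at s\<^sub>0)"
    using d2 eq'' by simp
  have cau: "norm ((deriv ^^ n) R (of_real s\<^sub>0)) \<le> fact n * (C + 1) / (\<delta> / 2) ^ n" if "0 < n" for n
  proof (rule Cauchy_higher_deriv_bound[where y=0, OF _ _ _ _ that])
    show "R holomorphic_on ball (of_real s\<^sub>0) (\<delta> / 2)"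
      by (rule holomorphic_on_subset[OF R]) (use \<delta> in auto)
    show "continuous_on (cball (of_real s\<^sub>0) (\<delta> / 2)) R"
      by (rule continuous_on_subset[OF holomorphic_on_imp_continuous_on[OF R]]) (use \<delta> in auto)
    show "R w \<in> ball 0 (C + 1)" if "w \<in> ball (of_real s\<^sub>0) (\<delta> / 2)" for w
      using bd[of w] that \<delta> by auto
  qed (use \<delta> in auto)
  show "\<bar>deriv \<rho> s\<^sub>0\<bar> \<le> 2 * (C + 1) / \<delta>"
    using cau[of 1] eq'[of s\<^sub>0] abs_Re_le_cmod[of "deriv R (of_real s\<^sub>0)"] \<delta> by (simp add: mult.commute)
  show "\<bar>deriv (deriv \<rho>) s\<^sub>0\<bar> \<le> 8 * (C + 1) / \<delta>\<^sup>2"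
    using cau[of 2] eq'' abs_Re_le_cmod[of "deriv (deriv R) (of_real s\<^sub>0)"]
    by (simp add: numeral_2_eq_2 power2_eq_square)
qed

text \<open>Up to constants, \<open>f t\<close> is g + t \<rho> with \<rho> and two derivatives
  bounded uniformly in \<open>t\<close>. The sup bound forces maximisers close to \<open>p\<close>,
  the bound on the second derivative keeps \<open>f t\<close> strictly concave there, and the bound
  on the first derivative measures the displacement. The expansion is asked for near each
  \<open>s\<^sub>0\<close> separately, as reflection delivers it, but with a common radius and
  bound.\<close>

lemma perturbed_max:
  fixes f :: "real \<Rightarrow> real \<Rightarrow> real" and g :: "real \<Rightarrow> real"
  assumes p: "a < p" "p < b"
    and g1: "\<And>s. (g has_real_derivative g' s) (at s)"
    and g2: "\<And>s. (g' has_real_derivative g'' s) (at s)"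
    and cont: "isCont g'' p" and neg: "g'' p < 0"
    and max: "\<And>s. s \<in> {a..b} \<Longrightarrow> s \<noteq> p \<Longrightarrow> g s < g p"
    and \<delta>: "\<delta> > 0"
    and expansion: "\<forall>\<^sub>F t in at_right 0. \<forall>s\<^sub>0. \<exists>R. R holomorphic_on ball (of_real s\<^sub>0) \<delta> \<and>
       (\<forall>w\<in>ball (of_real s\<^sub>0) \<delta>. norm (R w) \<le> C) \<and>
       (\<forall>s. \<bar>s - s\<^sub>0\<bar> < \<delta> \<longrightarrow> f t s = c\<^sub>0 + t * (g s + t * Re (R (of_real s))))"
  obtains \<sigma> where "\<forall>\<^sub>F t in at_right 0. {s. is_arg_max (f t) (\<lambda>s. s \<in> {a..b}) s} = {\<sigma> t}"
    and "(\<lambda>t. \<sigma> t - p) \<in> O[at_right 0](\<lambda>t. t)"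
proof -
  \<comment> \<open>Half of |g''(p)|: continuity then gives g'' < -m on a whole neighbourhood, with
    room for a perturbation smaller than m.\<close>
  define m where "m = - g'' p / 2"
  have m: "m > 0"
    using neg by (simp add: m_def)
  have "\<forall>\<^sub>F s in at p. g'' s < - m"
    using cont m unfolding isCont_def m_def by (intro order_tendstoD) auto
  then obtain \<eta>0 where \<eta>0: "\<eta>0 > 0" "\<And>s. s \<noteq> p \<Longrightarrow> \<bar>s - p\<bar> < \<eta>0 \<Longrightarrow> g'' s < - m"
    by (auto simp: eventually_at dist_real_def)
  \<comment> \<open>Halving leaves a strict margin, so the closed \<eta>-neighbourhood of
    \<open>p\<close> lies inside (a, b) and maximisers in it are critical points.\<close>
  define \<eta> where "\<eta> = Min {\<eta>0, p - a, b - p} / 2"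
  have "Min {\<eta>0, p - a, b - p} > 0" "Min {\<eta>0, p - a, b - p} \<le> \<eta>0"
    "Min {\<eta>0, p - a, b - p} \<le> p - a" "Min {\<eta>0, p - a, b - p} \<le> b - p"
    using \<eta>0 p by auto
  then have \<eta>: "\<eta> > 0" "\<eta> < \<eta>0" "\<eta> < p - a" "\<eta> < b - p"
    unfolding \<eta>_def by linarith+
  have g''m: "g'' s < - m" if "\<bar>s - p\<bar> \<le> \<eta>" for s
    using \<eta>0(2)[of s] that \<eta> m by (cases "s = p") (auto simp: m_def)
  have contg: "continuous_on A g" for A
    using g1 DERIV_isCont continuous_at_imp_continuous_on by blast
  obtain \<mu> where \<mu>: "\<mu> > 0" "\<And>s. s \<in> {a..b} \<Longrightarrow> \<eta> \<le> \<bar>s - p\<bar> \<Longrightarrow> g s \<le> g p - \<mu>"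
  proof -
    let ?K = "{a..b} - ball p \<eta>"
    have "compact ?K" "?K \<noteq> {}"
      using \<eta> p by (auto intro!: compact_diff exI[of _ a] simp: dist_real_def set_eq_iff)
    then obtain q where q: "q \<in> ?K" "\<And>s. s \<in> ?K \<Longrightarrow> g s \<le> g q"
      using continuous_attains_sup[OF _ _ contg] by metis
    have "q \<noteq> p"
      using q(1) \<eta> by auto
    then have "g p - g q > 0"
      using max[of q] q(1) by auto
    then show ?thesis
      using q(2) by (intro that[of "g p - g q"]) (auto simp: dist_real_def abs_minus_commute)
  qed
  have g'p: "g' p = 0"
  proof (rule DERIV_local_max[OF g1 \<eta>(1)], intro allI impI)
    show "g y \<le> g p" if "\<bar>p - y\<bar> < \<eta>" for y
      using max[of y] that \<eta> by (cases "y = p") (auto simp: abs_less_iff)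
  qed
  define C1 where "C1 = 2 * (C + 1) / \<delta>"
  define C2 where "C2 = 8 * (C + 1) / \<delta>\<^sup>2"
  \<comment> \<open>Two values of t \<rho> differ by at most 2Ct, which stays below the gap \<mu> by
    which \<open>g\<close> drops away from \<open>p\<close>; t C2 < m preserves the sign of the
    second derivative near \<open>p\<close>.\<close>
  define good where "good t \<longleftrightarrow> t > 0 \<and> t * (2 * C) < \<mu> \<and> t * C2 < m \<and> (\<forall>s\<^sub>0. \<exists>R. R holomorphic_on ball (of_real s\<^sub>0) \<delta> \<and>
       (\<forall>w\<in>ball (of_real s\<^sub>0) \<delta>. norm (R w) \<le> C) \<and>
       (\<forall>s. \<bar>s - s\<^sub>0\<bar> < \<delta> \<longrightarrow> f t s = c\<^sub>0 + t * (g s + t * Re (R (of_real s)))))" for t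
  have small: "\<forall>\<^sub>F t in at_right 0. t * c < d" if "d > 0" for c d :: real
  proof -
    have "((\<lambda>t. t * c) \<longlongrightarrow> 0 * c) (at_right 0)"
      by (intro tendsto_intros)
    then show ?thesis
      using that by (auto dest: order_tendstoD)
  qed
  have ev: "\<forall>\<^sub>F t in at_right 0. good t"
    using expansion small[OF \<mu>(1), of "2 * C"] small[OF m, of C2] eventually_at_right_less[of 0]
    by eventually_elim (auto simp: good_def)
  have main: "\<exists>s. {s. is_arg_max (f t) (\<lambda>s. s \<in> {a..b}) s} = {s} \<and> \<bar>s - p\<bar> \<le> C1 / m * t" if gt: "good t" for t
  proof -
    have t: "t > 0" "t * (2 * C) < \<mu>" "t * C2 < m"
      using gt by (auto simp: good_def)
    \<comment> \<open>Solving the expansion for its error term gives one function on the whole line,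
      of which every local \<open>R\<close> is a complexification.\<close>
    define \<rho> where "\<rho> s = ((f t s - c\<^sub>0) / t - g s) / t" for s
    have f_eq: "f t s = c\<^sub>0 + t * (g s + t * \<rho> s)" for s
      using t by (simp add: \<rho>_def field_simps)
    have \<rho>: "\<bar>\<rho> s\<bar> \<le> C \<and> (\<rho> has_real_derivative deriv \<rho> s) (at s) \<and>
      (deriv \<rho> has_real_derivative deriv (deriv \<rho>) s) (at s) \<and> \<bar>deriv \<rho> s\<bar> \<le> C1 \<and>
      \<bar>deriv (deriv \<rho>) s\<bar> \<le> C2" for s
    proof -
      obtain R where R: "R holomorphic_on ball (of_real s) \<delta>"
         "\<And>w. w \<in> ball (of_real s) \<delta> \<Longrightarrow> norm (R w) \<le> C"
         "\<And>y. \<bar>y - s\<bar> < \<delta> \<Longrightarrow> f t y = c\<^sub>0 + t * (g y + t * Re (R (of_real y)))"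
        using gt unfolding good_def by meson
      have "\<rho> y = Re (R (of_real y))" if "\<bar>y - s\<bar> < \<delta>" for y
        using R(3)[OF that] f_eq[of y] t by simp
      from Re_trace_derivative_bounds[OF R(1) \<delta> R(2) this] show ?thesis
        by (simp add: C1_def C2_def)
    qed
    define F' where "F' s = t * (g' s + t * deriv \<rho> s)" for s
    define F'' where "F'' s = t * (g'' s + t * deriv (deriv \<rho>) s)" for s
    have f1: "(f t has_real_derivative F' s) (at s)" for s
    proof -
      have "((\<lambda>s. c\<^sub>0 + t * (g s + t * \<rho> s)) has_real_derivative F' s) (at s)"
        unfolding F'_def using \<rho>[of s] g1[of s] by (auto intro!: derivative_eq_intros)
      then show ?thesis
        by (simp add: f_eq[abs_def])
    qed
    have f2: "(F' has_real_derivative F'' s) (at s)" for s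
      unfolding F'_def F''_def using \<rho>[of s] g2[of s] by (auto intro!: derivative_eq_intros)
    have F''neg: "F'' s < 0" if "\<bar>s - p\<bar> \<le> \<eta>" for s
    proof -
      have "t * deriv (deriv \<rho>) s \<le> t * C2"
        using \<rho>[of s] t by (intro mult_left_mono) auto
      then have "g'' s + t * deriv (deriv \<rho>) s < 0"
        using g''m[OF that] t by linarith
      then show ?thesis
        using t by (simp add: F''_def mult_pos_neg)
    qed
    have crit: "\<bar>s - p\<bar> < \<eta> \<and> F' s = 0" if s: "s \<in> {a..b}" "\<And>y. y \<in> {a..b} \<Longrightarrow> f t y \<le> f t s" for s
    proof -
      have "f t p \<le> f t s"
        using s(2)[of p] p by simp
      then have "g p + t * \<rho> p \<le> g s + t * \<rho> s"
        using t by (simp add: f_eq)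
      moreover have "t * \<rho> s \<le> t * C" "t * (- \<rho> p) \<le> t * C"
        using \<rho>[of s] \<rho>[of p] t by (intro mult_left_mono; simp add: abs_le_iff)+
      moreover have "t * (2 * C) = t * C + t * C" "t * (- \<rho> p) = - (t * \<rho> p)"
        by simp_all
      ultimately have "g p - \<mu> < g s"
        using t(2) by linarith
      then have near: "\<bar>s - p\<bar> < \<eta>"
        using \<mu>(2)[of s] s(1) by force
      have "F' s = 0"
      proof (rule DERIV_local_max[OF f1, of "min (s - a) (b - s)"])
        show "0 < min (s - a) (b - s)"
          using near \<eta> by (auto simp: abs_less_iff)
        show "\<forall>y. \<bar>s - y\<bar> < min (s - a) (b - s) \<longrightarrow> f t y \<le> f t s"
          by (intro allI impI s(2)) (auto simp: abs_less_iff)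
      qed
      with near show ?thesis by simp
    qed
    have "continuous_on {a..b} (f t)"
      using f1 DERIV_isCont continuous_at_imp_continuous_on by blast
    then obtain s where s: "s \<in> {a..b}" "\<And>y. y \<in> {a..b} \<Longrightarrow> f t y \<le> f t s"
      using continuous_attains_sup[of "{a..b}" "f t"] p by auto
    have uniq: "y \<le> s'" if y: "y \<in> {a..b}" "\<And>z. z \<in> {a..b} \<Longrightarrow> f t z \<le> f t y"
      and s': "s' \<in> {a..b}" "\<And>z. z \<in> {a..b} \<Longrightarrow> f t z \<le> f t s'" for y s'
    proof (rule ccontr)
      assume "\<not> y \<le> s'"
      then have "s' < y" by simp
      \<comment> \<open>Two maximisers are two zeros of \<open>F'\<close> near \<open>p\<close>,
        which would force a zero of \<open>F''\<close> between them.\<close>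
      from MVT2[OF this f2] obtain z where z: "s' < z" "z < y" "F' y - F' s' = (y - s') * F'' z"
        by blast
      then have "F'' z = 0"
        using crit[OF y] crit[OF s'] by simp
      moreover have "\<bar>z - p\<bar> \<le> \<eta>"
        using crit[OF y] crit[OF s'] z by (auto simp: abs_less_iff abs_le_iff)
      ultimately show False
        using F''neg[of z] by simp
    qed
    have "{s. is_arg_max (f t) (\<lambda>s. s \<in> {a..b}) s} = {s}"
    proof (rule set_eqI)
      fix y
      have "y = s" if "is_arg_max (f t) (\<lambda>s. s \<in> {a..b}) y"
      proof -
        have y: "y \<in> {a..b}" "\<And>z. z \<in> {a..b} \<Longrightarrow> f t z \<le> f t y"
          using that by (auto simp: is_arg_max_def not_less)
        show ?thesis
          using uniq[OF y s] uniq[OF s y] by simp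
      qed
      moreover have "is_arg_max (f t) (\<lambda>s. s \<in> {a..b}) s"
        using s by (auto simp: is_arg_max_def not_less)
      ultimately show "y \<in> {s. is_arg_max (f t) (\<lambda>s. s \<in> {a..b}) s} \<longleftrightarrow> y \<in> {s}"
        by auto
    qed
    moreover have "\<bar>s - p\<bar> \<le> C1 / m * t"
    proof -
      have near: "\<bar>s - p\<bar> < \<eta>" and F's: "F' s = 0"
        using crit[OF s] by auto
      have "g' s = - t * deriv \<rho> s"
        using F's t by (simp add: F'_def)
      then have "\<bar>g' s\<bar> \<le> t * C1"
        using \<rho>[of s] t by (simp add: abs_mult)
      \<comment> \<open>Since g' vanishes at \<open>p\<close> and has slope below -m nearby, the
        distance to \<open>p\<close> is controlled by g'(s), which the critical point equation makes
        of order \<open>t\<close>.\<close>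
      moreover have "m * \<bar>s - p\<bar> \<le> \<bar>g' s\<bar>"
      proof (cases s p rule: linorder_cases)
        case less
        from MVT2[OF this g2] obtain z where z: "s < z" "z < p" "g' p - g' s = (p - s) * g'' z"
          by blast
        then have "g' s = (s - p) * g'' z"
          using g'p by (simp add: algebra_simps)
        then have "\<bar>g' s\<bar> = \<bar>s - p\<bar> * \<bar>g'' z\<bar>"
          by (simp add: abs_mult)
        moreover have "m \<le> \<bar>g'' z\<bar>"
          using g''m[of z] z near by (auto simp: abs_less_iff)
        ultimately show ?thesis
          by (simp add: mult.commute mult_right_mono)
      next
        case greater
        from MVT2[OF this g2] obtain z where z: "p < z" "z < s" "g' s - g' p = (s - p) * g'' z"
          by blast
        then have "\<bar>g' s\<bar> = \<bar>s - p\<bar> * \<bar>g'' z\<bar>"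
          using g'p by (simp add: abs_mult)
        moreover have "m \<le> \<bar>g'' z\<bar>"
          using g''m[of z] z near by (auto simp: abs_less_iff)
        ultimately show ?thesis
          by (simp add: mult.commute mult_right_mono)
      qed auto
      ultimately show ?thesis
        using m by (simp add: field_simps)
    qed
    ultimately show ?thesis by blast
  qed
  define \<sigma> where "\<sigma> t = (SOME s. {s. is_arg_max (f t) (\<lambda>s. s \<in> {a..b}) s} = {s} \<and> \<bar>s - p\<bar> \<le> C1 / m * t)" for t
  have \<sigma>: "{s. is_arg_max (f t) (\<lambda>s. s \<in> {a..b}) s} = {\<sigma> t} \<and> \<bar>\<sigma> t - p\<bar> \<le> C1 / m * t" if "good t" for t
    using someI_ex[OF main[OF that]] unfolding \<sigma>_def .
  show ?thesis
  proof (rule that)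
    show "\<forall>\<^sub>F t in at_right 0. {s. is_arg_max (f t) (\<lambda>s. s \<in> {a..b}) s} = {\<sigma> t}"
      using ev by eventually_elim (use \<sigma> in blast)
    show "(\<lambda>t. \<sigma> t - p) \<in> O[at_right 0](\<lambda>t. t)"
    proof (rule bigoI)
      show "\<forall>\<^sub>F t in at_right 0. norm (\<sigma> t - p) \<le> C1 / m * norm t"
        using ev by eventually_elim (use \<sigma> in \<open>auto simp: good_def\<close>)
    qed
  qed
qed

section \<open>The domain and its complexified boundary curve\<close>

text \<open>Uniformity in \<open>t\<close> is part of the notion, so that closure under algebraic
  operations yields error constants independent of \<open>t\<close> directly from the shape of a
  formula.\<close>

definition strip_bounded :: "(real \<Rightarrow> complex \<Rightarrow> complex) \<Rightarrow> bool" where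
  "strip_bounded \<Phi> \<longleftrightarrow> (\<exists>C. \<forall>t w. 0 \<le> t \<longrightarrow> t \<le> 1 \<longrightarrow> \<bar>Im w\<bar> \<le> 1 \<longrightarrow> norm (\<Phi> t w) \<le> C)"

lemma strip_boundedD:
  assumes "strip_bounded \<Phi>"
  shows "\<exists>C>0. \<forall>t w. 0 \<le> t \<longrightarrow> t \<le> 1 \<longrightarrow> \<bar>Im w\<bar> \<le> 1 \<longrightarrow> norm (\<Phi> t w) \<le> C"
proof -
  obtain C where "\<forall>t w. 0 \<le> t \<longrightarrow> t \<le> 1 \<longrightarrow> \<bar>Im w\<bar> \<le> 1 \<longrightarrow> norm (\<Phi> t w) \<le> C"
    using assms unfolding strip_bounded_def by blast
  then show ?thesis
    by (intro exI[of _ "max C 1"]) (auto simp: le_max_iff_disj)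
qed

lemma strip_bounded_const: "strip_bounded (\<lambda>t w. c)"
  by (auto simp: strip_bounded_def)

lemma strip_bounded_parameter: "strip_bounded (\<lambda>t w. of_real t)"
  unfolding strip_bounded_def by (intro exI[of _ 1]) auto

lemma strip_bounded_add:
  assumes "strip_bounded \<Phi>" "strip_bounded \<Psi>"
  shows "strip_bounded (\<lambda>t w. \<Phi> t w + \<Psi> t w)"
proof -
  obtain B where "\<forall>t w. 0 \<le> t \<longrightarrow> t \<le> 1 \<longrightarrow> \<bar>Im w\<bar> \<le> 1 \<longrightarrow> norm (\<Phi> t w) \<le> B"
    using assms(1) unfolding strip_bounded_def by blast
  moreover obtain C where "\<forall>t w. 0 \<le> t \<longrightarrow> t \<le> 1 \<longrightarrow> \<bar>Im w\<bar> \<le> 1 \<longrightarrow> norm (\<Psi> t w) \<le> C"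
    using assms(2) unfolding strip_bounded_def by blast
  ultimately show ?thesis
    unfolding strip_bounded_def by (intro exI[of _ "B + C"] allI impI norm_triangle_mono) auto
qed

lemma strip_bounded_mult:
  assumes "strip_bounded \<Phi>" "strip_bounded \<Psi>"
  shows "strip_bounded (\<lambda>t w. \<Phi> t w * \<Psi> t w)"
proof -
  obtain B where "B > 0" "\<forall>t w. 0 \<le> t \<longrightarrow> t \<le> 1 \<longrightarrow> \<bar>Im w\<bar> \<le> 1 \<longrightarrow> norm (\<Phi> t w) \<le> B"
    using strip_boundedD[OF assms(1)] by blast
  moreover obtain C where "\<forall>t w. 0 \<le> t \<longrightarrow> t \<le> 1 \<longrightarrow> \<bar>Im w\<bar> \<le> 1 \<longrightarrow> norm (\<Psi> t w) \<le> C"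
    using strip_boundedD[OF assms(2)] by blast
  ultimately show ?thesis
    unfolding strip_bounded_def norm_mult by (intro exI[of _ "B * C"] allI impI mult_mono) auto
qed

lemma strip_bounded_minus: "strip_bounded \<Phi> \<Longrightarrow> strip_bounded (\<lambda>t w. - \<Phi> t w)"
  by (simp add: strip_bounded_def)

lemma strip_bounded_diff:
  "strip_bounded \<Phi> \<Longrightarrow> strip_bounded \<Psi> \<Longrightarrow> strip_bounded (\<lambda>t w. \<Phi> t w - \<Psi> t w)"
  using strip_bounded_add[of \<Phi> "\<lambda>t w. - \<Psi> t w"] by (simp add: strip_bounded_minus)

lemma strip_bounded_power: "strip_bounded \<Phi> \<Longrightarrow> strip_bounded (\<lambda>t w. \<Phi> t w ^ n)"
  by (induction n) (auto intro: strip_bounded_const strip_bounded_mult)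

lemma strip_bounded_divide_const: "strip_bounded \<Phi> \<Longrightarrow> strip_bounded (\<lambda>t w. \<Phi> t w / c)"
  using strip_bounded_mult[OF _ strip_bounded_const[of "inverse c"]] by (simp add: divide_inverse)

lemma strip_bounded_exp: "strip_bounded (\<lambda>t w. exp (\<i> * (numeral n * w)))"
  unfolding strip_bounded_def
proof (intro exI allI impI)
  fix w :: complex
  assume w: "\<bar>Im w\<bar> \<le> 1"
  have "- (numeral n * Im w) \<le> (numeral n :: real)"
    using w mult_left_mono[of "- Im w" 1 "numeral n"] by (simp add: abs_le_iff)
  then show "norm (exp (\<i> * (numeral n * w))) \<le> exp (numeral n)"
    by simp
qed

lemma strip_bounded_cos: "strip_bounded (\<lambda>t w. cos (numeral n * w))"
  and strip_bounded_sin: "strip_bounded (\<lambda>t w. sin (numeral n * w))"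
proof -
  have *: "exp \<bar>Im (numeral n * w)\<bar> \<le> exp (numeral n)" if "\<bar>Im w\<bar> \<le> 1" for w
    using that by (simp add: abs_mult)
  have "norm (cos z) \<le> exp \<bar>Im z\<bar>" "norm (sin z) \<le> exp \<bar>Im z\<bar>" for z :: complex
    using cmod_cos_le_exp[of 1 z] cmod_sin_le_exp[of 1 z] by auto
  then have "norm (cos (numeral n * w)) \<le> exp (numeral n)" "norm (sin (numeral n * w)) \<le> exp (numeral n)"
    if "\<bar>Im w\<bar> \<le> 1" for w
    using *[OF that] order_trans by blast+
  then show "strip_bounded (\<lambda>t w. cos (numeral n * w))" "strip_bounded (\<lambda>t w. sin (numeral n * w))"
    unfolding strip_bounded_def by blast+
qed

lemmas strip_bounded_intros =
  strip_bounded_const strip_bounded_parameter strip_bounded_add strip_bounded_mult strip_bounded_minus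
  strip_bounded_diff strip_bounded_power strip_bounded_divide_const strip_bounded_exp
  strip_bounded_cos strip_bounded_sin

section \<open>The boundary profile as an entire function and as a function of direction\<close>

definition czeta :: "complex \<Rightarrow> complex" where
  "czeta w = - 4 * cos (2 * w) + cos (4 * w)"

definition czeta' :: "complex \<Rightarrow> complex" where
  "czeta' w = 8 * sin (2 * w) - 4 * sin (4 * w)"

lemma czeta_derivative [derivative_intros]: "(czeta has_field_derivative czeta' w) (at w within A)"
  unfolding czeta_def czeta'_def by (auto intro!: derivative_eq_intros)

lemma holomorphic_on_czeta [holomorphic_intros]: "czeta holomorphic_on A"
  unfolding czeta_def by (intro holomorphic_intros)

lemma holomorphic_on_czeta' [holomorphic_intros]: "czeta' holomorphic_on A"
  unfolding czeta'_def by (intro holomorphic_intros)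

lemma czeta_of_real: "czeta (of_real s) = of_real (zeta s)"
  by (simp add: czeta_def zeta_def flip: cos_of_real)

lemma strip_bounded_czeta: "strip_bounded (\<lambda>t w. czeta w)"
  unfolding czeta_def by (intro strip_bounded_intros)

lemma strip_bounded_czeta': "strip_bounded (\<lambda>t w. czeta' w)"
  unfolding czeta'_def by (intro strip_bounded_intros)

text \<open>The profile at the direction of \<open>z\<close>, expressed through \<open>sgn\<close>
  instead of \<open>Arg\<close>. This removes the jump of \<open>Arg\<close> on the negative axis
  and leaves the origin, where the value is 0, as the only exceptional point.\<close>

definition zdir :: "complex \<Rightarrow> real" where
  "zdir z = - 4 * Re (sgn z ^ 2) + Re (sgn z ^ 4)"

lemma zdir_rcis:
  assumes "r > 0"
  shows "zdir (rcis r s) = zeta s"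
proof -
  have "sgn (rcis r s) = cis s"
    using assms by (simp add: rcis_def sgn_div_norm norm_mult scaleR_conv_of_real field_simps)
  moreover have "cis s ^ 2 = cis (2 * s)" "cis s ^ 4 = cis (4 * s)"
    using Complex.DeMoivre[of s 2] Complex.DeMoivre[of s 4] by simp_all
  ultimately show ?thesis
    by (simp add: zdir_def zeta_def)
qed

lemma zeta_Arg: "z \<noteq> 0 \<Longrightarrow> zeta (Arg z) = zdir z"
  using zdir_rcis[of "norm z" "Arg z"] by (simp add: rcis_cmod_Arg)

lemma abs_zeta_le: "\<bar>zeta s\<bar> \<le> 5"
  using cos_le_one[of "2 * s"] cos_le_one[of "4 * s"] cos_ge_minus_one[of "2 * s"] cos_ge_minus_one[of "4 * s"]
  unfolding zeta_def by linarith

lemma abs_zdir_le: "\<bar>zdir z\<bar> \<le> 5"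
  using zeta_Arg[of z] abs_zeta_le[of "Arg z"] by (cases "z = 0") (auto simp: zdir_def)

lemma zdir_scaleR: "c > 0 \<Longrightarrow> zdir (c *\<^sub>R z) = zdir z"
  by (simp add: zdir_def sgn_scaleR)

lemma continuous_on_zdir: "0 \<notin> A \<Longrightarrow> continuous_on A zdir"
  unfolding zdir_def by (intro continuous_intros) auto

text \<open>Normalisation is 4-Lipschitz outside radius 1/2, and -4 x^2 + x^4 has Lipschitz constant
  4 * 2 + 4 = 12 on the unit circle; hence 48.\<close>

lemma zdir_diff_le:
  assumes "norm a \<ge> 1 / 2" "norm b \<ge> 1 / 2"
  shows "\<bar>zdir a - zdir b\<bar> \<le> 48 * norm (a - b)"
proof -
  define x where "x = sgn a"
  define y where "y = sgn b"
  have nz: "a \<noteq> 0" "b \<noteq> 0"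
    using assms by auto
  then have ab: "a = norm a *\<^sub>R x" "b = norm b *\<^sub>R y"
    by (auto simp: x_def y_def sgn_div_norm)
  have xy: "norm x = 1" "norm y = 1"
    using nz by (auto simp: x_def y_def norm_sgn)
  have "norm b * norm (x - y) = norm (norm b *\<^sub>R x - b)"
    using ab(2) by (metis norm_scaleR abs_norm_cancel scaleR_diff_right)
  also have "\<dots> = norm (a - b + (norm b - norm a) *\<^sub>R x)"
    using ab(1) by (metis (no_types) add.commute add_diff_eq diff_add_cancel scaleR_left_diff_distrib)
  also have "\<dots> \<le> norm (a - b) + norm (a - b)"
    by (rule order_trans[OF norm_triangle_ineq])
      (use norm_triangle_ineq3[of a b] xy in \<open>auto simp: abs_minus_commute\<close>)
  finally have 1: "norm (x - y) \<le> 4 * norm (a - b)"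
    using assms(2) mult_right_mono[of "1/2" "norm b" "norm (x - y)"] by simp
  have 2: "norm (x ^ n - y ^ n) \<le> real n * norm (x - y)" for n
    by (rule norm_power_diff) (use xy in auto)
  have "zdir a - zdir b = - 4 * Re (x ^ 2 - y ^ 2) + Re (x ^ 4 - y ^ 4)"
    by (simp add: zdir_def x_def y_def)
  also have "\<bar>\<dots>\<bar> \<le> 4 * norm (x ^ 2 - y ^ 2) + norm (x ^ 4 - y ^ 4)"
    using abs_Re_le_cmod[of "x ^ 2 - y ^ 2"] abs_Re_le_cmod[of "x ^ 4 - y ^ 4"] by linarith
  also have "\<dots> \<le> 12 * norm (x - y)"
    using 2[of 2] 2[of 4] by simp
  finally show ?thesis
    using 1 by linarith
qed

text \<open>Only the origin needs care: there \<open>Arg\<close> gives the profile value -3 and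
  \<open>zdir\<close> gives 0, but for such \<open>t\<close> both descriptions include the
  point.\<close>

lemma Omega_eq_zdir:
  assumes "t \<in> {0<..<1/10}"
  shows "Omega t = {z. norm z < 1 + t * zdir z}"
proof -
  have "norm z < 1 + t * zeta (Arg z) \<longleftrightarrow> norm z < 1 + t * zdir z" for z
  proof (cases "z = 0")
    case True
    then show ?thesis
      using assms by (simp add: zeta_def Arg_zero zdir_def)
  qed (simp add: zeta_Arg)
  then show ?thesis
    by (simp add: Omega_def)
qed

text \<open>Since |\<zeta>| is at most 5, the threshold 1/10 keeps boundary radii between 1/2 and
  3/2.\<close>

lemma t_zdir_bound:
  assumes "t \<in> {0<..<1/10}"
  shows "\<bar>t * zdir z\<bar> < 1/2"
proof -
  have "t * \<bar>zdir z\<bar> \<le> t * 5"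
    using assms abs_zdir_le[of z] by (intro mult_left_mono) auto
  moreover have "\<bar>t * zdir z\<bar> = t * \<bar>zdir z\<bar>"
    using assms by (simp add: abs_mult)
  moreover have "t * 5 < 1/2"
    using assms by simp
  ultimately show ?thesis
    by linarith
qed

text \<open>The singular point of \<open>zdir\<close> is harmless because boundary radii exceed 1/2:
  open and closed conditions need testing only where |z| is at least 1/2.\<close>

lemma
  assumes t: "t \<in> {0<..<1/10}"
  shows open_Omega: "open (Omega t)"
    and closure_Omega: "closure (Omega t) = {z. norm z \<le> 1 + t * zdir z}"
    and frontier_Omega: "frontier (Omega t) = {z. norm z = 1 + t * zdir z}"
    and starlike_Omega: "starlike (Omega t)"
    and bounded_Omega: "bounded (Omega t)"
proof -
  note \<Omega> = Omega_eq_zdir[OF t]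
  have half: "1/2 < 1 + t * zdir z" for z
    using t_zdir_bound[OF t, of z] by linarith
  let ?A = "{z::complex. 1/2 \<le> norm z}"
  have A: "closed ?A"
    by (intro closed_Collect_le continuous_intros)
  have cont: "continuous_on ?A zdir"
    by (rule continuous_on_zdir) auto
  have "closed {z \<in> ?A. 1 + t * zdir z \<le> norm z}"
    by (intro continuous_on_closed_Collect_le A continuous_intros cont)
  moreover have "Omega t = - {z \<in> ?A. 1 + t * zdir z \<le> norm z}"
  proof (rule set_eqI)
    show "z \<in> Omega t \<longleftrightarrow> z \<in> - {z \<in> ?A. 1 + t * zdir z \<le> norm z}" for z
      using half[of z] by (auto simp: \<Omega>)
  qed
  ultimately show op: "open (Omega t)"
    by (simp add: open_Compl)
  have "closed {z \<in> ?A. norm z \<le> 1 + t * zdir z}"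
    by (intro continuous_on_closed_Collect_le A continuous_intros cont)
  then have "closed (cball 0 (1/2) \<union> {z \<in> ?A. norm z \<le> 1 + t * zdir z})"
    by (intro closed_Un closed_cball)
  moreover have "cball 0 (1/2) \<union> {z \<in> ?A. norm z \<le> 1 + t * zdir z} = {z. norm z \<le> 1 + t * zdir z}"
  proof (rule set_eqI)
    show "z \<in> cball 0 (1/2) \<union> {z \<in> ?A. norm z \<le> 1 + t * zdir z} \<longleftrightarrow> z \<in> {z. norm z \<le> 1 + t * zdir z}" for z
      using half[of z] by auto
  qed
  ultimately have cl: "closed {z. norm z \<le> 1 + t * zdir z}"
    by simp
  \<comment> \<open>Radial contraction pushes boundary points inside. It gives starlikeness and, as
    c tends to 1, shows that the closure contains the whole boundary curve.\<close>
  have scale: "c *\<^sub>R z \<in> Omega t" if "norm z \<le> 1 + t * zdir z" "0 \<le> c" "c < 1" for c z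
  proof (cases "c = 0 \<or> z = 0")
    case False
    then have "c * norm z < norm z"
      using that by simp
    then have "c * norm z < 1 + t * zdir z"
      using that by linarith
    with False that show ?thesis
      by (simp add: \<Omega> zdir_scaleR)
  qed (use half[of 0] in \<open>auto simp: \<Omega>\<close>)
  have "z \<in> closure (Omega t)" if z: "norm z \<le> 1 + t * zdir z" for z
  proof -
    have "(\<lambda>c::real. c *\<^sub>R z) ` closure {0..<1} \<subseteq> closure (Omega t)"
      using scale[OF z] closure_subset[of "Omega t"]
      by (intro image_closure_subset) (auto intro!: continuous_intros)
    moreover have "1 *\<^sub>R z \<in> (\<lambda>c::real. c *\<^sub>R z) ` closure {0..<1}"
      by (rule imageI) simp
    ultimately have "1 *\<^sub>R z \<in> closure (Omega t)"
      by (rule subsetD)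
    then show ?thesis by simp
  qed
  moreover have "closure (Omega t) \<subseteq> {z. norm z \<le> 1 + t * zdir z}"
    by (rule closure_minimal[OF _ cl]) (auto simp: \<Omega>)
  ultimately show clos: "closure (Omega t) = {z. norm z \<le> 1 + t * zdir z}"
    by blast
  show "frontier (Omega t) = {z. norm z = 1 + t * zdir z}"
    unfolding frontier_def clos interior_open[OF op] by (auto simp: \<Omega>)
  show "starlike (Omega t)"
    unfolding starlike_def
  proof (intro bexI[of _ 0] ballI subsetI)
    show 0: "0 \<in> Omega t"
      using half[of 0] by (simp add: \<Omega>)
    fix z y
    assume z: "z \<in> Omega t" and "y \<in> closed_segment 0 z"
    then obtain c where c: "y = c *\<^sub>R z" "0 \<le> c" "c \<le> 1"
      by (auto simp: in_segment)
    then show "y \<in> Omega t"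
      using z scale[of z c] by (cases "c = 1") (auto simp: \<Omega>)
  qed
  have "norm z \<le> 2" if "z \<in> Omega t" for z
    using that t_zdir_bound[OF t, of z] by (auto simp: \<Omega>)
  then show "bounded (Omega t)"
    by (auto simp: bounded_iff)
qed

section \<open>The complexified boundary curve and the sides of the real axis\<close>

definition bcurve :: "real \<Rightarrow> complex \<Rightarrow> complex" where
  "bcurve t w = (1 + of_real t * czeta w) * exp (\<i> * w)"

lemma holomorphic_on_bcurve [holomorphic_intros]: "bcurve t holomorphic_on A"
  unfolding bcurve_def by (intro holomorphic_intros)

lemma bcurve_of_real: "bcurve t (of_real s) = rcis (1 + t * zeta s) s"
  by (simp add: bcurve_def czeta_of_real rcis_def cis_conv_exp)

lemma t_zeta_bound:
  assumes "t \<in> {0<..<1/10}"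
  shows "\<bar>t * zeta s\<bar> < 1/2"
  using t_zdir_bound[OF assms, of "cis s"] zdir_rcis[of 1 s] by (simp add: rcis_def)

lemma bcurve_in_frontier:
  assumes "t \<in> {0<..<1/10}"
  shows "bcurve t (of_real s) \<in> frontier (Omega t)"
  using t_zeta_bound[OF assms, of s] by (auto simp: frontier_Omega[OF assms] bcurve_of_real zdir_rcis)

lemma frontier_eq_bcurve:
  assumes "t \<in> {0<..<1/10}" "z \<in> frontier (Omega t)"
  shows "z = bcurve t (of_real (Arg z))"
proof -
  have "z \<noteq> 0"
    using assms t_zdir_bound[OF assms(1), of 0] by (auto simp: frontier_Omega)
  then show ?thesis
    using assms rcis_cmod_Arg[of z] by (simp add: bcurve_of_real zeta_Arg frontier_Omega)
qed

text \<open>\<open>inside\<close> permits pulling functions on the domain back to upper half discs.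
  \<open>outside\<close> serves the way back: a point of the closure near the boundary can only come
  from a parameter with nonnegative imaginary part. The last two bounds keep the derivative of
  \<open>bcurve\<close> away from 0.\<close>

locale thin_star =
  fixes t :: real
  assumes t: "t \<in> {0<..<1/10}"
    and inside: "\<And>w. \<bar>Im w\<bar> \<le> 1 \<Longrightarrow> 0 < Im w \<Longrightarrow> bcurve t w \<in> Omega t"
    and outside: "\<And>w. \<bar>Im w\<bar> \<le> 1 \<Longrightarrow> Im w < 0 \<Longrightarrow> bcurve t w \<notin> closure (Omega t)"
    and small: "\<And>w. \<bar>Im w\<bar> \<le> 1 \<Longrightarrow> norm (of_real t * czeta w) \<le> 1/4"
    and small': "\<And>w. \<bar>Im w\<bar> \<le> 1 \<Longrightarrow> norm (of_real t * czeta' w) \<le> 1/4"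

text \<open>To first order in \<open>y\<close>, the point \<open>\<gamma>(s + iy)\<close> exceeds the boundary radius in its direction by
  \<open>- y (1 + t \<zeta>(s))\<close>, so crossing the real axis upwards enters the domain.\<close>

lemma thin_star_small:
  obtains t\<^sub>0 where "t\<^sub>0 > 0" "\<And>t. t \<in> {0<..<t\<^sub>0} \<Longrightarrow> thin_star t"
proof -
  obtain M where M: "M > 0" "\<forall>t w. 0 \<le> t \<longrightarrow> t \<le> (1::real) \<longrightarrow> \<bar>Im w\<bar> \<le> 1 \<longrightarrow> norm (czeta w) \<le> M"
    using strip_boundedD[OF strip_bounded_czeta] by blast
  obtain L where L: "L > 0" "\<forall>t w. 0 \<le> t \<longrightarrow> t \<le> (1::real) \<longrightarrow> \<bar>Im w\<bar> \<le> 1 \<longrightarrow> norm (czeta' w) \<le> L"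
    using strip_boundedD[OF strip_bounded_czeta'] by blast
  \<comment> \<open>The summand 10 gives t < 1/10, the others the bounds 1/4. Here 51 = 3 + 48, from
    e \<le> 3 and the Lipschitz constant of \<open>zdir\<close>.\<close>
  define t\<^sub>0 where "t\<^sub>0 = 1 / (10 + 4 * M + 4 * 51 * L)"
  have pos: "10 + 4 * M + 4 * 51 * L > 10"
    using M(1) L(1) by simp
  then have t0: "t\<^sub>0 \<in> {0<..<1/10}"
    unfolding t\<^sub>0_def by (auto simp: divide_less_eq)
  have tML: "t * M \<le> 1/4" "t * L \<le> 1/4" "t * (51 * L) < 1/4" if t: "t \<in> {0<..<t\<^sub>0}" for t
  proof -
    have "t * (10 + 4 * M + 4 * 51 * L) < 1"
      using t pos by (simp add: t\<^sub>0_def field_simps)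
    moreover have "0 < t * M" "0 < t * L"
      using t M(1) L(1) by auto
    moreover have "t * (10 + 4 * M + 4 * 51 * L) = 10 * t + 4 * (t * M) + 204 * (t * L)" "t * (51 * L) = 51 * (t * L)"
      by (simp_all add: algebra_simps)
    ultimately show "t * M \<le> 1/4" "t * L \<le> 1/4" "t * (51 * L) < 1/4"
      using t by auto
  qed
  have bounds: "norm (of_real t * czeta w) \<le> 1/4" "norm (of_real t * czeta' w) \<le> 1/4"
    if t: "t \<in> {0<..<t\<^sub>0}" and w: "\<bar>Im w\<bar> \<le> 1" for t w
  proof -
    have "t * norm (czeta w) \<le> t * M" "t * norm (czeta' w) \<le> t * L"
      using t M(2)[rule_format, of 0 w] L(2)[rule_format, of 0 w] w by (auto intro!: mult_left_mono)
    moreover have "norm (of_real t * czeta w) = t * norm (czeta w)" "norm (of_real t * czeta' w) = t * norm (czeta' w)"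
      using t by (simp_all add: norm_mult)
    ultimately show "norm (of_real t * czeta w) \<le> 1/4" "norm (of_real t * czeta' w) \<le> 1/4"
      using tML(1,2)[OF t] by linarith+
  qed
  have strip: "convex {w. \<bar>Im w\<bar> \<le> 1}"
  proof -
    have "{w. \<bar>Im w\<bar> \<le> 1} = {w. Im w \<le> 1} \<inter> {w. Im w \<ge> -1}"
      by auto
    then show ?thesis
      by (simp add: convex_Int convex_halfspace_Im_le convex_halfspace_Im_ge)
  qed
  have defect: "\<bar>norm (bcurve t w) - 1 - t * zdir (bcurve t w) - (exp (- Im w) - 1) * (1 + t * zeta (Re w))\<bar> \<le> t * (51 * L) * \<bar>Im w\<bar>"
    "norm (bcurve t w) > 0"
    if t: "t \<in> {0<..<t\<^sub>0}" and w: "\<bar>Im w\<bar> \<le> 1" for t w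
  proof -
    define s where "s = Re w"
    \<comment> \<open>Up to the factor exp (- Im w), which \<open>zdir\<close> ignores,
      \<open>a\<close> is the point on the curve; \<open>b\<close> is its counterpart at the real
      parameter, and their difference carries a factor \<open>t\<close>.\<close>
    define a where "a = cis s * (1 + of_real t * czeta w)"
    define b where "b = cis s * (1 + of_real t * czeta (of_real s))"
    have t': "t \<in> {0<..<1/10}"
      using t t0 by auto
    have "exp (\<i> * w) = exp (- Im w) *\<^sub>R cis s"
      unfolding exp_eq_polar[of "\<i> * w"] by (simp add: s_def scaleR_conv_of_real)
    then have curve: "bcurve t w = exp (- Im w) *\<^sub>R a"
      by (simp add: bcurve_def a_def algebra_simps)
    have na: "norm a \<ge> 1/2"
      using bounds(1)[OF t w] norm_diff_ineq[of 1 "of_real t * czeta w"] by (simp add: a_def norm_mult)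
    have b: "b = rcis (1 + t * zeta s) s" "norm b = 1 + t * zeta s" "zdir b = zeta s"
    proof -
      show b: "b = rcis (1 + t * zeta s) s"
        by (simp add: b_def rcis_def czeta_of_real mult.commute)
      show "norm b = 1 + t * zeta s" "zdir b = zeta s"
        using t_zeta_bound[OF t', of s] by (simp_all add: b zdir_rcis)
    qed
    have nb: "norm b \<ge> 1/2"
      using t_zeta_bound[OF t', of s] b by simp
    have "norm (czeta w - czeta (of_real s)) \<le> L * norm (w - of_real s)"
      by (rule field_differentiable_bound[OF strip, where f'=czeta']) (use w L(2)[rule_format, of 0] in \<open>auto intro!: derivative_intros\<close>)
    also have "w - of_real s = \<i> * of_real (Im w)"
      by (simp add: s_def complex_eq_iff)
    finally have dz: "norm (czeta w - czeta (of_real s)) \<le> L * \<bar>Im w\<bar>"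
      by (simp add: norm_mult)
    have "a - b = cis s * (of_real t * (czeta w - czeta (of_real s)))"
      by (simp add: a_def b_def algebra_simps)
    then have "norm (a - b) = t * norm (czeta w - czeta (of_real s))"
      using t by (simp add: norm_mult)
    also have "\<dots> \<le> t * (L * \<bar>Im w\<bar>)"
      using dz t by (intro mult_left_mono) auto
    finally have ab: "norm (a - b) \<le> t * (L * \<bar>Im w\<bar>)" .
    have 1: "\<bar>norm a - norm b\<bar> \<le> t * (L * \<bar>Im w\<bar>)"
      using norm_triangle_ineq3[of a b] ab by linarith
    have 2: "\<bar>zdir a - zdir b\<bar> \<le> 48 * (t * (L * \<bar>Im w\<bar>))"
      using zdir_diff_le[OF na nb] ab by linarith
    have e3: "exp (- Im w) \<le> 3"
    proof -
      have "exp (- Im w) \<le> exp 1"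
        using w by simp
      then show ?thesis
        using exp_le by linarith
    qed
    have "norm (bcurve t w) - 1 - t * zdir (bcurve t w) - (exp (- Im w) - 1) * (1 + t * zeta (Re w))
       = exp (- Im w) * (norm a - norm b) - t * (zdir a - zdir b)"
      by (simp add: curve zdir_scaleR b(2,3) s_def[symmetric] algebra_simps)
    also have "\<bar>\<dots>\<bar> \<le> exp (- Im w) * \<bar>norm a - norm b\<bar> + t * \<bar>zdir a - zdir b\<bar>"
      using t by (intro order_trans[OF abs_triangle_ineq4]) (simp add: abs_mult)
    also have "\<dots> \<le> 3 * (t * (L * \<bar>Im w\<bar>)) + 1 * (48 * (t * (L * \<bar>Im w\<bar>)))"
      using 1 2 e3 t t0 by (intro add_mono mult_mono) auto
    finally show "\<bar>norm (bcurve t w) - 1 - t * zdir (bcurve t w) - (exp (- Im w) - 1) * (1 + t * zeta (Re w))\<bar> \<le> t * (51 * L) * \<bar>Im w\<bar>"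
      by (simp add: mult_ac)
    show "norm (bcurve t w) > 0"
      using na by (auto simp: curve intro!: mult_pos_pos)
  qed
  show ?thesis
  proof (rule that)
    show "t\<^sub>0 > 0"
      using t0 by simp
    fix t
    assume t: "t \<in> {0<..<t\<^sub>0}"
    show "thin_star t"
    proof
      show t': "t \<in> {0<..<1/10}"
        using t t0 by auto
      fix w :: complex
      assume w: "\<bar>Im w\<bar> \<le> 1"
      have r: "1 + t * zeta (Re w) \<ge> 1/2"
        using t_zeta_bound[OF t', of "Re w"] by linarith
      have K: "t * (51 * L) * \<bar>Im w\<bar> < \<bar>Im w\<bar> / 4" if "Im w \<noteq> 0"
        using mult_strict_right_mono[OF tML(3)[OF t], of "\<bar>Im w\<bar>"] that by simp
      show "bcurve t w \<in> Omega t" if y: "0 < Im w"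
      proof -
        have "(1 + Im w) * exp (- Im w) \<le> exp (Im w) * exp (- Im w)"
          by (intro mult_right_mono exp_ge_add_one_self) auto
        then have e: "exp (- Im w) + Im w * exp (- Im w) \<le> 1"
          by (simp add: algebra_simps flip: exp_add)
        \<comment> \<open>If the exponential is at least 1/2 this follows from the preceding
          inequality; otherwise the left side is below -1/2, which suffices as
          \<open>Im w \<le> 1\<close>.\<close>
        have "exp (- Im w) - 1 \<le> - (Im w / 2)"
        proof (cases "1/2 \<le> exp (- Im w)")
          case True
          then have "Im w * (1/2) \<le> Im w * exp (- Im w)"
            using y by (intro mult_left_mono) auto
          then show ?thesis
            using e by linarith
        qed (use w y in auto)
        then have "(1 - exp (- Im w)) * (1 + t * zeta (Re w)) \<ge> Im w / 2 * (1/2)"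
          using r y by (intro mult_mono) auto
        then have "(exp (- Im w) - 1) * (1 + t * zeta (Re w)) \<le> - (Im w / 4)"
          by (simp add: algebra_simps)
        moreover have "Im w \<noteq> 0" "\<bar>Im w\<bar> = Im w"
          using y by simp_all
        moreover note K[OF this(1)]
        ultimately have "norm (bcurve t w) < 1 + t * zdir (bcurve t w)"
          using defect(1)[OF t w] unfolding abs_le_iff by linarith
        then show ?thesis
          by (simp add: Omega_eq_zdir[OF t'])
      qed
      show "bcurve t w \<notin> closure (Omega t)" if y: "Im w < 0"
      proof -
        have "exp (- Im w) - 1 \<ge> - Im w"
          using exp_ge_add_one_self[of "- Im w"] by linarith
        then have "(exp (- Im w) - 1) * (1 + t * zeta (Re w)) \<ge> - Im w * (1/2)"
          using r y by (intro mult_mono) auto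
        moreover have "Im w \<noteq> 0" "\<bar>Im w\<bar> = - Im w"
          using y by simp_all
        moreover note K[OF this(1)]
        ultimately have "norm (bcurve t w) > 1 + t * zdir (bcurve t w)"
          using defect(1)[OF t w] y unfolding abs_le_iff by linarith
        then show ?thesis
          by (simp add: closure_Omega[OF t'])
      qed
      show "norm (of_real t * czeta w) \<le> 1/4" "norm (of_real t * czeta' w) \<le> 1/4"
        using bounds[OF t w] by simp_all
    qed
  qed
qed

section \<open>Expansion of the boundary gradient\<close>

text \<open>With r = 1 + t \<zeta>, expand r^2 / 4 minus the boundary value of the approximating
  polynomial: the orders 0 and 1 in \<open>t\<close> cancel, and this is the rest divided by t^2. It
  is a polynomial in \<open>t\<close> and entire in \<open>w\<close>.\<close>

definition boundary_error :: "real \<Rightarrow> complex \<Rightarrow> complex" where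
  "boundary_error t w = czeta w ^ 2 / 4 + 2 * (2 * czeta w + of_real t * czeta w ^ 2) * cos (2 * w)
     - (4 * czeta w + 6 * of_real t * czeta w ^ 2 + 4 * of_real t ^ 2 * czeta w ^ 3 + of_real t ^ 3 * czeta w ^ 4)
       * cos (4 * w) / 2"

lemma holomorphic_on_boundary_error [holomorphic_intros]: "boundary_error t holomorphic_on A"
  unfolding boundary_error_def by (intro holomorphic_intros) auto

lemma strip_bounded_boundary_error: "strip_bounded boundary_error"
  unfolding boundary_error_def by (intro strip_bounded_intros strip_bounded_czeta)

text \<open>Its real part approximates u + |z|^2 / 4 rather than u. The boundary data (1 + t
  \<zeta>)^2 / 4 begin with 1/4 + t \<zeta> / 2, and \<zeta> / 2 = -2 cos 2s + cos 4s / 2 is the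
  trace on the unit circle of the real part of the bracket.\<close>

definition approx_torsion :: "real \<Rightarrow> complex \<Rightarrow> complex" where
  "approx_torsion t z = 1/4 + of_real t * (- 2 * z ^ 2 + z ^ 4 / 2)"

lemma holomorphic_on_approx_torsion [holomorphic_intros]: "approx_torsion t holomorphic_on A"
  unfolding approx_torsion_def by (intro holomorphic_intros) auto

lemma approx_torsion_boundary:
  "(norm (bcurve t (of_real s)))\<^sup>2 / 4 - Re (approx_torsion t (bcurve t (of_real s)))
    = t\<^sup>2 * Re (boundary_error t (of_real s))"
proof -
  define r where "r = 1 + t * zeta s"
  have pow: "rcis r s ^ 2 = rcis (r ^ 2) (2 * s)" "rcis r s ^ 4 = rcis (r ^ 4) (4 * s)"
    using DeMoivre2[of r s 2] DeMoivre2[of r s 4] by simp_all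
  have "Re (approx_torsion t (rcis r s)) = 1/4 + t * (- 2 * (r ^ 2 * cos (2 * s)) + r ^ 4 * cos (4 * s) / 2)"
    unfolding approx_torsion_def pow by simp
  moreover have "r ^ 2 / 4 - (1/4 + t * (- 2 * (r ^ 2 * a) + r ^ 4 * b / 2))
      = t ^ 2 * (Z ^ 2 / 4 + 2 * (2 * Z + t * Z ^ 2) * a - (4 * Z + 6 * t * Z ^ 2 + 4 * t ^ 2 * Z ^ 3 + t ^ 3 * Z ^ 4) * b / 2)"
    if "Z = - 4 * a + b" "r = 1 + t * Z" for Z a b
  proof -
    \<comment> \<open>Eliminating \<open>b\<close> turns the claim into a polynomial identity in
      \<open>t\<close>, \<open>Z\<close> and \<open>a\<close>.\<close>
    have b: "b = Z + 4 * a"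
      using that by simp
    show ?thesis
      unfolding b that(2) by (simp add: power4_eq_xxxx power3_eq_cube power2_eq_square field_simps)
  qed
  note this[OF zeta_def r_def]
  moreover have "boundary_error t (of_real s) = of_real (zeta s ^ 2 / 4 + 2 * (2 * zeta s + t * zeta s ^ 2) * cos (2 * s)
      - (4 * zeta s + 6 * t * zeta s ^ 2 + 4 * t ^ 2 * zeta s ^ 3 + t ^ 3 * zeta s ^ 4) * cos (4 * s) / 2)"
  proof -
    have "cos (2 * complex_of_real s) = of_real (cos (2 * s))" "cos (4 * complex_of_real s) = of_real (cos (4 * s))"
      by (simp_all add: cos_of_real[symmetric])
    then show ?thesis
      by (simp only: boundary_error_def czeta_of_real of_real_add of_real_diff of_real_mult of_real_power of_real_divide of_real_numeral)
  qed
  then have "Re (boundary_error t (of_real s)) = zeta s ^ 2 / 4 + 2 * (2 * zeta s + t * zeta s ^ 2) * cos (2 * s)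
      - (4 * zeta s + 6 * t * zeta s ^ 2 + 4 * t ^ 2 * zeta s ^ 3 + t ^ 3 * zeta s ^ 4) * cos (4 * s) / 2"
    by (simp only: Re_complex_of_real)
  moreover have "norm (bcurve t (of_real s)) ^ 2 = r ^ 2" "bcurve t (of_real s) = rcis r s"
    by (simp_all add: bcurve_of_real r_def)
  ultimately show ?thesis
    by (simp only:)
qed

lemma bcurve_derivative:
  "(bcurve t has_field_derivative exp (\<i> * w) * (of_real t * czeta' w + \<i> * (1 + of_real t * czeta w))) (at w within A)"
  unfolding bcurve_def by (auto intro!: derivative_eq_intros simp: algebra_simps)

section \<open>Pullback of the torsion function to discs around boundary parameters\<close>

context thin_star
begin

lemma bcurve_in_closure: "\<bar>Im w\<bar> \<le> 1 \<Longrightarrow> 0 \<le> Im w \<Longrightarrow> bcurve t w \<in> closure (Omega t)"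
proof (cases "Im w = 0")
  case True
  then have "w = of_real (Re w)"
    by (simp add: complex_eq_iff)
  then show ?thesis
    using bcurve_in_frontier[OF t, of "Re w"] by (simp add: frontier_def)
next
  case False
  assume "\<bar>Im w\<bar> \<le> 1" "0 \<le> Im w"
  with False show ?thesis
    using inside[of w] closure_subset[of "Omega t"] by auto
qed

text \<open>Up to the factor exp (i w) this is the derivative of \<open>bcurve\<close>, and 3/4 -
  1/4 bounds it below. It makes the curve locally invertible with uniform constants.\<close>

lemma denominator_bound:
  assumes "\<bar>Im w\<bar> \<le> 1"
  shows "norm (of_real t * czeta' w + \<i> * (1 + of_real t * czeta w)) \<ge> 1/2"
proof -
  have "norm (1 + of_real t * czeta w) \<ge> 3/4"
    using small[OF assms] norm_diff_ineq[of 1 "of_real t * czeta w"] by simp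
  moreover have "norm (\<i> * (1 + of_real t * czeta w)) - norm (of_real t * czeta' w)
      \<le> norm (\<i> * (1 + of_real t * czeta w) + of_real t * czeta' w)"
    by (rule norm_diff_ineq)
  ultimately show ?thesis
    using small'[OF assms] by (simp add: norm_mult add.commute)
qed

text \<open>The identity with \<open>u\<close> holds only for \<open>0 \<le> Im w\<close>, while
  \<open>D\<close> and its bound live on full discs centred on the real axis; Cauchy estimates thus
  become available at the boundary points themselves.\<close>

lemma torsion_pullback:
  assumes u: "torsion_function (Omega t) u"
    and C: "\<And>w. \<bar>Im w\<bar> \<le> 1 \<Longrightarrow> norm (boundary_error t w) \<le> C"
  obtains D where "D holomorphic_on ball (of_real s\<^sub>0) 1"
    "\<And>w. w \<in> ball (of_real s\<^sub>0) 1 \<Longrightarrow> 0 \<le> Im w \<Longrightarrow>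
       u (bcurve t w) + (norm (bcurve t w))\<^sup>2 / 4 - Re (approx_torsion t (bcurve t w)) = Re (D w)"
    "\<And>w. w \<in> ball (of_real s\<^sub>0) (3/4) \<Longrightarrow> norm (D w) \<le> 13 * C * t\<^sup>2"
proof -
  have C2: "C2_on (Omega t) u" and contu: "continuous_on (closure (Omega t)) u"
    and lap: "\<And>x. x \<in> Omega t \<Longrightarrow> - laplacian u x = 1" and u0: "\<And>x. x \<in> frontier (Omega t) \<Longrightarrow> u x = 0"
    using u by (auto simp: torsion_function_def)
  obtain F where F: "F holomorphic_on Omega t" "\<And>z. z \<in> Omega t \<Longrightarrow> u z + (norm z)\<^sup>2 / 4 = Re (F z)"
    using torsion_eq_Re_holomorphic[OF open_Omega[OF t] starlike_Omega[OF t] C2 lap] by blast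
  define d where "d z = u z + (norm z)\<^sup>2 / 4 - Re (approx_torsion t z)" for z
  have contd: "continuous_on (closure (Omega t)) d"
    unfolding d_def
    by (intro continuous_intros contu holomorphic_on_imp_continuous_on holomorphic_intros) auto
  have d_eq: "d z = Re (F z - approx_torsion t z)" if "z \<in> Omega t" for z
    using F(2)[OF that] by (simp add: d_def)
  have d_bdry: "d (bcurve t (of_real s)) = t\<^sup>2 * Re (boundary_error t (of_real s))" for s
    using approx_torsion_boundary[of t s] u0[OF bcurve_in_frontier[OF t]] by (simp add: d_def)
  have ReE: "\<bar>t\<^sup>2 * Re (boundary_error t w)\<bar> \<le> C * t\<^sup>2" if "\<bar>Im w\<bar> \<le> 1" for w
  proof -
    have "\<bar>Re (boundary_error t w)\<bar> \<le> C"
      using C[OF that] abs_Re_le_cmod order_trans by blast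
    then have "t\<^sup>2 * \<bar>Re (boundary_error t w)\<bar> \<le> t\<^sup>2 * C"
      by (intro mult_left_mono) auto
    then show ?thesis
      by (simp add: abs_mult mult.commute)
  qed
  have fr: "\<bar>d z\<bar> \<le> C * t\<^sup>2" if "z \<in> frontier (Omega t)" for z
    using frontier_eq_bcurve[OF t that] d_bdry[of "Arg z"] ReE[of "of_real (Arg z)"] by simp
  note conn = starlike_imp_connected[OF starlike_Omega[OF t]]
  have d_bound: "\<bar>d z\<bar> \<le> C * t\<^sup>2" if z: "z \<in> closure (Omega t)" for z
  proof -
    have "d z \<le> C * t\<^sup>2"
      by (rule harmonic_le_frontier[OF open_Omega[OF t] conn bounded_Omega[OF t], where f="\<lambda>z. F z - approx_torsion t z"])
        (use z contd d_eq fr in \<open>auto intro!: holomorphic_intros F(1) simp: abs_le_iff\<close>)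
    moreover have "- d z \<le> C * t\<^sup>2"
      by (rule harmonic_le_frontier[OF open_Omega[OF t] conn bounded_Omega[OF t], where f="\<lambda>z. approx_torsion t z - F z"])
        (use z contd d_eq fr in \<open>auto intro!: holomorphic_intros F(1) continuous_intros simp: abs_le_iff\<close>)
    ultimately show ?thesis
      by linarith
  qed
  let ?\<tau> = "\<lambda>\<omega>. of_real s\<^sub>0 + \<omega> :: complex"
  \<comment> \<open>As \<open>boundary_error\<close> is entire, subtracting its real part cancels
    the values on the real axis and leaves \<open>h\<close> the real part of a holomorphic function
    above it.\<close>
  define h where "h \<omega> = d (bcurve t (?\<tau> \<omega>)) - t\<^sup>2 * Re (boundary_error t (?\<tau> \<omega>))" for \<omega>
  have Im_le: "\<bar>Im \<omega>\<bar> \<le> 1" if "norm \<omega> \<le> 1" for \<omega>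
    using abs_Im_le_cmod[of \<omega>] that by linarith
  have clo: "bcurve t (?\<tau> \<omega>) \<in> closure (Omega t)" if "norm \<omega> \<le> 1" "0 \<le> Im \<omega>" for \<omega>
    using bcurve_in_closure[of "?\<tau> \<omega>"] Im_le[of \<omega>] that by simp
  have ins: "bcurve t (?\<tau> \<omega>) \<in> Omega t" if "norm \<omega> \<le> 1" "0 < Im \<omega>" for \<omega>
    using inside[of "?\<tau> \<omega>"] Im_le[of \<omega>] that by simp
  have hol_shift: "(\<lambda>\<omega>. f (?\<tau> \<omega>)) holomorphic_on A" if "f holomorphic_on UNIV" for f A
  proof -
    have "?\<tau> holomorphic_on A"
      by (intro holomorphic_intros)
    from holomorphic_on_compose_gen[OF this that] show ?thesis
      by (simp add: o_def)
  qed
  obtain H where H: "H holomorphic_on ball 0 1"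
    "\<And>z. norm z < 1 \<Longrightarrow> 0 \<le> Im z \<Longrightarrow> Re (H z) = h z"
    "\<And>z. norm z < 3/4 \<Longrightarrow> norm (H z) \<le> 6 * (2 * C * t\<^sup>2)"
  proof (rule harmonic_reflection[where h=h and M="2 * C * t\<^sup>2" and
        f="\<lambda>\<omega>. F (bcurve t (?\<tau> \<omega>)) - approx_torsion t (bcurve t (?\<tau> \<omega>)) - of_real (t\<^sup>2) * boundary_error t (?\<tau> \<omega>)"])
    show "continuous_on (cball 0 1 \<inter> {z. 0 \<le> Im z}) h"
      unfolding h_def
      by (intro continuous_intros continuous_on_compose2[OF contd]
          hol_shift[OF holomorphic_on_bcurve, THEN holomorphic_on_imp_continuous_on]
          hol_shift[OF holomorphic_on_boundary_error, THEN holomorphic_on_imp_continuous_on])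
        (auto intro!: clo)
    show "(\<lambda>\<omega>. F (bcurve t (?\<tau> \<omega>)) - approx_torsion t (bcurve t (?\<tau> \<omega>)) - of_real (t\<^sup>2) * boundary_error t (?\<tau> \<omega>))
        holomorphic_on ball 0 1 \<inter> {z. 0 < Im z}"
    proof -
      have "(F \<circ> (\<lambda>\<omega>. bcurve t (?\<tau> \<omega>))) holomorphic_on ball 0 1 \<inter> {z. 0 < Im z}"
        by (rule holomorphic_on_compose_gen[OF hol_shift[OF holomorphic_on_bcurve] F(1)]) (auto intro!: ins)
      then have 1: "(\<lambda>\<omega>. F (bcurve t (?\<tau> \<omega>))) holomorphic_on ball 0 1 \<inter> {z. 0 < Im z}"
        by (simp add: o_def)
      have "(approx_torsion t \<circ> bcurve t) holomorphic_on UNIV"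
        by (intro holomorphic_on_compose holomorphic_on_bcurve holomorphic_on_approx_torsion)
      then have "(\<lambda>w. approx_torsion t (bcurve t w)) holomorphic_on UNIV"
        by (simp add: o_def)
      note 2 = hol_shift[OF this]
      show ?thesis
        by (rule holomorphic_on_diff[OF holomorphic_on_diff[OF 1 2]
              holomorphic_on_mult[OF holomorphic_on_const hol_shift[OF holomorphic_on_boundary_error]]])
    qed
    show "h z = Re (F (bcurve t (?\<tau> z)) - approx_torsion t (bcurve t (?\<tau> z)) - of_real (t\<^sup>2) * boundary_error t (?\<tau> z))"
      if "norm z < 1" "0 < Im z" for z
      using d_eq[OF ins[of z]] that by (simp add: h_def flip: of_real_power)
    show "h z = 0" if "norm z \<le> 1" "Im z = 0" for z
    proof -
      have "?\<tau> z = of_real (s\<^sub>0 + Re z)"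
        using that by (simp add: complex_eq_iff)
      then show ?thesis
        using d_bdry[of "s\<^sub>0 + Re z"] by (simp add: h_def)
    qed
    show "\<bar>h z\<bar> \<le> 2 * C * t\<^sup>2" if "norm z \<le> 1" "0 \<le> Im z" for z
    proof -
      have "\<bar>Im (?\<tau> z)\<bar> \<le> 1" "0 \<le> Im (?\<tau> z)"
        using Im_le[OF that(1)] that by auto
      then show ?thesis
        using d_bound[OF clo[OF that]] ReE[of "?\<tau> z"] unfolding h_def by linarith
    qed
  qed (use that in blast)
  \<comment> \<open>Restoring the entire correction adds C t^2 to the reflection bound 6 * 2 C t^2,
    whence the 13.\<close>
  define D where "D w = H (w - of_real s\<^sub>0) + of_real (t\<^sup>2) * boundary_error t w" for w
  show ?thesis
  proof (rule that)
    have "(H \<circ> (\<lambda>w. w - of_real s\<^sub>0)) holomorphic_on ball (of_real s\<^sub>0) 1"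
      by (rule holomorphic_on_compose_gen[OF _ H(1)])
        (auto intro!: holomorphic_intros simp: dist_norm norm_minus_commute)
    then show "D holomorphic_on ball (of_real s\<^sub>0) 1"
      unfolding D_def by (intro holomorphic_intros) (auto simp: o_def)
    show "u (bcurve t w) + (norm (bcurve t w))\<^sup>2 / 4 - Re (approx_torsion t (bcurve t w)) = Re (D w)"
      if "w \<in> ball (of_real s\<^sub>0) 1" "0 \<le> Im w" for w
      using H(2)[of "w - of_real s\<^sub>0"] that
      by (simp add: D_def h_def d_def dist_norm norm_minus_commute flip: of_real_power)
    show "norm (D w) \<le> 13 * C * t\<^sup>2" if w: "w \<in> ball (of_real s\<^sub>0) (3/4)" for w
    proof -
      have n: "norm (w - of_real s\<^sub>0) < 3/4"
        using w by (simp add: dist_norm norm_minus_commute)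
      then have "\<bar>Im w\<bar> \<le> 1"
        using abs_Im_le_cmod[of "w - of_real s\<^sub>0"] by simp
      then have "t\<^sup>2 * norm (boundary_error t w) \<le> t\<^sup>2 * C"
        by (intro mult_left_mono C) auto
      then have "norm (of_real (t\<^sup>2) * boundary_error t w) \<le> C * t\<^sup>2"
        by (simp add: norm_mult mult.commute norm_power)
      then show ?thesis
        using H(3)[OF n] norm_triangle_ineq[of "H (w - of_real s\<^sub>0)" "of_real (t\<^sup>2) * boundary_error t w"]
        unfolding D_def by linarith
    qed
  qed
qed

end

section \<open>Uniqueness and value of the one-sided gradient\<close>

lemma derivative_along_path_unique:
  fixes f :: "'a::real_normed_vector \<Rightarrow> 'b::real_normed_vector"
  assumes A: "(f has_derivative A) (at x within S)" and B: "(f has_derivative B) (at x within S)"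
    and p: "(p has_vector_derivative v) (at 0 within {0..e})" "p 0 = x" "p ` {0..e} \<subseteq> S" and e: "0 < (e::real)"
  shows "A v = B v"
proof -
  have *: "((f \<circ> p) has_vector_derivative L v) (at 0 within {0..e})" if "(f has_derivative L) (at x within S)" for L
    by (rule vector_derivative_diff_chain_within[OF p(1)])
      (use has_derivative_subset[OF that p(3)] p(2) in simp)
  show ?thesis
    by (rule vector_derivative_unique_within_closed_interval[of 0 e 0 "f \<circ> p"]) (use *[OF A] *[OF B] e in auto)
qed

context thin_star
begin

text \<open>The paths leaving the point with parameter velocities 1 and i stay in the closure, and
  their image velocities G and iG span the plane over the reals. A derivative relative to the
  closure is therefore determined.\<close>

lemma derivative_within_closure_unique:
  fixes f :: "complex \<Rightarrow> real"
  assumes A: "(f has_derivative A) (at (bcurve t (of_real s)) within closure (Omega t))"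
    and B: "(f has_derivative B) (at (bcurve t (of_real s)) within closure (Omega t))"
  shows "A = B"
proof
  fix \<eta>
  define G where "G = exp (\<i> * of_real s) * (of_real t * czeta' (of_real s) + \<i> * (1 + of_real t * czeta (of_real s)))"
  have G: "G \<noteq> 0"
    using denominator_bound[of "of_real s"] by (auto simp: G_def)
  have eq: "A (G * c) = B (G * c)" if c: "0 \<le> Im c" "norm c = 1" for c
  proof (rule derivative_along_path_unique[OF A B])
    have "(bcurve t has_field_derivative G) (at (of_real s + of_real 0 * c))"
      using bcurve_derivative[of t "of_real s"] by (simp add: G_def)
    then have "((\<lambda>z. bcurve t (of_real s + z * c)) has_field_derivative G * c) (at (of_real 0))"
      by (rule DERIV_chain2) (auto intro!: derivative_eq_intros)
    from has_vector_derivative_real_field[OF this]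
    show "((\<lambda>\<epsilon>. bcurve t (of_real s + of_real \<epsilon> * c)) has_vector_derivative G * c) (at 0 within {0..1})"
      by (rule has_vector_derivative_at_within)
    have "\<bar>Im c\<bar> \<le> 1"
      using abs_Im_le_cmod[of c] c by simp
    then show "(\<lambda>\<epsilon>. bcurve t (of_real s + of_real \<epsilon> * c)) ` {0..1} \<subseteq> closure (Omega t)"
      using c by (auto intro!: bcurve_in_closure mult_nonneg_nonneg simp: abs_mult mult_le_one)
  qed auto
  define z where "z = \<eta> / G"
  have "\<eta> = G * z"
    using G by (simp add: z_def)
  also have "z = Re z *\<^sub>R 1 + Im z *\<^sub>R \<i>"
    by (simp add: complex_eq_iff)
  finally have \<eta>: "\<eta> = Re z *\<^sub>R (G * 1) + Im z *\<^sub>R (G * \<i>)"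
    by (simp add: algebra_simps)
  note lin = linear_add[OF has_derivative_linear] linear_scale[OF has_derivative_linear]
  show "A \<eta> = B \<eta>"
    unfolding \<eta> lin[OF A] lin[OF B] using eq[of 1] eq[of \<i>] by simp
qed

text \<open>Composing \<open>D\<close> with a local inverse of \<open>bcurve\<close> gives a smooth
  function on a full neighbourhood that coincides with \<open>u\<close> on the closure. In
  \<open>Q\<close> the three summands come from \<open>D\<close>, from the approximating polynomial
  and from |z|^2 / 4.\<close>

lemma torsion_has_derivative:
  assumes D: "D holomorphic_on ball (of_real s\<^sub>0) 1"
    and eq: "\<And>w. w \<in> ball (of_real s\<^sub>0) 1 \<Longrightarrow> 0 \<le> Im w \<Longrightarrow>
       u (bcurve t w) + (norm (bcurve t w))\<^sup>2 / 4 - Re (approx_torsion t (bcurve t w)) = Re (D w)"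
    and s: "\<bar>s - s\<^sub>0\<bar> < 1"
    and Q: "Q = deriv D (of_real s) / (exp (\<i> * of_real s) * (of_real t * czeta' (of_real s) + \<i> * (1 + of_real t * czeta (of_real s))))
       + of_real t * (- 4 * bcurve t (of_real s) + 2 * bcurve t (of_real s) ^ 3) - cnj (bcurve t (of_real s)) / 2"
  shows "(u has_derivative (\<lambda>\<eta>. Re (Q * \<eta>))) (at (bcurve t (of_real s)) within closure (Omega t))"
proof -
  define \<sigma> where "\<sigma> = complex_of_real s"
  define G where "G = exp (\<i> * \<sigma>) * (of_real t * czeta' \<sigma> + \<i> * (1 + of_real t * czeta \<sigma>))"
  have G: "G \<noteq> 0"
    using denominator_bound[of \<sigma>] by (auto simp: G_def \<sigma>_def)
  have dG: "deriv (bcurve t) \<sigma> = G"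
    unfolding G_def by (rule DERIV_imp_deriv[OF bcurve_derivative])
  have \<sigma>: "\<sigma> \<in> ball (of_real s\<^sub>0) 1"
    using s by (simp add: \<sigma>_def dist_of_real dist_real_def abs_minus_commute)
  obtain r where r: "r > 0" "ball \<sigma> r \<subseteq> ball (of_real s\<^sub>0) 1" "inj_on (bcurve t) (ball \<sigma> r)"
    using has_complex_derivative_locally_injective[OF holomorphic_on_bcurve \<sigma> open_ball] dG G by metis
  obtain g where g: "g holomorphic_on (bcurve t ` ball \<sigma> r)"
      "\<And>z. z \<in> ball \<sigma> r \<Longrightarrow> deriv (bcurve t) z * deriv g (bcurve t z) = 1"
      "\<And>z. z \<in> ball \<sigma> r \<Longrightarrow> g (bcurve t z) = z"
    using holomorphic_has_inverse[OF holomorphic_on_bcurve open_ball r(3)] by metis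
  have op: "open (bcurve t ` ball \<sigma> r)"
    by (rule open_mapping_thm3[OF holomorphic_on_bcurve open_ball r(3)])
  define z\<^sub>0 where "z\<^sub>0 = bcurve t \<sigma>"
  have \<sigma>r: "\<sigma> \<in> ball \<sigma> r"
    using r(1) by simp
  then have z0: "z\<^sub>0 \<in> bcurve t ` ball \<sigma> r"
    by (simp add: z\<^sub>0_def)
  have u_eq: "Re (D (g z)) + Re (approx_torsion t z) - (z \<bullet> z) / 4 = u z"
    if "z \<in> bcurve t ` ball \<sigma> r" "z \<in> closure (Omega t)" for z
  proof -
    obtain w where w: "w \<in> ball \<sigma> r" "z = bcurve t w"
      using \<open>z \<in> bcurve t ` ball \<sigma> r\<close> by blast
    then have w1: "w \<in> ball (of_real s\<^sub>0) 1"
      using r(2) by blast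
    then have "\<bar>Im w\<bar> \<le> 1"
      using abs_Im_le_cmod[of "w - of_real s\<^sub>0"] by (simp add: dist_norm norm_minus_commute)
    \<comment> \<open>A negative imaginary part would put the point outside the closure.\<close>
    then have "0 \<le> Im w"
      using outside[of w] that(2) w(2) by force
    then show ?thesis
      using eq[OF w1] g(3)[OF w(1)] w(2) by (simp add: dot_square_norm)
  qed
  have Dg: "((\<lambda>z. D (g z)) has_field_derivative deriv D \<sigma> * (1 / G)) (at z\<^sub>0)"
  proof (rule DERIV_chain2[where f=D and g=g])
    have "g z\<^sub>0 = \<sigma>"
      using g(3)[OF \<sigma>r] by (simp add: z\<^sub>0_def)
    then show "(D has_field_derivative deriv D \<sigma>) (at (g z\<^sub>0))"
      using D \<sigma> by (simp add: holomorphic_derivI)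
    have "deriv g z\<^sub>0 = 1 / G"
      using g(2)[OF \<sigma>r] G by (simp add: dG z\<^sub>0_def field_simps)
    then show "(g has_field_derivative 1 / G) (at z\<^sub>0)"
      using holomorphic_derivI[OF g(1) op z0] by simp
  qed
  have ap: "(approx_torsion t has_field_derivative of_real t * (- 4 * z\<^sub>0 + 2 * z\<^sub>0 ^ 3)) (at z\<^sub>0)"
    unfolding approx_torsion_def by (auto intro!: derivative_eq_intros)
  have "((\<lambda>z. Re (D (g z)) + Re (approx_torsion t z) - (z \<bullet> z) / 4) has_derivative
      (\<lambda>\<eta>. Re (deriv D \<sigma> * (1 / G) * \<eta>) + Re (of_real t * (- 4 * z\<^sub>0 + 2 * z\<^sub>0 ^ 3) * \<eta>) - (z\<^sub>0 \<bullet> \<eta> + \<eta> \<bullet> z\<^sub>0) / 4)) (at z\<^sub>0)"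
    using Dg ap unfolding has_field_derivative_def by (auto intro!: derivative_eq_intros)
  also have "(\<lambda>\<eta>. Re (deriv D \<sigma> * (1 / G) * \<eta>) + Re (of_real t * (- 4 * z\<^sub>0 + 2 * z\<^sub>0 ^ 3) * \<eta>) - (z\<^sub>0 \<bullet> \<eta> + \<eta> \<bullet> z\<^sub>0) / 4)
     = (\<lambda>\<eta>. Re (Q * \<eta>))"
  proof
    fix \<eta>
    have "(z\<^sub>0 \<bullet> \<eta> + \<eta> \<bullet> z\<^sub>0) / 4 = Re (cnj z\<^sub>0 / 2 * \<eta>)"
      by (simp add: inner_complex_def)
    moreover have "Q = deriv D \<sigma> * (1 / G) + of_real t * (- 4 * z\<^sub>0 + 2 * z\<^sub>0 ^ 3) - cnj z\<^sub>0 / 2"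
      unfolding Q G_def z\<^sub>0_def \<sigma>_def by simp
    ultimately show "Re (deriv D \<sigma> * (1 / G) * \<eta>) + Re (of_real t * (- 4 * z\<^sub>0 + 2 * z\<^sub>0 ^ 3) * \<eta>) - (z\<^sub>0 \<bullet> \<eta> + \<eta> \<bullet> z\<^sub>0) / 4 = Re (Q * \<eta>)"
      by (simp only: left_diff_distrib distrib_right minus_complex.sel plus_complex.sel)
  qed
  finally have full: "((\<lambda>z. Re (D (g z)) + Re (approx_torsion t z) - (z \<bullet> z) / 4) has_derivative (\<lambda>\<eta>. Re (Q * \<eta>)))
      (at z\<^sub>0 within closure (Omega t))"
    by (rule has_derivative_at_withinI)
  have z0c: "z\<^sub>0 \<in> closure (Omega t)"
    unfolding z\<^sub>0_def by (rule bcurve_in_closure) (simp_all add: \<sigma>_def)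
  obtain e where e: "e > 0" "\<And>z. dist z z\<^sub>0 < e \<Longrightarrow> z \<in> bcurve t ` ball \<sigma> r"
    using op z0 unfolding open_dist by blast
  have "(u has_derivative (\<lambda>\<eta>. Re (Q * \<eta>))) (at z\<^sub>0 within closure (Omega t))"
    by (rule has_derivative_transform_within[OF full e(1) z0c u_eq]) (use e(2) in auto)
  then show ?thesis
    by (simp add: z\<^sub>0_def \<sigma>_def)
qed

text \<open>Uniqueness identifies the derivative chosen by \<open>frechet_derivative\<close> with
  the given one; its values at 1 and i are Re Q and - Im Q.\<close>

lemma gradient_eq_cnj:
  assumes "(u has_derivative (\<lambda>\<eta>. Re (Q * \<eta>))) (at (bcurve t (of_real s)) within closure (Omega t))"
  shows "gradient u (at (bcurve t (of_real s)) within closure (Omega t)) = cnj Q"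
proof -
  have "frechet_derivative u (at (bcurve t (of_real s)) within closure (Omega t)) = (\<lambda>\<eta>. Re (Q * \<eta>))"
    unfolding frechet_derivative_def
    by (rule some_equality[where P="\<lambda>f'. (u has_derivative f') (at (bcurve t (of_real s)) within closure (Omega t))", OF assms]) (rule derivative_within_closure_unique[OF _ assms])
  then show ?thesis
    by (simp add: gradient_def Basis_complex_def complex_eq_iff)
qed

end

text \<open>The square |X|^2 is kept as \<open>X * cnj X\<close> because, for X depending on a real
  parameter, X(w) * cnj (X (cnj w)) continues it holomorphically.\<close>

lemma norm_shift_half:
  fixes X :: complex and t :: real
  shows "(norm (- 1/2 + of_real t * X))\<^sup>2 = 1/4 + t * (- Re X + t * Re (X * cnj X))"
  unfolding cmod_power2 by (simp add: power2_eq_square field_simps)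

text \<open>Multiplying \<open>Q\<close> by exp (i s), of modulus 1, turns the normal of the unit
  circle into the real direction and gives -1/2 + t X. Here -1/2 is the outward derivative of (1 -
  |x|^2) / 4, the torsion function of the unit disc.\<close>

lemma gradient_expansion:
  obtains C t\<^sub>0 where "t\<^sub>0 > 0"
    "\<And>t u s\<^sub>0. t \<in> {0<..<t\<^sub>0} \<Longrightarrow> torsion_function (Omega t) u \<Longrightarrow>
      \<exists>R. R holomorphic_on ball (of_real s\<^sub>0) (1/2) \<and> (\<forall>w\<in>ball (of_real s\<^sub>0) (1/2). norm (R w) \<le> C) \<and>
        (\<forall>s. \<bar>s - s\<^sub>0\<bar> < 1/2 \<longrightarrow>
          (norm (gradient u (at (bcurve t (of_real s)) within closure (Omega t))))\<^sup>2
            = 1/4 + t * ((2 * cos (2 * s) - 3/2 * cos (4 * s)) + t * Re (R (of_real s))))"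
proof -
  \<comment> \<open>The value of X at order 0: - \<zeta> / 2 comes from |z|^2 / 4 and the
    exponentials from the derivative of the approximating polynomial at radius 1. \<open>W\<close>
    holds what the powers of the true radius 1 + t \<zeta> add to the latter.\<close>
  define k where "k w = - czeta w / 2 - 4 * exp (\<i> * (2 * w)) + 2 * exp (\<i> * (4 * w))" for w
  define W where "W t w = - 4 * czeta w * exp (\<i> * (2 * w))
      + 2 * (3 * czeta w + 3 * of_real t * czeta w ^ 2 + of_real t ^ 2 * czeta w ^ 3) * exp (\<i> * (4 * w))" for t w
  have "strip_bounded (\<lambda>t w. k w)"
    unfolding k_def by (intro strip_bounded_intros strip_bounded_czeta)
  then obtain Ck where Ck: "Ck > 0" "\<forall>t w. 0 \<le> t \<longrightarrow> t \<le> (1::real) \<longrightarrow> \<bar>Im w\<bar> \<le> 1 \<longrightarrow> norm (k w) \<le> Ck"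
    using strip_boundedD by blast
  have "strip_bounded W"
    unfolding W_def by (intro strip_bounded_intros strip_bounded_czeta)
  then obtain CW where CW: "CW > 0" "\<forall>t w. 0 \<le> t \<longrightarrow> t \<le> (1::real) \<longrightarrow> \<bar>Im w\<bar> \<le> 1 \<longrightarrow> norm (W t w) \<le> CW"
    using strip_boundedD by blast
  obtain CE where CE: "CE > 0" "\<forall>t w. 0 \<le> t \<longrightarrow> t \<le> (1::real) \<longrightarrow> \<bar>Im w\<bar> \<le> 1 \<longrightarrow> norm (boundary_error t w) \<le> CE"
    using strip_boundedD[OF strip_bounded_boundary_error] by blast
  obtain t\<^sub>0 where t0: "t\<^sub>0 > 0" "\<And>t. t \<in> {0<..<t\<^sub>0} \<Longrightarrow> thin_star t"
    using thin_star_small by blast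
  \<comment> \<open>The 8 is Cauchy's estimate on discs of radius 1/8, the 2 the lower bound 1/2 for
    \<open>den\<close>, and the summand 1 makes the bound on \<open>D\<close> strict.\<close>
  define CV where "CV = 2 * (8 * (13 * CE + 1))"
  define CX where "CX = Ck + (CV + CW)"
  show ?thesis
  proof (rule that[OF t0(1), of "CV + CW + CX * CX"])
    fix t u s\<^sub>0
    assume "t \<in> {0<..<t\<^sub>0}" and u: "torsion_function (Omega t) u"
    then interpret thin_star t
      by (intro t0(2))
    have t1: "0 < t" "0 \<le> t" "t \<le> 1"
      using t by auto
    obtain D where D: "D holomorphic_on ball (of_real s\<^sub>0) 1"
      "\<And>w. w \<in> ball (of_real s\<^sub>0) 1 \<Longrightarrow> 0 \<le> Im w \<Longrightarrow>
         u (bcurve t w) + (norm (bcurve t w))\<^sup>2 / 4 - Re (approx_torsion t (bcurve t w)) = Re (D w)"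
      "\<And>w. w \<in> ball (of_real s\<^sub>0) (3/4) \<Longrightarrow> norm (D w) \<le> 13 * CE * t\<^sup>2"
      using torsion_pullback[OF u, of CE s\<^sub>0] CE(2) t1 by blast
    define B where "B = ball (complex_of_real s\<^sub>0) (1/2)"
    have B1: "B \<subseteq> ball (of_real s\<^sub>0) 1"
      by (auto simp: B_def)
    have Im_B: "\<bar>Im w\<bar> \<le> 1" if "w \<in> B" for w
      using that abs_Im_le_cmod[of "w - of_real s\<^sub>0"] by (simp add: B_def dist_norm norm_minus_commute)
    have cnj_B: "cnj w \<in> B" if "w \<in> B" for w
      using that complex_mod_cnj[of "of_real s\<^sub>0 - w"] by (simp add: B_def dist_norm)
    define den where "den w = of_real t * czeta' w + \<i> * (1 + of_real t * czeta w)" for w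
    have den: "norm (den w) \<ge> 1/2" "den w \<noteq> 0" if "w \<in> B" for w
      using denominator_bound[OF Im_B[OF that]] by (auto simp: den_def)
    define V where "V w = deriv D w / (of_real t ^ 2 * den w)" for w
    have V: "norm (V w) \<le> CV" if w: "w \<in> B" for w
    proof -
      \<comment> \<open>The radii satisfy 1/2 + 1/8 < 3/4.\<close>
      have sub: "cball w (1/8) \<subseteq> ball (of_real s\<^sub>0) (3/4)"
      proof
        fix y assume "y \<in> cball w (1/8)"
        then show "y \<in> ball (of_real s\<^sub>0) (3/4)"
          using w dist_triangle[of "of_real s\<^sub>0" y w] by (simp add: B_def)
      qed
      have subb: "ball w (1/8) \<subseteq> ball (of_real s\<^sub>0) (3/4)"
        using sub ball_subset_cball[of w "1/8"] by blast
      have D34: "D holomorphic_on ball (of_real s\<^sub>0) (3/4)"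
        by (rule holomorphic_on_subset[OF D(1)]) auto
      have "norm ((deriv ^^ 1) D w) \<le> fact 1 * ((13 * CE + 1) * t\<^sup>2) / (1/8) ^ 1"
      proof (rule Cauchy_higher_deriv_bound[where y=0])
        show "D holomorphic_on ball w (1/8)"
          by (rule holomorphic_on_subset[OF D34 subb])
        show "continuous_on (cball w (1/8)) D"
          by (rule continuous_on_subset[OF holomorphic_on_imp_continuous_on[OF D34] sub])
        show "D y \<in> ball 0 ((13 * CE + 1) * t\<^sup>2)" if "y \<in> ball w (1/8)" for y
        proof -
          have "norm (D y) \<le> 13 * CE * t\<^sup>2"
            using D(3)[of y] that subb by blast
          also have "\<dots> < (13 * CE + 1) * t\<^sup>2"
            using t1 by (simp add: algebra_simps)
          finally show ?thesis by simp
        qed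
      qed auto
      then have dD: "norm (deriv D w) \<le> 8 * (13 * CE + 1) * t\<^sup>2"
        by (simp add: algebra_simps)
      have "norm (V w) = norm (deriv D w) / (t\<^sup>2 * norm (den w))"
        by (simp add: V_def norm_divide norm_mult norm_power)
      also have "\<dots> \<le> (8 * (13 * CE + 1) * t\<^sup>2) / (t\<^sup>2 * (1/2))"
        using den[OF w] t1 CE(1) dD by (intro frac_le mult_left_mono) auto
      also have "\<dots> = CV"
        using t1 by (simp add: CV_def)
      finally show ?thesis .
    qed
    define K where "K w = V w + W t w" for w
    define X where "X w = k w + of_real t * K w" for w
    define R where "R w = - K w + X w * cnj (X (cnj w))" for w
    have K: "norm (K w) \<le> CV + CW" if "w \<in> B" for w
      unfolding K_def using V[OF that] CW(2) Im_B[OF that] t1 by (intro norm_triangle_mono) auto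
    have X: "norm (X w) \<le> CX" if "w \<in> B" for w
    proof -
      have "norm (of_real t * K w) \<le> 1 * (CV + CW)"
        unfolding norm_mult using t1 K[OF that] by (intro mult_mono) auto
      then show ?thesis
        unfolding X_def CX_def using Ck(2) Im_B[OF that] t1 by (intro norm_triangle_mono) auto
    qed
    have R: "norm (R w) \<le> CV + CW + CX * CX" if "w \<in> B" for w
    proof -
      have "norm (X w * cnj (X (cnj w))) \<le> CX * CX"
        unfolding norm_mult complex_mod_cnj using X[OF that] X[OF cnj_B[OF that]] order_trans[OF norm_ge_zero X[OF that]]
        by (intro mult_mono) auto
      then show ?thesis
        unfolding R_def using K[OF that] by (intro norm_triangle_mono) auto
    qed
    have holK: "K holomorphic_on B"
      unfolding K_def V_def W_def den_def[abs_def]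
      by (intro holomorphic_intros holomorphic_deriv holomorphic_on_subset[OF D(1) B1])
        (use den t1 in \<open>auto simp: B_def den_def\<close>)
    have holX: "X holomorphic_on B"
      unfolding X_def k_def by (intro holomorphic_intros holK) auto
    \<comment> \<open>The disc has a real centre, so the reflected conjugate of \<open>X\<close> is
      defined and holomorphic on it.\<close>
    have "cnj ` B = B"
      using cnj_B by (auto simp: image_iff) (metis complex_cnj_cnj)
    then have "(\<lambda>w. cnj (X (cnj w))) holomorphic_on B"
      using holomorphic_on_compose_cnj_cnj[of X B] holX by (simp add: o_def B_def)
    then have holR: "R holomorphic_on B"
      unfolding R_def by (intro holomorphic_intros holK holX)
    have "(norm (gradient u (at (bcurve t (of_real s)) within closure (Omega t))))\<^sup>2
            = 1/4 + t * ((2 * cos (2 * s) - 3/2 * cos (4 * s)) + t * Re (R (of_real s)))"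
      if s: "\<bar>s - s\<^sub>0\<bar> < 1/2" for s
    proof -
      define \<sigma> where "\<sigma> = complex_of_real s"
      have \<sigma>B: "\<sigma> \<in> B"
        using s by (simp add: \<sigma>_def B_def dist_of_real dist_real_def abs_minus_commute)
      define Q where "Q = deriv D \<sigma> / (exp (\<i> * \<sigma>) * den \<sigma>)
         + of_real t * (- 4 * bcurve t \<sigma> + 2 * bcurve t \<sigma> ^ 3) - cnj (bcurve t \<sigma>) / 2"
      have "gradient u (at (bcurve t \<sigma>) within closure (Omega t)) = cnj Q"
        unfolding \<sigma>_def
        by (intro gradient_eq_cnj torsion_has_derivative[OF D(1,2)]) (use s in \<open>auto simp: Q_def \<sigma>_def den_def\<close>)
      then have "norm (gradient u (at (bcurve t \<sigma>) within closure (Omega t))) = norm (exp (\<i> * \<sigma>) * Q)"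
        by (simp add: norm_mult \<sigma>_def)
      also have "exp (\<i> * \<sigma>) * Q = - 1/2 + of_real t * X \<sigma>"
      proof -
        have 1: "exp (\<i> * \<sigma>) * (deriv D \<sigma> / (exp (\<i> * \<sigma>) * den \<sigma>)) = of_real t ^ 2 * V \<sigma>"
          using t1 by (simp add: V_def)
        have "cnj (exp (\<i> * \<sigma>)) * exp (\<i> * \<sigma>) = 1" "cnj (czeta \<sigma>) = czeta \<sigma>"
          by (simp_all add: \<sigma>_def exp_cnj czeta_of_real flip: exp_add)
        then have 2: "exp (\<i> * \<sigma>) * cnj (bcurve t \<sigma>) = 1 + of_real t * czeta \<sigma>"
          by (simp add: bcurve_def mult_ac)
        have "exp (\<i> * (2 * \<sigma>)) = exp (\<i> * \<sigma>) ^ 2" "exp (\<i> * (4 * \<sigma>)) = exp (\<i> * \<sigma>) ^ 4"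
          using exp_of_nat_mult[of 2 "\<i> * \<sigma>"] exp_of_nat_mult[of 4 "\<i> * \<sigma>"] by (simp_all add: mult_ac)
        note e = this
        have "exp (\<i> * \<sigma>) * Q = of_real t ^ 2 * V \<sigma> + of_real t * (- 4 * (exp (\<i> * \<sigma>) * bcurve t \<sigma>) + 2 * (exp (\<i> * \<sigma>) * bcurve t \<sigma> ^ 3))
            - (1 + of_real t * czeta \<sigma>) / 2"
          unfolding Q_def right_diff_distrib distrib_left 1 2[symmetric] by (simp add: mult_ac)
        also have "\<dots> = - 1/2 + of_real t * X \<sigma>"
          unfolding X_def k_def K_def W_def e bcurve_def
          by (simp add: power4_eq_xxxx power3_eq_cube power2_eq_square field_simps)
        finally show ?thesis .
      qed
      also have "(norm (- 1/2 + of_real t * X \<sigma>))\<^sup>2 = 1/4 + t * (- Re (X \<sigma>) + t * Re (X \<sigma> * cnj (X \<sigma>)))"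
        by (rule norm_shift_half)
      also have "Re (k \<sigma>) = - (2 * cos (2 * s) - 3/2 * cos (4 * s))"
        by (simp add: k_def \<sigma>_def czeta_of_real zeta_def Re_exp field_simps)
      then have "- Re (X \<sigma>) = (2 * cos (2 * s) - 3/2 * cos (4 * s)) - t * Re (K \<sigma>)"
        by (simp add: X_def)
      finally show ?thesis
        by (simp add: R_def \<sigma>_def algebra_simps)
    qed
    then show "\<exists>R. R holomorphic_on ball (of_real s\<^sub>0) (1/2) \<and> (\<forall>w\<in>ball (of_real s\<^sub>0) (1/2). norm (R w) \<le> CV + CW + CX * CX) \<and>
        (\<forall>s. \<bar>s - s\<^sub>0\<bar> < 1/2 \<longrightarrow>
          (norm (gradient u (at (bcurve t (of_real s)) within closure (Omega t))))\<^sup>2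
            = 1/4 + t * ((2 * cos (2 * s) - 3/2 * cos (4 * s)) + t * Re (R (of_real s))))"
      using holR R unfolding B_def by blast
  qed
qed

section \<open>Expansion of the curvature\<close>

definition czeta'' :: "complex \<Rightarrow> complex" where
  "czeta'' w = 16 * cos (2 * w) - 16 * cos (4 * w)"

lemma holomorphic_on_czeta'' [holomorphic_intros]: "czeta'' holomorphic_on A"
  unfolding czeta''_def by (intro holomorphic_intros)

lemma strip_bounded_czeta'': "strip_bounded (\<lambda>t w. czeta'' w)"
  unfolding czeta''_def by (intro strip_bounded_intros)

lemma deriv_zeta: "deriv zeta = (\<lambda>s. 8 * sin (2 * s) - 4 * sin (4 * s))"
  by (rule ext, rule DERIV_imp_deriv) (auto simp: zeta_def[abs_def] intro!: derivative_eq_intros)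

lemma deriv_deriv_zeta: "deriv (deriv zeta) = (\<lambda>s. 16 * cos (2 * s) - 16 * cos (4 * s))"
  unfolding deriv_zeta by (rule ext, rule DERIV_imp_deriv) (auto intro!: derivative_eq_intros)

lemma czeta'_of_real: "czeta' (of_real s) = of_real (deriv zeta s)"
  by (simp add: czeta'_def deriv_zeta flip: sin_of_real)

lemma czeta''_of_real: "czeta'' (of_real s) = of_real (deriv (deriv zeta) s)"
  by (simp add: czeta''_def deriv_deriv_zeta flip: cos_of_real)

text \<open>First-order Taylor expansion of (1 + z)^(-3/2) at 0. The principal branch is holomorphic
  on the unit disc, so its second derivative is bounded on the smaller closed disc by
  compactness.\<close>

lemma powr_expansion_bound:
  obtains C where "C > 0"
    "\<And>z. norm z \<le> 1/2 \<Longrightarrow> norm (exp (- 3/2 * Ln (1 + z)) - (1 - 3/2 * z)) \<le> C * (norm z)\<^sup>2"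
proof -
  define m where "m z = exp (- 3/2 * Ln (1 + z))" for z
  have hol: "m holomorphic_on ball 0 1"
    unfolding m_def
  proof (intro holomorphic_intros)
    fix z :: complex
    assume "z \<in> ball 0 1"
    then have "Re (1 + z) > 0"
      using abs_Re_le_cmod[of z] by simp
    then show "1 + z \<notin> \<real>\<^sub>\<le>\<^sub>0"
      by (auto simp: complex_nonpos_Reals_iff)
  qed
  have sub: "cball 0 (1/2) \<subseteq> ball (0::complex) 1"
    by auto
  define f where "f i = (deriv ^^ i) m" for i
  have holf: "f i holomorphic_on ball 0 1" for i
    unfolding f_def by (rule holomorphic_higher_deriv[OF hol open_ball])
  have "compact (f 2 ` cball 0 (1/2))"
    by (intro compact_continuous_image holomorphic_on_imp_continuous_on holomorphic_on_subset[OF holf sub] compact_cball)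
  from compact_imp_bounded[OF this, unfolded bounded_pos]
  obtain B where "B > 0" "\<forall>y\<in>f 2 ` cball 0 (1/2). norm y \<le> B"
    by blast
  then have B: "B > 0" "\<And>z. z \<in> cball 0 (1/2) \<Longrightarrow> norm (f 2 z) \<le> B"
    by simp_all
  have f1: "f 1 0 = - 3/2"
    unfolding f_def m_def by (auto intro!: DERIV_imp_deriv derivative_eq_intros)
  have "norm (f 0 z - (\<Sum>i\<le>1. f i 0 * (z - 0) ^ i / fact i)) \<le> B * norm (z - 0) ^ Suc 1 / fact 1" if "norm z \<le> 1/2" for z
  proof (rule complex_Taylor[where S="cball 0 (1/2)" and f=f and n=1 and w=0])
    fix i :: nat and x :: complex
    assume "x \<in> cball 0 (1/2)"
    then have "x \<in> ball 0 1"
      using sub by blast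
    from holomorphic_derivI[OF holf open_ball this]
    show "(f i has_field_derivative f (Suc i) x) (at x within cball 0 (1/2))"
      by (simp add: f_def has_field_derivative_at_within)
  qed (use B that in \<open>auto simp: numeral_2_eq_2\<close>)
  then have "norm (m z - (1 - 3/2 * z)) \<le> B * (norm z)\<^sup>2" if "norm z \<le> 1/2" for z
    using that f1 by (simp add: f_def[of 0] m_def[of 0] power2_eq_square algebra_simps)
  with B(1) show ?thesis
    by (intro that) (auto simp: m_def)
qed

text \<open>The numerator of the curvature is \<open>1 + t n\<^sub>1\<close> and the base of the
  power is \<open>1 + t q\<^sub>1\<close>. To leading order \<open>n\<^sub>1 - 3/2 q\<^sub>1\<close>
  is - (\<zeta> + \<zeta>''), and \<zeta> + \<zeta>'' = 12 cos 2s - 15 cos 4s. The sign is reversed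
  so that the minimum becomes a maximum.\<close>

lemma kappa_expansion:
  obtains C t\<^sub>0 where "t\<^sub>0 > 0"
    "\<And>t s\<^sub>0. t \<in> {0<..<t\<^sub>0} \<Longrightarrow>
      \<exists>R. R holomorphic_on ball (of_real s\<^sub>0) (1/2) \<and> (\<forall>w\<in>ball (of_real s\<^sub>0) (1/2). norm (R w) \<le> C) \<and>
        (\<forall>s. \<bar>s - s\<^sub>0\<bar> < 1/2 \<longrightarrow>
          - kappa s t = - 1 + t * ((12 * cos (2 * s) - 15 * cos (4 * s)) + t * Re (R (of_real s))))"
proof -
  note sb = strip_bounded_intros strip_bounded_czeta strip_bounded_czeta' strip_bounded_czeta''
  define n\<^sub>1 where "n\<^sub>1 t w = 2 * czeta w + of_real t * czeta w ^ 2 + 2 * of_real t * czeta' w ^ 2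
      - (1 + of_real t * czeta w) * czeta'' w" for t w
  define q\<^sub>1 where "q\<^sub>1 t w = 2 * czeta w + of_real t * czeta w ^ 2 + of_real t * czeta' w ^ 2" for t w
  \<comment> \<open>The coefficient of t^2 in \<open>(1 + t n\<^sub>1) (1 - 3/2 t q\<^sub>1)\<close>
    after removing 1 - t (\<zeta> + \<zeta>''); the remainder of the power is treated separately as
    \<open>e\<close>.\<close>
  define S where "S t w = czeta w ^ 2 + 2 * czeta' w ^ 2 - czeta w * czeta'' w
     - 3/2 * (czeta w ^ 2 + czeta' w ^ 2) - 3/2 * n\<^sub>1 t w * q\<^sub>1 t w" for t w
  have "strip_bounded (\<lambda>t w. 1 + of_real t * n\<^sub>1 t w)" "strip_bounded q\<^sub>1" "strip_bounded S"
    unfolding n\<^sub>1_def q\<^sub>1_def S_def by (intro sb)+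
  note this[THEN strip_boundedD]
  then obtain CN Cq CS where
    CN: "CN > 0" "\<forall>t w. 0 \<le> t \<longrightarrow> t \<le> 1 \<longrightarrow> \<bar>Im w\<bar> \<le> 1 \<longrightarrow> norm (1 + of_real t * n\<^sub>1 t w) \<le> CN" and
    Cq: "Cq > 0" "\<forall>t w. 0 \<le> t \<longrightarrow> t \<le> 1 \<longrightarrow> \<bar>Im w\<bar> \<le> 1 \<longrightarrow> norm (q\<^sub>1 t w) \<le> Cq" and
    CS: "CS > 0" "\<forall>t w. 0 \<le> t \<longrightarrow> t \<le> 1 \<longrightarrow> \<bar>Im w\<bar> \<le> 1 \<longrightarrow> norm (S t w) \<le> CS"
    by blast
  define m where "m z = exp (- 3/2 * Ln (1 + z))" for z
  obtain Cm where Cm: "Cm > 0" "\<And>z. norm z \<le> 1/2 \<Longrightarrow> norm (m z - (1 - 3/2 * z)) \<le> Cm * (norm z)\<^sup>2"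
    unfolding m_def using powr_expansion_bound by blast
  \<comment> \<open>Chosen so that \<open>t * q\<^sub>1\<close> stays in the disc of radius 1/2
    where the expansion of the power is valid.\<close>
  define t\<^sub>0 where "t\<^sub>0 = 1 / (2 * Cq + 2)"
  show ?thesis
  proof (rule that[of t\<^sub>0 "CS + CN * (Cm * Cq\<^sup>2)"])
    show "t\<^sub>0 > 0"
      using Cq(1) by (simp add: t\<^sub>0_def)
    fix t s\<^sub>0
    assume "t \<in> {0<..<t\<^sub>0}"
    then have "t > 0" "t * (2 * Cq + 2) < 1"
      using Cq(1) by (auto simp: t\<^sub>0_def field_simps)
    moreover then have "t * Cq > 0"
      using Cq(1) by simp
    ultimately have t: "0 < t" "0 \<le> t" "t \<le> 1" "t * Cq \<le> 1/2"
      by (auto simp: algebra_simps)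
    define B where "B = ball (complex_of_real s\<^sub>0) (1/2)"
    have Im_B: "\<bar>Im w\<bar> \<le> 1" if "w \<in> B" for w
      using that abs_Im_le_cmod[of "w - of_real s\<^sub>0"] by (simp add: B_def dist_norm norm_minus_commute)
    have tq: "norm (of_real t * q\<^sub>1 t w) \<le> t * Cq" if "\<bar>Im w\<bar> \<le> 1" for w
      unfolding norm_mult using Cq(2) that t by (auto intro!: mult_left_mono)
    have half: "norm (of_real t * q\<^sub>1 t w) \<le> 1/2" if "\<bar>Im w\<bar> \<le> 1" for w
      using tq[OF that] t(4) by linarith
    define e where "e w = m (of_real t * q\<^sub>1 t w) - (1 - 3/2 * (of_real t * q\<^sub>1 t w))" for w
    define R where "R w = - (S t w) - (1 + of_real t * n\<^sub>1 t w) * e w / of_real t ^ 2" for w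
    have R: "norm (R w) \<le> CS + CN * (Cm * Cq\<^sup>2)" if "w \<in> B" for w
    proof -
      note Im = Im_B[OF that]
      have "norm (e w) \<le> Cm * (norm (of_real t * q\<^sub>1 t w))\<^sup>2"
        unfolding e_def by (rule Cm(2)[OF half[OF Im]])
      also have "\<dots> \<le> Cm * (t * Cq)\<^sup>2"
        using tq[OF Im] Cm(1) by (intro mult_left_mono power_mono) auto
      finally have "norm (e w) / t\<^sup>2 \<le> Cm * Cq\<^sup>2"
        using t(1) by (simp add: field_simps)
      then have "norm (1 + of_real t * n\<^sub>1 t w) * (norm (e w) / t\<^sup>2) \<le> CN * (Cm * Cq\<^sup>2)"
        using CN Im t by (intro mult_mono) auto
      then have "norm ((1 + of_real t * n\<^sub>1 t w) * e w / of_real t ^ 2) \<le> CN * (Cm * Cq\<^sup>2)"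
        by (simp add: norm_mult norm_divide norm_power)
      moreover have "norm (- S t w) \<le> CS"
        using CS(2) Im t by simp
      ultimately show ?thesis
        unfolding R_def using norm_triangle_ineq4[of "- S t w" "(1 + of_real t * n\<^sub>1 t w) * e w / of_real t ^ 2"]
        by linarith
    qed
    have holR: "R holomorphic_on B"
      unfolding R_def e_def m_def S_def n\<^sub>1_def q\<^sub>1_def[abs_def]
    proof (intro holomorphic_intros)
      fix w
      assume "w \<in> B"
      from half[OF Im_B[OF this]]
      have "Re (1 + of_real t * q\<^sub>1 t w) > 0"
        using abs_Re_le_cmod[of "of_real t * q\<^sub>1 t w"] by simp
      then show "1 + of_real t * (2 * czeta w + of_real t * czeta w ^ 2 + of_real t * czeta' w ^ 2) \<notin> \<real>\<^sub>\<le>\<^sub>0"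
        unfolding q\<^sub>1_def by (auto simp: complex_nonpos_Reals_iff)
    qed (use t in auto)
    have "- kappa s t = - 1 + t * ((12 * cos (2 * s) - 15 * cos (4 * s)) + t * Re (R (of_real s)))" for s
    proof -
      define \<sigma> where "\<sigma> = complex_of_real s"
      define z where "z = zeta s"
      define z' where "z' = deriv zeta s"
      define z'' where "z'' = deriv (deriv zeta) s"
      have cz: "czeta \<sigma> = of_real z" "czeta' \<sigma> = of_real z'" "czeta'' \<sigma> = of_real z''"
        by (simp_all add: \<sigma>_def z_def z'_def z''_def czeta_of_real czeta'_of_real czeta''_of_real)
      define n where "n = 2 * z + t * z ^ 2 + 2 * t * z' ^ 2 - (1 + t * z) * z''"
      define q where "q = 2 * z + t * z ^ 2 + t * z' ^ 2"
      have n: "n\<^sub>1 t \<sigma> = of_real n" and q: "q\<^sub>1 t \<sigma> = of_real q"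
        by (simp_all add: n\<^sub>1_def q\<^sub>1_def n_def q_def cz)
      have "norm (of_real t * q\<^sub>1 t \<sigma>) \<le> 1/2"
        by (rule half) (simp add: \<sigma>_def)
      then have qpos: "1 + t * q > 0"
        by (simp add: q flip: of_real_mult)
      define r where "r = exp (- 3/2 * ln (1 + t * q))"
      have mr: "m (of_real t * q\<^sub>1 t \<sigma>) = of_real r"
      proof -
        have "1 + of_real t * q\<^sub>1 t \<sigma> = of_real (1 + t * q)"
          by (simp add: q)
        then have "Ln (1 + of_real t * q\<^sub>1 t \<sigma>) = of_real (ln (1 + t * q))"
          using Ln_of_real[OF qpos] by (simp only:)
        then show ?thesis
          by (simp add: m_def r_def flip: exp_of_real)
      qed
      have "kappa s t = (1 + t * n) / (1 + t * q) powr (3/2)"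
      proof -
        have "(1 + t * z)\<^sup>2 + 2 * (t * z')\<^sup>2 - (1 + t * z) * (t * z'') = 1 + t * n"
          "(1 + t * z)\<^sup>2 + (t * z')\<^sup>2 = 1 + t * q"
          by (simp_all add: n_def q_def power2_eq_square algebra_simps)
        then show ?thesis
          by (simp add: kappa_def z_def z'_def z''_def)
      qed
      also have "(1 + t * q) powr (3/2) = exp (3/2 * ln (1 + t * q))"
        using qpos unfolding powr_def by auto
      also have "(1 + t * n) / exp (3/2 * ln (1 + t * q)) = (1 + t * n) * r"
        unfolding r_def divide_inverse exp_minus[symmetric] by simp
      finally have kap: "kappa s t = (1 + t * n) * r" .
      have Rr: "Re (R \<sigma>) = - (z ^ 2 + 2 * z' ^ 2 - z * z'' - 3/2 * (z ^ 2 + z' ^ 2) - 3/2 * n * q)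
          - (1 + t * n) * (r - (1 - 3/2 * (t * q))) / t ^ 2"
      proof -
        have "R \<sigma> = of_real (- (z ^ 2 + 2 * z' ^ 2 - z * z'' - 3/2 * (z ^ 2 + z' ^ 2) - 3/2 * n * q)
          - (1 + t * n) * (r - (1 - 3/2 * (t * q))) / t ^ 2)"
          unfolding R_def e_def S_def n q cz mr[unfolded q] by simp
        then show ?thesis
          by (simp only: Re_complex_of_real)
      qed
      have g: "12 * cos (2 * s) - 15 * cos (4 * s) = z + z''"
        by (simp add: z_def z''_def zeta_def deriv_deriv_zeta)
      have "t ^ 2 * (- A - B / t ^ 2) = - (t ^ 2 * A) - B" for A B
        using t(1) by (simp add: field_simps)
      then have "t ^ 2 * Re (R \<sigma>) = - (t ^ 2 * (z ^ 2 + 2 * z' ^ 2 - z * z'' - 3/2 * (z ^ 2 + z' ^ 2) - 3/2 * n * q))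
          - (1 + t * n) * (r - (1 - 3/2 * (t * q)))"
        unfolding Rr .
      moreover have "t * (n - 3/2 * q + (z + z'')) = t ^ 2 * (z ^ 2 + 2 * z' ^ 2 - z * z'' - 3/2 * (z ^ 2 + z' ^ 2))"
        by (simp add: n_def q_def power2_eq_square field_simps)
      ultimately have "- ((1 + t * n) * r) = - 1 + t * (z + z'') + t ^ 2 * Re (R \<sigma>)"
        by (simp add: power2_eq_square field_simps)
      then show ?thesis
        unfolding kap g by (simp add: \<sigma>_def power2_eq_square algebra_simps)
    qed
    then show "\<exists>R. R holomorphic_on ball (of_real s\<^sub>0) (1/2) \<and> (\<forall>w\<in>ball (of_real s\<^sub>0) (1/2). norm (R w) \<le> CS + CN * (Cm * Cq\<^sup>2)) \<and>
        (\<forall>s. \<bar>s - s\<^sub>0\<bar> < 1/2 \<longrightarrow>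
          - kappa s t = - 1 + t * ((12 * cos (2 * s) - 15 * cos (4 * s)) + t * Re (R (of_real s))))"
      using holR R unfolding B_def by blast
  qed
qed

section \<open>Location of the extrema\<close>

text \<open>In the variable \<open>c = cos (2 s)\<close> the leading coefficient is a concave parabola with vertex \<open>cos (2 p)\<close>.\<close>

lemma perturbed_cos_max:
  fixes f :: "real \<Rightarrow> real \<Rightarrow> real"
  assumes p: "0 < p" "p < pi / 2" and \<beta>: "\<beta> < 0" and \<alpha>: "\<alpha> = - 4 * \<beta> * cos (2 * p)"
    and expansion: "\<forall>\<^sub>F t in at_right 0. \<forall>s\<^sub>0. \<exists>R. R holomorphic_on ball (of_real s\<^sub>0) (1/2) \<and>
       (\<forall>w\<in>ball (of_real s\<^sub>0) (1/2). norm (R w) \<le> C) \<and>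
       (\<forall>s. \<bar>s - s\<^sub>0\<bar> < 1/2 \<longrightarrow> f t s = c\<^sub>0 + t * ((\<alpha> * cos (2 * s) + \<beta> * cos (4 * s)) + t * Re (R (of_real s))))"
  obtains \<sigma> where "\<forall>\<^sub>F t in at_right 0. {s. is_arg_max (f t) (\<lambda>s. s \<in> {0..pi / 2}) s} = {\<sigma> t}"
    and "(\<lambda>t. \<sigma> t - p) \<in> O[at_right 0](\<lambda>t. t)"
proof (rule perturbed_max[OF p _ _ _ _ _ _ expansion])
  have cos4: "cos (4 * s) = 2 * (cos (2 * s))\<^sup>2 - 1" for s :: real
    using cos_double_cos[of "2 * s"] by simp
  show "((\<lambda>s. \<alpha> * cos (2 * s) + \<beta> * cos (4 * s)) has_real_derivative - 2 * \<alpha> * sin (2 * s) - 4 * \<beta> * sin (4 * s)) (at s)" for s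
    by (auto intro!: derivative_eq_intros)
  show "((\<lambda>s. - 2 * \<alpha> * sin (2 * s) - 4 * \<beta> * sin (4 * s)) has_real_derivative - 4 * \<alpha> * cos (2 * s) - 16 * \<beta> * cos (4 * s)) (at s)" for s
    by (auto intro!: derivative_eq_intros)
  show "isCont (\<lambda>s. - 4 * \<alpha> * cos (2 * s) - 16 * \<beta> * cos (4 * s)) p"
    by (intro continuous_intros)
  have "sin (2 * p) > 0"
    using p by (intro sin_gt_zero) auto
  then have "\<beta> * (sin (2 * p))\<^sup>2 < 0"
    using \<beta> by (intro mult_neg_pos) auto
  \<comment> \<open>Nondegeneracy in \<open>s\<close> itself: the vertex of the parabola in c is
    interior, and dc/ds = -2 sin 2s does not vanish at \<open>p\<close>.\<close>
  moreover have "- 4 * \<alpha> * cos (2 * p) - 16 * \<beta> * cos (4 * p) = 16 * (\<beta> * (sin (2 * p))\<^sup>2)"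
    unfolding cos4 \<alpha> sin_squared_eq by (simp add: power2_eq_square algebra_simps)
  ultimately show "- 4 * \<alpha> * cos (2 * p) - 16 * \<beta> * cos (4 * p) < 0"
    by simp
  show "\<alpha> * cos (2 * s) + \<beta> * cos (4 * s) < \<alpha> * cos (2 * p) + \<beta> * cos (4 * p)"
    if "s \<in> {0..pi / 2}" "s \<noteq> p" for s
  proof -
    have "cos (2 * s) \<noteq> cos (2 * p)"
      using cos_inj_pi[of "2 * s" "2 * p"] that p by auto
    then have "\<beta> * (cos (2 * s) - cos (2 * p))\<^sup>2 < 0"
      using \<beta> by (intro mult_neg_pos) auto
    moreover have "(\<alpha> * cos (2 * s) + \<beta> * cos (4 * s)) - (\<alpha> * cos (2 * p) + \<beta> * cos (4 * p))
        = 2 * (\<beta> * (cos (2 * s) - cos (2 * p))\<^sup>2)"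
      unfolding cos4 \<alpha> by (simp add: power2_eq_square algebra_simps)
    ultimately show ?thesis
      by linarith
  qed
qed (use that in auto)

section \<open>From the parameter interval to the boundary arc\<close>

lemma Arg_bcurve:
  assumes "t \<in> {0<..<1/10}" "s \<in> {0..pi / 2}"
  shows "Arg (bcurve t (of_real s)) = s"
proof -
  have "s \<in> {- pi<..pi}"
    using assms(2) pi_gt_zero unfolding atLeastAtMost_iff greaterThanAtMost_iff by linarith
  moreover have "1 + t * zeta s > 0"
    using t_zeta_bound[OF assms(1), of s] by linarith
  ultimately show ?thesis
    unfolding bcurve_of_real by (rule Arg_rcis)
qed

lemma Gamma_pp_eq:
  assumes t: "t \<in> {0<..<1/10}"
  shows "Gamma_pp t = (\<lambda>s. bcurve t (of_real s)) ` {0..pi / 2}"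
proof (intro equalityI subsetI)
  fix z
  assume z: "z \<in> Gamma_pp t"
  then have "z = bcurve t (of_real (Arg z))"
    using frontier_eq_bcurve[OF t] by (simp add: Gamma_pp_def)
  moreover have "Arg z \<in> {0..pi / 2}"
    using z Arg_less_0[of z] Arg_Re_nonneg[of z] by (auto simp: Gamma_pp_def)
  ultimately show "z \<in> (\<lambda>s. bcurve t (of_real s)) ` {0..pi / 2}"
    by blast
next
  fix z
  assume "z \<in> (\<lambda>s. bcurve t (of_real s)) ` {0..pi / 2}"
  then obtain s where s: "s \<in> {0..pi / 2}" "z = bcurve t (of_real s)"
    by blast
  have "cos s \<ge> 0" "sin s \<ge> 0" "1 + t * zeta s \<ge> 0"
    using s(1) t_zeta_bound[OF t, of s] by (auto intro!: cos_ge_zero sin_ge_zero simp: abs_less_iff)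
  then show "z \<in> Gamma_pp t"
    using bcurve_in_frontier[OF t, of s] s(2) unfolding Gamma_pp_def by (simp add: bcurve_of_real)
qed

lemma is_arg_max_image:
  "{x. is_arg_max \<phi> (\<lambda>x. x \<in> h ` A) x} = h ` {s. is_arg_max (\<lambda>s. \<phi> (h s)) (\<lambda>s. s \<in> A) s}"
  by (auto simp: is_arg_max_def)

lemma is_arg_max_Gamma_pp:
  assumes t: "t \<in> {0<..<1/10}"
    and \<sigma>: "{s. is_arg_max (\<lambda>s. \<phi> (bcurve t (of_real s))) (\<lambda>s. s \<in> {0..pi / 2}) s} = {\<sigma>}"
  shows "{x. is_arg_max \<phi> (\<lambda>x. x \<in> Gamma_pp t) x} = {bcurve t (of_real \<sigma>)}"
    and "Arg (bcurve t (of_real \<sigma>)) = \<sigma>"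
proof -
  show "{x. is_arg_max \<phi> (\<lambda>x. x \<in> Gamma_pp t) x} = {bcurve t (of_real \<sigma>)}"
    unfolding Gamma_pp_eq[OF t] is_arg_max_image \<sigma> by simp
  have "is_arg_max (\<lambda>s. \<phi> (bcurve t (of_real s))) (\<lambda>s. s \<in> {0..pi / 2}) \<sigma>"
    using \<sigma> by blast
  then show "Arg (bcurve t (of_real \<sigma>)) = \<sigma>"
    by (intro Arg_bcurve[OF t]) (simp add: is_arg_max_def)
qed

text \<open>Carries the location of the maximum from the squared gradient norm, for which the
  expansion holds, to the norm.\<close>

lemma is_arg_max_power2:
  fixes f :: "'a \<Rightarrow> real"
  assumes "\<And>x. P x \<Longrightarrow> 0 \<le> f x"
  shows "is_arg_max (\<lambda>x. (f x)\<^sup>2) P x \<longleftrightarrow> is_arg_max f P x"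
proof -
  have "(f x)\<^sup>2 < (f y)\<^sup>2 \<longleftrightarrow> f x < f y" if "P x" "P y" for x y
    using assms[OF that(1)] assms[OF that(2)] by (simp flip: not_le)
  then show ?thesis
    unfolding is_arg_max_def by blast
qed

text \<open>On the line spanned by \<open>c\<close> the domain is symmetric when the profile has the
  same value \<open>Z\<close> at \<open>c\<close> and \<open>- c\<close>. The choices 1 and i of
  \<open>c\<close> yield the two axes.\<close>

lemma Omega_Int_axis:
  assumes t: "t \<in> {0<..<1/10}" and c: "norm c = 1" and z: "zdir c = Z" "zdir (- c) = Z"
  shows "Omega t \<inter> range (\<lambda>y. of_real y * c) = open_segment (- (of_real (1 + t * Z) * c)) (of_real (1 + t * Z) * c)"
proof -
  define r where "r = 1 + t * Z"
  have r: "r > 0"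
    using t_zdir_bound[OF t, of c] z by (auto simp: r_def abs_less_iff)
  have in_iff: "of_real y * c \<in> Omega t \<longleftrightarrow> \<bar>y\<bar> < r" for y :: real
  proof (cases y "0::real" rule: linorder_cases)
    case less
    have "of_real y * c = (- y) *\<^sub>R (- c)"
      by (simp add: scaleR_conv_of_real)
    then show ?thesis
      using less c z zdir_scaleR[of "- y" "- c"] by (simp add: Omega_eq_zdir[OF t] r_def)
  next
    case equal
    then show ?thesis
      using r t_zdir_bound[OF t, of 0] by (simp add: Omega_eq_zdir[OF t] abs_less_iff)
  next
    case greater
    then show ?thesis
      using c z zdir_scaleR[of y c] by (simp add: Omega_eq_zdir[OF t] r_def norm_mult scaleR_conv_of_real)
  qed
  have "open_segment (- (of_real r * c)) (of_real r * c) = (\<lambda>y. of_real y * c) ` open_segment (- r) r"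
  proof -
    have "linear (\<lambda>y. of_real y * c)"
      by (rule linearI) (simp_all add: algebra_simps scaleR_conv_of_real)
    moreover have "inj (\<lambda>y. of_real y * c)"
      using c by (auto simp: inj_def)
    ultimately show ?thesis
      using open_segment_linear_image[of "\<lambda>y. of_real y * c" "- r" r] by simp
  qed
  also have "open_segment (- r) r = {- r<..<r}"
    using r by (simp add: open_segment_eq_real_ivl)
  finally show ?thesis
    unfolding r_def[symmetric] by (auto simp: in_iff abs_less_iff image_iff)
qed

lemma diameter_open_segment:
  fixes a b :: "'a::euclidean_space"
  assumes "a \<noteq> b"
  shows "diameter (open_segment a b) = dist a b"
proof -
  have "diameter (open_segment a b) = diameter (closed_segment a b)"
    using diameter_closure[OF bounded_open_segment, of a b] assms by simp
  also have "\<dots> = dist a b"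
  proof (rule antisym)
    show "diameter (closed_segment a b) \<le> dist a b"
    proof (rule diameter_le)
      fix x y
      assume "x \<in> closed_segment a b" "y \<in> closed_segment a b"
      then obtain c d where cd: "x = (1 - c) *\<^sub>R a + c *\<^sub>R b" "0 \<le> c" "c \<le> 1"
        "y = (1 - d) *\<^sub>R a + d *\<^sub>R b" "0 \<le> d" "d \<le> 1"
        by (auto simp: in_segment)
      have "x - y = (d - c) *\<^sub>R (a - b)"
        by (simp add: cd algebra_simps)
      then show "norm (x - y) \<le> dist a b"
        using cd by (simp add: dist_norm mult_left_le_one_le abs_le_iff)
    qed auto
    show "dist a b \<le> diameter (closed_segment a b)"
      by (intro diameter_bounded_bound compact_imp_bounded compact_segment) auto
  qed
  finally show ?thesis .
qed

lemma dist_uminus_self: "dist (- x) x = norm (x + x)" for x :: "'a::real_normed_vector"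
  by (metis dist_commute dist_norm diff_minus_eq_add)

text \<open>With c = cos 2s one has \<zeta> = 2 (c - 1)^2 - 3, so the minimum at s = 0 is exact and
  holds for every \<open>t\<close> in the range. The axes have lengths 2 (1 - 3t) and 2 (1 + 5t),
  which expresses that the minimum lies at an end of the shorter one.\<close>

lemma shortest_axis:
  assumes t: "t \<in> {0<..<1/10}"
  shows "{x. is_arg_min norm (\<lambda>x. x \<in> Gamma_pp t) x} = {bcurve t 0} \<and> Arg (bcurve t 0) = 0 \<and>
    closure (Omega t \<inter> {x. Im x = 0}) = closed_segment (- bcurve t 0) (bcurve t 0) \<and>
    diameter (Omega t \<inter> {x. Im x = 0}) < diameter (Omega t \<inter> {x. Re x = 0})"
proof (intro conjI)
  have pos: "1 + t * zeta s > 0" for s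
    using t_zeta_bound[OF t, of s] by (simp add: abs_less_iff)
  have nb: "norm (bcurve t (of_real s)) = 1 + t * zeta s" for s
    using pos[of s] by (simp add: bcurve_of_real)
  have zeta0: "zeta 0 < zeta s" if "s \<in> {0..pi / 2}" "s \<noteq> 0" for s
  proof -
    have "cos (2 * s) \<noteq> 1"
      using cos_inj_pi[of "2 * s" 0] that by auto
    then have "(cos (2 * s) - 1)\<^sup>2 > 0"
      by simp
    then show ?thesis
      using cos_double_cos[of "2 * s"] by (simp add: zeta_def power2_eq_square algebra_simps)
  qed
  have "{s. is_arg_max (\<lambda>s. - norm (bcurve t (of_real s))) (\<lambda>s. s \<in> {0..pi / 2}) s} = {0}"
  proof (rule set_eqI)
    fix s
    have le: "zeta 0 \<le> zeta y" if "y \<in> {0..pi / 2}" for y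
      using zeta0[OF that] by (cases "y = 0") auto
    have "is_arg_max (\<lambda>s. - norm (bcurve t (of_real s))) (\<lambda>s. s \<in> {0..pi / 2}) s \<longleftrightarrow>
        s \<in> {0..pi / 2} \<and> (\<forall>y\<in>{0..pi / 2}. zeta s \<le> zeta y)"
      unfolding is_arg_max_def nb using t by (auto simp: not_less)
    also have "\<dots> \<longleftrightarrow> s = 0"
    proof
      assume *: "s \<in> {0..pi / 2} \<and> (\<forall>y\<in>{0..pi / 2}. zeta s \<le> zeta y)"
      have "0 \<in> {0..pi / 2}"
        using pi_ge_zero by simp
      then have "zeta s \<le> zeta 0"
        using * by blast
      then show "s = 0"
        using zeta0[of s] * by force
    qed (use le pi_ge_zero in auto)
    finally show "s \<in> {s. is_arg_max (\<lambda>s. - norm (bcurve t (of_real s))) (\<lambda>s. s \<in> {0..pi / 2}) s} \<longleftrightarrow> s \<in> {0}"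
      by simp
  qed
  from is_arg_max_Gamma_pp[where \<phi>="\<lambda>z. - norm z", OF t this]
  show "{x. is_arg_min norm (\<lambda>x. x \<in> Gamma_pp t) x} = {bcurve t 0}" "Arg (bcurve t 0) = 0"
    by (simp_all add: is_arg_max_def is_arg_min_def)
  have z: "zdir 1 = -3" "zdir (-1) = -3" "zdir \<i> = 5" "zdir (-\<i>) = 5"
    by (simp_all add: zdir_def sgn_div_norm power4_eq_xxxx power2_eq_square)
  have b0: "bcurve t 0 = of_real (1 + t * (-3))"
    using bcurve_of_real[of t 0] by (simp add: zeta_def rcis_def)
  have "{x. Im x = 0} = range (\<lambda>y. of_real y * 1)" "{x. Re x = 0} = range (\<lambda>y. of_real y * \<i>)"
    by (auto simp: image_iff complex_eq_iff)
  then have ax: "Omega t \<inter> {x. Im x = 0} = open_segment (- bcurve t 0) (bcurve t 0)"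
    "Omega t \<inter> {x. Re x = 0} = open_segment (- (of_real (1 + t * 5) * \<i>)) (of_real (1 + t * 5) * \<i>)"
    using Omega_Int_axis[OF t _ z(1,2)] Omega_Int_axis[OF t _ z(3,4)] by (simp_all add: b0)
  have ne: "bcurve t 0 \<noteq> 0" "complex_of_real (1 + t * 5) \<noteq> 0"
    using t unfolding b0 of_real_eq_0_iff by auto
  have neg: "- b \<noteq> b" if "b \<noteq> 0" for b :: complex
    using that by (auto simp: complex_eq_iff)
  have ne': "- bcurve t 0 \<noteq> bcurve t 0" "- (of_real (1 + t * 5) * \<i>) \<noteq> of_real (1 + t * 5) * \<i>"
    using ne neg[of "bcurve t 0"] neg[of "of_real (1 + t * 5) * \<i>"] by simp_all
  show "closure (Omega t \<inter> {x. Im x = 0}) = closed_segment (- bcurve t 0) (bcurve t 0)"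
    unfolding ax closure_open_segment using ne'(1) by simp
  have "diameter (Omega t \<inter> {x. Im x = 0}) = norm (2 * of_real (1 + t * (-3)) :: complex)"
    unfolding ax diameter_open_segment[OF ne'(1)] dist_uminus_self unfolding b0 by (simp only: mult_2)
  also have "\<dots> = 2 * (1 + t * (-3))"
    using t by (simp only: norm_mult norm_of_real norm_numeral) simp
  also have "\<dots> < 2 * (1 + t * 5)"
    using t by simp
  also have "\<dots> = norm (2 * (of_real (1 + t * 5) * \<i>))"
    using t by (simp only: norm_mult norm_of_real norm_numeral norm_ii) simp
  also have "\<dots> = diameter (Omega t \<inter> {x. Re x = 0})"
    unfolding ax diameter_open_segment[OF ne'(2)] dist_uminus_self by (simp only: mult_2)
  finally show "diameter (Omega t \<inter> {x. Im x = 0}) < diameter (Omega t \<inter> {x. Re x = 0})" .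
qed

text \<open>Matches the stated angles with the vertices: q = 2/3 gives cos 2p = 1/3 and q = 3/5
  gives 1/5.\<close>

lemma arccos_sqrt_bounds:
  assumes "0 < q" "q < 1"
  shows "0 < arccos (sqrt q)" "arccos (sqrt q) < pi / 2" "cos (2 * arccos (sqrt q)) = 2 * q - 1"
proof -
  have s: "0 < sqrt q" "sqrt q < 1"
    using assms by auto
  show "0 < arccos (sqrt q)" "arccos (sqrt q) < pi / 2"
    using s arccos_less_arccos[of "sqrt q" 1] arccos_less_arccos[of 0 "sqrt q"] by (simp_all del: real_sqrt_gt_0_iff)
  show "cos (2 * arccos (sqrt q)) = 2 * q - 1"
  proof -
    have "cos (arccos (sqrt q)) = sqrt q"
      using s by (intro cos_arccos) linarith+
    then show ?thesis
      using assms by (simp add: cos_double_cos)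
  qed
qed

theorem proposition4p1:
  fixes u :: "real \<Rightarrow> complex \<Rightarrow> real"
  assumes torsion: "\<forall>\<^sub>F t in at_right 0. torsion_function (Omega t) (u t)"
  shows
    "(\<exists>P :: real \<Rightarrow> complex.
        (\<forall>\<^sub>F t in at_right 0.
           {x. is_arg_max (\<lambda>x. norm (gradient (u t) (at x within closure (Omega t))))
                 (\<lambda>x. x \<in> Gamma_pp t) x} = {P t}) \<and>
        (\<lambda>t. Arg (P t) - arccos (sqrt (2 / 3))) \<in> O[at_right 0](\<lambda>t. t)) \<and>
     (\<exists>P :: real \<Rightarrow> complex.
        (\<forall>\<^sub>F t in at_right 0.
           {x. is_arg_min (\<lambda>x. kappa (Arg x) t) (\<lambda>x. x \<in> Gamma_pp t) x} = {P t}) \<and>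
        (\<lambda>t. Arg (P t) - arccos (sqrt (3 / 5))) \<in> O[at_right 0](\<lambda>t. t)) \<and>
     (\<exists>P :: real \<Rightarrow> complex.
        \<forall>\<^sub>F t in at_right 0.
           {x. is_arg_min norm (\<lambda>x. x \<in> Gamma_pp t) x} = {P t} \<and>
           Arg (P t) = 0 \<and>
           closure (Omega t \<inter> {x. Im x = 0}) = closed_segment (- P t) (P t) \<and>
           diameter (Omega t \<inter> {x. Im x = 0}) < diameter (Omega t \<inter> {x. Re x = 0}))"
proof (intro conjI)
  have ev: "\<forall>\<^sub>F t in at_right 0. t \<in> {0<..<d}" if "d > 0" for d :: real
    using that by (auto simp: eventually_at_right_field)
  have ev10: "\<forall>\<^sub>F t in at_right 0. t \<in> {0<..<1/10::real}"
    by (rule ev) simp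
  show "\<exists>P :: real \<Rightarrow> complex.
        (\<forall>\<^sub>F t in at_right 0.
           {x. is_arg_max (\<lambda>x. norm (gradient (u t) (at x within closure (Omega t))))
                 (\<lambda>x. x \<in> Gamma_pp t) x} = {P t}) \<and>
        (\<lambda>t. Arg (P t) - arccos (sqrt (2 / 3))) \<in> O[at_right 0](\<lambda>t. t)"
  proof -
    define G where "G t x = norm (gradient (u t) (at x within closure (Omega t)))" for t x
    obtain C t\<^sub>0 where t0: "t\<^sub>0 > 0"
      "\<And>t u s\<^sub>0. t \<in> {0<..<t\<^sub>0} \<Longrightarrow> torsion_function (Omega t) u \<Longrightarrow>
      \<exists>R. R holomorphic_on ball (of_real s\<^sub>0) (1/2) \<and> (\<forall>w\<in>ball (of_real s\<^sub>0) (1/2). norm (R w) \<le> C) \<and>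
        (\<forall>s. \<bar>s - s\<^sub>0\<bar> < 1/2 \<longrightarrow>
          (norm (gradient u (at (bcurve t (of_real s)) within closure (Omega t))))\<^sup>2
            = 1/4 + t * ((2 * cos (2 * s) - 3/2 * cos (4 * s)) + t * Re (R (of_real s))))"
      by (rule gradient_expansion) blast
    have exp: "\<forall>\<^sub>F t in at_right 0. \<forall>s\<^sub>0. \<exists>R. R holomorphic_on ball (of_real s\<^sub>0) (1/2) \<and>
       (\<forall>w\<in>ball (of_real s\<^sub>0) (1/2). norm (R w) \<le> C) \<and>
       (\<forall>s. \<bar>s - s\<^sub>0\<bar> < 1/2 \<longrightarrow> (G t (bcurve t (of_real s)))\<^sup>2
          = 1/4 + t * ((2 * cos (2 * s) + (- 3/2) * cos (4 * s)) + t * Re (R (of_real s))))"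
      using torsion ev[OF t0(1)]
    proof eventually_elim
      case (elim t)
      show ?case
        using t0(2)[OF elim(2,1)] by (simp add: G_def)
    qed
    note p = arccos_sqrt_bounds[of "2/3"]
    obtain \<sigma> where \<sigma>: "\<forall>\<^sub>F t in at_right 0. {s. is_arg_max (\<lambda>s. (G t (bcurve t (of_real s)))\<^sup>2) (\<lambda>s. s \<in> {0..pi / 2}) s} = {\<sigma> t}"
      "(\<lambda>t. \<sigma> t - arccos (sqrt (2 / 3))) \<in> O[at_right 0](\<lambda>t. t)"
      \<comment> \<open>The vertex condition reads 2 = -4 * (-3/2) * (1/3).\<close>
      by (rule perturbed_cos_max[OF _ _ _ _ exp, of "arccos (sqrt (2/3))"]) (use p in auto)
    have fin: "\<forall>\<^sub>F t in at_right 0. {x. is_arg_max (G t) (\<lambda>x. x \<in> Gamma_pp t) x} = {bcurve t (of_real (\<sigma> t))} \<and>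
        Arg (bcurve t (of_real (\<sigma> t))) = \<sigma> t"
      using \<sigma>(1) ev10
    proof eventually_elim
      case (elim t)
      have "{s. is_arg_max (\<lambda>s. G t (bcurve t (of_real s))) (\<lambda>s. s \<in> {0..pi / 2}) s} = {\<sigma> t}"
        using elim(1) by (subst (asm) is_arg_max_power2) (simp_all add: G_def)
      from is_arg_max_Gamma_pp[OF elim(2) this] show ?case
        by simp
    qed
    have "(\<lambda>t. Arg (bcurve t (of_real (\<sigma> t))) - arccos (sqrt (2 / 3))) \<in> O[at_right 0](\<lambda>t. t)"
      \<comment> \<open>The argument of the point equals \<open>\<sigma> t\<close> only for small
        \<open>t\<close>, which is all that the order relation at 0 sees.\<close>
      by (rule landau_o.big.in_cong[THEN iffD2, OF _ \<sigma>(2)]) (use fin in \<open>auto elim: eventually_mono\<close>)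
    with fin show ?thesis
      unfolding G_def by (intro exI[of _ "\<lambda>t. bcurve t (of_real (\<sigma> t))"]) (auto elim: eventually_mono)
  qed
  show "\<exists>P :: real \<Rightarrow> complex.
        (\<forall>\<^sub>F t in at_right 0.
           {x. is_arg_min (\<lambda>x. kappa (Arg x) t) (\<lambda>x. x \<in> Gamma_pp t) x} = {P t}) \<and>
        (\<lambda>t. Arg (P t) - arccos (sqrt (3 / 5))) \<in> O[at_right 0](\<lambda>t. t)"
  proof -
    obtain C t\<^sub>0 where t0: "t\<^sub>0 > 0"
      "\<And>t s\<^sub>0. t \<in> {0<..<t\<^sub>0} \<Longrightarrow>
      \<exists>R. R holomorphic_on ball (of_real s\<^sub>0) (1/2) \<and> (\<forall>w\<in>ball (of_real s\<^sub>0) (1/2). norm (R w) \<le> C) \<and>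
        (\<forall>s. \<bar>s - s\<^sub>0\<bar> < 1/2 \<longrightarrow>
          - kappa s t = - 1 + t * ((12 * cos (2 * s) - 15 * cos (4 * s)) + t * Re (R (of_real s))))"
      by (rule kappa_expansion) blast
    have exp: "\<forall>\<^sub>F t in at_right 0. \<forall>s\<^sub>0. \<exists>R. R holomorphic_on ball (of_real s\<^sub>0) (1/2) \<and>
       (\<forall>w\<in>ball (of_real s\<^sub>0) (1/2). norm (R w) \<le> C) \<and>
       (\<forall>s. \<bar>s - s\<^sub>0\<bar> < 1/2 \<longrightarrow> - kappa s t
          = - 1 + t * ((12 * cos (2 * s) + (- 15) * cos (4 * s)) + t * Re (R (of_real s))))"
      using ev[OF t0(1)]
    proof eventually_elim
      case (elim t)
      show ?case
        using t0(2)[OF elim] by simp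
    qed
    note p = arccos_sqrt_bounds[of "3/5"]
    obtain \<sigma> where \<sigma>: "\<forall>\<^sub>F t in at_right 0. {s. is_arg_max (\<lambda>s. - kappa s t) (\<lambda>s. s \<in> {0..pi / 2}) s} = {\<sigma> t}"
      "(\<lambda>t. \<sigma> t - arccos (sqrt (3 / 5))) \<in> O[at_right 0](\<lambda>t. t)"
      \<comment> \<open>The vertex condition reads 12 = -4 * (-15) * (1/5).\<close>
      by (rule perturbed_cos_max[OF _ _ _ _ exp, of "arccos (sqrt (3/5))"]) (use p in auto)
    have fin: "\<forall>\<^sub>F t in at_right 0. {x. is_arg_min (\<lambda>x. kappa (Arg x) t) (\<lambda>x. x \<in> Gamma_pp t) x} = {bcurve t (of_real (\<sigma> t))} \<and>
        Arg (bcurve t (of_real (\<sigma> t))) = \<sigma> t"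
      using \<sigma>(1) ev10
    proof eventually_elim
      case (elim t)
      have "is_arg_max (\<lambda>s. - kappa (Arg (bcurve t (of_real s))) t) (\<lambda>s. s \<in> {0..pi / 2}) s
          \<longleftrightarrow> is_arg_max (\<lambda>s. - kappa s t) (\<lambda>s. s \<in> {0..pi / 2}) s" for s
        unfolding is_arg_max_def using Arg_bcurve[OF elim(2)] by (metis (no_types, lifting))
      then have "{s. is_arg_max (\<lambda>s. - kappa (Arg (bcurve t (of_real s))) t) (\<lambda>s. s \<in> {0..pi / 2}) s} = {\<sigma> t}"
        using elim(1) by simp
      from is_arg_max_Gamma_pp[where \<phi>="\<lambda>x. - kappa (Arg x) t", OF elim(2) this] show ?case
        by (simp add: is_arg_max_def is_arg_min_def)
    qed
    have "(\<lambda>t. Arg (bcurve t (of_real (\<sigma> t))) - arccos (sqrt (3 / 5))) \<in> O[at_right 0](\<lambda>t. t)"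
      by (rule landau_o.big.in_cong[THEN iffD2, OF _ \<sigma>(2)]) (use fin in \<open>auto elim: eventually_mono\<close>)
    with fin show ?thesis
      by (intro exI[of _ "\<lambda>t. bcurve t (of_real (\<sigma> t))"]) (auto elim: eventually_mono)
  qed
  show "\<exists>P :: real \<Rightarrow> complex.
        \<forall>\<^sub>F t in at_right 0.
           {x. is_arg_min norm (\<lambda>x. x \<in> Gamma_pp t) x} = {P t} \<and>
           Arg (P t) = 0 \<and>
           closure (Omega t \<inter> {x. Im x = 0}) = closed_segment (- P t) (P t) \<and>
           diameter (Omega t \<inter> {x. Im x = 0}) < diameter (Omega t \<inter> {x. Re x = 0})"
    by (intro exI[of _ "\<lambda>t. bcurve t 0"] eventually_mono[OF ev10 shortest_axis])
qed

end
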